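(* There is a functor $P:\mathbf{KJBM}\to\mathbf{DFC}^{\mathrm{core}}$ given on objects by $Y\mapsto P(Y)$ and on isomorphisms by $f\mapsto P(f)$, where $P(Y)$ and $P(f)$ are the constructions described in the context.
   Context: **Many-to-one posets.** A many-to-one poset (MOP) is a finite set $P$ (of cells) with $\dim:P\to\mathbb N\cup\{-1\}$ (write $P_k=\dim^{-1}(k)$) and maps $\delta,\gamma:P_{k+1}\to\mathcal P(P_k)$ for each $k\ge-1$, such that: if $\dim x\ge 0$ then $\gamma(x)$ is a singleton; if $\delta(x)\cap\gamma(x)\ne\emptyset$ then $\delta(x)=\gamma(x)$; there is a unique cell $\ast$ of dimension $-1$, and $\gamma(x)\setminus\delta(x)=\{\ast\}$ whenever $\dim x=0$. Write $y\prec^- x$ iff $y\in\delta(x)\setminus\gamma(x)$; $y\prec^+x$ iff $y\in\gamma(x)\setminus\delta(x)$; $y\prec^\circ x$ iff $y\in\delta(x)\cap\gamma(x)$ ($x$ is then a loop on $y$); $y\prec x$ iff $y\in\partial(x):=\delta(x)\cup\gamma(x)$. The reflexive transitive closure of $\prec$ is a partial order on $P$. We identify $\gamma(x)$ with its unique element. $\delta$, $\gamma$, $\partial$ extend to sets of cells by unions. Put $\gamma^+(x)=\gamma(x)\setminus\delta(x)$, $\Lambda=P\setminus\gamma^+(P)$. Finally, a MOP carries, for each $x\in\Lambda$ and $z\in\partial^2(x)$, a total order $\triangleleft$ on $\{y\mid z\prec^\circ y\prec^- x\}$ (the local order). A morphism of MOPs $f:C\to D$ is a dimension-preserving map such that for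 every $x$ with $\dim x\ge0$, $f$ restricts to a bijection $\delta(x)\to\delta(f(x))$ and $f(\gamma(x))=\gamma(f(x))$, and $f$ preserves local orders. Signs $+,-,\circ$ are multiplied as $+1,-1,0$. **DFC.** A dendritic face complex (DFC) is a MOP $C$ such that: (greatest element) $C$ has a greatest element, of dimension $\ge0$; (loops) if $z\prec^\circ y$ there is $x$ with $y\prec^+x$; (oriented thinness) if $z\prec^\beta y\prec^\alpha x$ with $\alpha,\beta\neq\circ$, there is a unique $y'\ne y$ with $z\prec y'\prec x$, and moreover, writing $z\prec^{\beta'}y'\prec^{\alpha'}x$, one has $\alpha\beta=-\alpha'\beta'$; and if $z\prec^\circ y\prec^-x$ there is $y'$ ($\neq y$) with $z\prec^\beta y'\prec^\alpha x$ and $(\alpha,\beta)\ne(-,\circ)$; (acyclicity) for $\dim x\ge1$ there are no $p\ge1$ and $y_1,\dots,y_p\prec^-x$ with $\gamma(y_{i+1})\prec^+y_{i+1}$ and $\gamma(y_{i+1})\prec^- y_i$ for all $i$ (indices mod $p$). $\mathbf{DFC}$ is the full subcategory of MOPs on DFCs, $\mathbf{DFC}^{\mathrm{core}}$ its groupoid of isomorphisms. **Trees.** A rooted tree $T$ consists of finite sets $T^\bullet$ of nodes and $E(T)$ of edges; each node has exactly one target edge (it is then the source node of that edge; an edge has at most one source node); each edge $b$ has at most one target node $a$ (then $b$ is called a source of $a$); a distinguished root edge $\rho(T)$ has no target node; and from every edge there is a descending path to $\rho(T)$. Here a descending path from $x$ to $y$ is an alternating sequence of nodes and edges (possibly of length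 one) from $x$ to $y$, each term being the target of the previous one; write $x\sqsubseteq y$ if one exists. Leaves ($T^{|}$) are edges without source node; null dots are nodes without sources. A unit tree has no node and a single edge; a corolla has exactly one node; a tree is linear if each node has exactly one source. A subdivision $W$ of $T$ is a finite totally ordered set $W(b)$ for each edge $b$; the subdivided tree $T'=(T,W)$ is seen as a rooted tree by inserting the elements of $W(b)$ as nodes on $b$, in increasing order starting nearest the root. Put $\mathrm{blackdots}(T')=T^\bullet$, $\mathrm{whitedots}(T')=\bigsqcup_bW(b)$, $\mathrm{dots}(T')$ their union (for a tree $U$ without subdivision, $\mathrm{dots}(U)=U^\bullet$). **Opetopes.** A constellation $T\to U$ of rooted trees is a subdivision $T'$ of $T$ with bijections $\sigma_\bullet:\mathrm{blackdots}(T')\to U^{|}$ and $\sigma_\circ:\mathrm{whitedots}(T')\to\{\text{null dots of }U\}$ such that, with $\sigma=\sigma_\bullet+\sigma_\circ$, for each $x\in\mathrm{dots}(U)$ the set $\{t\in\mathrm{dots}(T')\mid\sigma(t)\sqsubseteq x\}$ induces a connected full subgraph of $T'$ (kernel rule). It is exact if $\sigma_\bullet,\sigma_\circ$ are identities. An $n$-opetope is a sequence of exact constellations $T_0\to\cdots\to T_n$ where $T_0$ has one root, one leaf and one node; if $n\ge1$, $T_1$ has the same form; if $n\ge2$, $T_2$ is linear. An isomorphism of $n$-opetopes is a sequence of isomorphisms of (subdivided) trees compatible with the structural maps of the constellations. $\mathbf{KJBM}$ is the category of opetopes and their isomorphisms. **The construction $P$.** Let $Y=(S_0\to\cdots\to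 S_n)$ be an $n$-opetope. Extend it by the corolla $S_{n+1}$ with node $\top$ and set of leaves $S_n^\bullet$, and the unit tree $S_{n+2}$ with root edge $\top$; $S_n$ and $S_{n+1}$ are given the empty subdivision, which gives two exact constellations $S_n\to S_{n+1}\to S_{n+2}$; $S_k'$ is the subdivided tree associated to $S_k$ for $k<n+2$. Write $\bot=\rho(S_1)$. For $0\le k\le n+1$ and $x$ a node or edge of $S_{k+1}$ let $\mathcal O_{k,x}=\{y\in\mathrm{dots}(S_k')\mid y\sqsubseteq x\text{ in }S_{k+1}\}$; by the kernel rule it induces a connected full subgraph of $S'_k$, that is a subdivided subtree of $S'_k$, whose underlying rooted tree is denoted $S_{k,x}$ (nodes: the nodes of $S_k$ in $\mathcal O_{k,x}$; edges: the edges of $S_k$ adjacent to them; if $\mathcal O_{k,x}$ consists only of white dots, they lie on one edge of $S_k$ and $S_{k,x}$ is the unit tree on that edge). $P(Y)$ is the MOP with $P(Y)_{-1}=\{\bot\}$, $P(Y)_k=E(S_{k+2})$ for $0\le k\le n$; $\gamma(x)=\rho(S_{k+1,x})$ for $x\in P(Y)_k$, $k\ge0$; $\delta(x)=S_{k+1,x}^{|}$ for $k>0$ and $\delta(x)=\emptyset$ for $k=0$; local order: if $y\ne y'$, $z\prec^\circ y\prec^-x$, $z\prec^\circ y'\prec^-x$ with $x\in P(Y)_k$, then $\mathcal O_{k,y}$, $\mathcal O_{k,y'}$ are disjoint sets of successive white dots on the edge $z$ of $S_k$, and $y\triangleleft y'$ iff $\mathcal O_{k,y}<\mathcal O_{k,y'}$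 in the subdivision order. For an isomorphism $f:Y\to Y'$ of opetopes (extended to degrees $n+1,n+2$ along the extensions of $Y$ and $Y'$), $P(f):P(Y)\to P(Y')$ is $f$ on every element.
   Formalization: In oriented thinness, y' is taken as the unique y' ≠ y with z ≺ y' ≺ x that satisfies αβ = −α'β' (so loops are not counted); uniqueness among all y' fails for P(Y) when a loop on z lies among the sources of x. *)

theory Defs
  imports Main "HOL-Library.FuncSet"
begin

section \<open>Categories and functors\<close>

text \<open>Hom-sets are indexed by their endpoints and need not be disjoint, so composition and the
  action of a functor on arrows take the endpoints as arguments.\<close>

record ('o, 'm) cat =
  obj :: "'o set"
  hom :: "'o \<Rightarrow> 'o \<Rightarrow> 'm set"
  ident :: "'o \<Rightarrow> 'm"
  cmp :: "'o \<Rightarrow> 'o \<Rightarrow> 'o \<Rightarrow> 'm \<Rightarrow> 'm \<Rightarrow> 'm"  \<comment> \<open>\<open>cmp C X Y Z g f\<close> is g after f, for f from X to Y and g from Y to Z\<close>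

definition is_category :: "('o, 'm) cat \<Rightarrow> bool" where
  "is_category C \<longleftrightarrow>
     (\<forall>X\<in>obj C. ident C X \<in> hom C X X) \<and>
     (\<forall>X\<in>obj C. \<forall>Y\<in>obj C. \<forall>Z\<in>obj C. \<forall>f\<in>hom C X Y. \<forall>g\<in>hom C Y Z.
        cmp C X Y Z g f \<in> hom C X Z) \<and>
     (\<forall>X\<in>obj C. \<forall>Y\<in>obj C. \<forall>f\<in>hom C X Y.
        cmp C X Y Y (ident C Y) f = f \<and> cmp C X X Y f (ident C X) = f) \<and>
     (\<forall>X\<in>obj C. \<forall>Y\<in>obj C. \<forall>Z\<in>obj C. \<forall>V\<in>obj C.
        \<forall>f\<in>hom C X Y. \<forall>g\<in>hom C Y Z. \<forall>h\<in>hom C Z V.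
        cmp C X Z V h (cmp C X Y Z g f) = cmp C X Y V (cmp C Y Z V h g) f)"

definition is_functor ::
  "('o, 'm) cat \<Rightarrow> ('p, 'k) cat \<Rightarrow> ('o \<Rightarrow> 'p) \<Rightarrow> ('o \<Rightarrow> 'o \<Rightarrow> 'm \<Rightarrow> 'k) \<Rightarrow> bool" where
  "is_functor C D F0 F1 \<longleftrightarrow>
     is_category C \<and> is_category D \<and>
     (\<forall>X\<in>obj C. F0 X \<in> obj D) \<and>
     (\<forall>X\<in>obj C. \<forall>Y\<in>obj C. \<forall>f\<in>hom C X Y. F1 X Y f \<in> hom D (F0 X) (F0 Y)) \<and>
     (\<forall>X\<in>obj C. F1 X X (ident C X) = ident D (F0 X)) \<and>
     (\<forall>X\<in>obj C. \<forall>Y\<in>obj C. \<forall>Z\<in>obj C. \<forall>f\<in>hom C X Y. \<forall>g\<in>hom C Y Z.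
        F1 X Z (cmp C X Y Z g f) = cmp D (F0 X) (F0 Y) (F0 Z) (F1 Y Z g) (F1 X Y f))"

definition full_subcat :: "('o, 'm) cat \<Rightarrow> 'o set \<Rightarrow> ('o, 'm) cat" where
  "full_subcat C A = C\<lparr>obj := obj C \<inter> A\<rparr>"

definition core :: "('o, 'm) cat \<Rightarrow> ('o, 'm) cat" where
  "core C = C\<lparr>hom := (\<lambda>X Y. {f \<in> hom C X Y. \<exists>g\<in>hom C Y X.
      cmp C X Y X g f = ident C X \<and> cmp C Y X Y f g = ident C Y})\<rparr>"


section \<open>Many-to-one posets\<close>

text \<open>\<open>lord C x z\<close> is the (strict) local order on the cells y with z a loop base of y
  and y a non-target source of x.\<close>

record 'c mop =
  cells :: "'c set"
  dim :: "'c \<Rightarrow> int"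
  dlt :: "'c \<Rightarrow> 'c set"
  gam :: "'c \<Rightarrow> 'c set"
  lord :: "'c \<Rightarrow> 'c \<Rightarrow> ('c \<times> 'c) set"

definition bd :: "'c mop \<Rightarrow> 'c \<Rightarrow> 'c set" where
  "bd C x = dlt C x \<union> gam C x"

definition prec :: "'c mop \<Rightarrow> 'c \<Rightarrow> 'c \<Rightarrow> bool" where
  "prec C y x \<longleftrightarrow> x \<in> cells C \<and> y \<in> bd C x"

definition prec_minus :: "'c mop \<Rightarrow> 'c \<Rightarrow> 'c \<Rightarrow> bool" where
  "prec_minus C y x \<longleftrightarrow> x \<in> cells C \<and> y \<in> dlt C x - gam C x"

definition prec_plus :: "'c mop \<Rightarrow> 'c \<Rightarrow> 'c \<Rightarrow> bool" where
  "prec_plus C y x \<longleftrightarrow> x \<in> cells C \<and> y \<in> gam C x - dlt C x"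

definition prec_loop :: "'c mop \<Rightarrow> 'c \<Rightarrow> 'c \<Rightarrow> bool" where
  "prec_loop C y x \<longleftrightarrow> x \<in> cells C \<and> y \<in> dlt C x \<inter> gam C x"

text \<open>Signs are encoded as the integers -1, 1 and 0.\<close>

definition prec_sign :: "'c mop \<Rightarrow> int \<Rightarrow> 'c \<Rightarrow> 'c \<Rightarrow> bool" where
  "prec_sign C s y x \<longleftrightarrow>
     s = -1 \<and> prec_minus C y x \<or> s = 1 \<and> prec_plus C y x \<or> s = 0 \<and> prec_loop C y x"

definition gam_plus :: "'c mop \<Rightarrow> 'c \<Rightarrow> 'c set" where
  "gam_plus C x = gam C x - dlt C x"

definition Lam :: "'c mop \<Rightarrow> 'c set" where
  "Lam C = cells C - (\<Union>x\<in>cells C. gam_plus C x)"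

definition bd2 :: "'c mop \<Rightarrow> 'c \<Rightarrow> 'c set" where
  "bd2 C x = (\<Union>y\<in>bd C x. bd C y)"

definition loops_at :: "'c mop \<Rightarrow> 'c \<Rightarrow> 'c \<Rightarrow> 'c set" where
  "loops_at C x z = {y. prec_loop C z y \<and> prec_minus C y x}"

definition strict_total_order_on :: "'c set \<Rightarrow> ('c \<times> 'c) set \<Rightarrow> bool" where
  "strict_total_order_on A r \<longleftrightarrow> r \<subseteq> A \<times> A \<and> irrefl r \<and> trans r \<and> total_on A r"

text \<open>All components are given fixed values outside their domains (in particular the two face
  maps are empty on the cell of dimension -1), so that equality of records is equality
  of many-to-one posets.\<close>

definition is_mop :: "'c mop \<Rightarrow> bool" where
  "is_mop C \<longleftrightarrow>
     finite (cells C) \<and>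
     dim C \<in> extensional (cells C) \<and>
     (\<forall>x\<in>cells C. dim C x \<ge> -1) \<and>
     (\<forall>x\<in>cells C. dim C x \<ge> 0 \<longrightarrow> bd C x \<subseteq> {y \<in> cells C. dim C y = dim C x - 1}) \<and>
     (\<forall>x. x \<notin> cells C \<or> dim C x = -1 \<longrightarrow> dlt C x = {} \<and> gam C x = {}) \<and>
     (\<forall>x\<in>cells C. dim C x \<ge> 0 \<longrightarrow> is_singleton (gam C x)) \<and>
     (\<forall>x\<in>cells C. dlt C x \<inter> gam C x \<noteq> {} \<longrightarrow> dlt C x = gam C x) \<and>
     (\<exists>s. {x \<in> cells C. dim C x = -1} = {s} \<and>
          (\<forall>x\<in>cells C. dim C x = 0 \<longrightarrow> gam C x - dlt C x = {s})) \<and>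
     (\<forall>x z. if x \<in> Lam C \<and> z \<in> bd2 C x
            then strict_total_order_on (loops_at C x z) (lord C x z)
            else lord C x z = {})"

definition mop_morphism :: "'c mop \<Rightarrow> 'c mop \<Rightarrow> ('c \<Rightarrow> 'c) \<Rightarrow> bool" where
  "mop_morphism C D f \<longleftrightarrow>
     f \<in> cells C \<rightarrow>\<^sub>E cells D \<and>
     (\<forall>x\<in>cells C. dim D (f x) = dim C x) \<and>
     (\<forall>x\<in>cells C. dim C x \<ge> 0 \<longrightarrow>
        bij_betw f (dlt C x) (dlt D (f x)) \<and> f ` gam C x = gam D (f x)) \<and>
     (\<forall>x\<in>Lam C. \<forall>z\<in>bd2 C x. \<forall>y y'.
        (y, y') \<in> lord C x z \<longrightarrow> (f y, f y') \<in> lord D (f x) (f z))"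

definition MOP :: "('c mop, 'c \<Rightarrow> 'c) cat" where
  "MOP = \<lparr>obj = Collect is_mop,
          hom = (\<lambda>C D. Collect (mop_morphism C D)),
          ident = (\<lambda>C. restrict id (cells C)),
          cmp = (\<lambda>C D E g f. compose (cells C) g f)\<rparr>"


section \<open>Dendritic face complexes\<close>

definition has_greatest_cell :: "'c mop \<Rightarrow> bool" where
  "has_greatest_cell C \<longleftrightarrow>
     (\<exists>t\<in>cells C. dim C t \<ge> 0 \<and> (\<forall>y\<in>cells C. (prec C)\<^sup>*\<^sup>* y t))"

definition loops_axiom :: "'c mop \<Rightarrow> bool" where
  "loops_axiom C \<longleftrightarrow> (\<forall>z y. prec_loop C z y \<longrightarrow> (\<exists>x. prec_plus C y x))"

text \<open>In the first clause the sign rule is part of what y' is the unique solution of. It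
  excludes loops, since \<open>\<alpha> * \<beta>\<close> is nonzero. Uniqueness among all cells between
  z and x would be too strong: there may also be loops on z among the sources of x.\<close>

definition oriented_thinness :: "'c mop \<Rightarrow> bool" where
  "oriented_thinness C \<longleftrightarrow>
     (\<forall>x y z \<alpha> \<beta>. prec_sign C \<beta> z y \<and> prec_sign C \<alpha> y x \<and> \<alpha> \<noteq> 0 \<and> \<beta> \<noteq> 0 \<longrightarrow>
        (\<exists>!y'. y' \<noteq> y \<and> (\<exists>\<alpha>' \<beta>'. prec_sign C \<beta>' z y' \<and> prec_sign C \<alpha>' y' x \<and>
                                \<alpha> * \<beta> = - (\<alpha>' * \<beta>')))) \<and>
     (\<forall>x y z. prec_loop C z y \<and> prec_minus C y x \<longrightarrow>
        (\<exists>y' \<alpha> \<beta>. y' \<noteq> y \<and> prec_sign C \<beta> z y' \<and> prec_sign C \<alpha> y' x \<and> (\<alpha>, \<beta>) \<noteq> (-1, 0)))"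

definition acyclicity :: "'c mop \<Rightarrow> bool" where
  "acyclicity C \<longleftrightarrow>
     (\<forall>x\<in>cells C. dim C x \<ge> 1 \<longrightarrow>
        \<not> (\<exists>p\<ge>1. \<exists>y :: nat \<Rightarrow> 'c. \<forall>i<p.
              prec_minus C (y i) x \<and>
              prec_plus C (the_elem (gam C (y (Suc i mod p)))) (y (Suc i mod p)) \<and>
              prec_minus C (the_elem (gam C (y (Suc i mod p)))) (y i)))"

definition is_dfc :: "'c mop \<Rightarrow> bool" where
  "is_dfc C \<longleftrightarrow> is_mop C \<and> has_greatest_cell C \<and> loops_axiom C \<and>
     oriented_thinness C \<and> acyclicity C"

definition DFC :: "('c mop, 'c \<Rightarrow> 'c) cat" where
  "DFC = full_subcat MOP (Collect is_dfc)"

definition DFC_core :: "('c mop, 'c \<Rightarrow> 'c) cat" where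
  "DFC_core = core DFC"


section \<open>Rooted trees\<close>

text \<open>\<open>(a, b) \<in> tgt_edge T\<close>: the edge b is the target of the node a.
  \<open>(b, a) \<in> tgt_node T\<close>: the node a is the target of the edge b, i.e. b is a source of a.\<close>

record ('n, 'e) tree =
  nodes :: "'n set"
  edges :: "'e set"
  tgt_edge :: "('n \<times> 'e) set"
  tgt_node :: "('e \<times> 'n) set"
  root :: 'e

datatype ('n, 'e) elt = Node 'n | Edge 'e

definition elts :: "('n, 'e) tree \<Rightarrow> ('n, 'e) elt set" where
  "elts T = Node ` nodes T \<union> Edge ` edges T"

definition target_step :: "('n, 'e) tree \<Rightarrow> (('n, 'e) elt \<times> ('n, 'e) elt) set" where
  "target_step T = {(Node a, Edge b) | a b. (a, b) \<in> tgt_edge T} \<union>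
                   {(Edge b, Node a) | a b. (b, a) \<in> tgt_node T}"

definition desc :: "('n, 'e) tree \<Rightarrow> ('n, 'e) elt \<Rightarrow> ('n, 'e) elt \<Rightarrow> bool" where
  "desc T x y \<longleftrightarrow> x \<in> elts T \<and> y \<in> elts T \<and> (x, y) \<in> (target_step T)\<^sup>*"

definition rooted_tree :: "('n, 'e) tree \<Rightarrow> bool" where
  "rooted_tree T \<longleftrightarrow>
     finite (nodes T) \<and> finite (edges T) \<and>
     tgt_edge T \<subseteq> nodes T \<times> edges T \<and> tgt_node T \<subseteq> edges T \<times> nodes T \<and>
     (\<forall>a\<in>nodes T. \<exists>!b. (a, b) \<in> tgt_edge T) \<and>
     (\<forall>a a' b. (a, b) \<in> tgt_edge T \<and> (a', b) \<in> tgt_edge T \<longrightarrow> a = a') \<and>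
     (\<forall>a a' b. (b, a) \<in> tgt_node T \<and> (b, a') \<in> tgt_node T \<longrightarrow> a = a') \<and>
     root T \<in> edges T \<and> (\<forall>a. (root T, a) \<notin> tgt_node T) \<and>
     (\<forall>b\<in>edges T. desc T (Edge b) (Edge (root T)))"

definition leaves :: "('n, 'e) tree \<Rightarrow> 'e set" where
  "leaves T = {b \<in> edges T. \<forall>a. (a, b) \<notin> tgt_edge T}"

definition null_dots :: "('n, 'e) tree \<Rightarrow> 'n set" where
  "null_dots T = {a \<in> nodes T. \<forall>b. (b, a) \<notin> tgt_node T}"

definition linear_tree :: "('n, 'e) tree \<Rightarrow> bool" where
  "linear_tree T \<longleftrightarrow> (\<forall>a\<in>nodes T. \<exists>!b. (b, a) \<in> tgt_node T)"

definition unit_tree :: "'e \<Rightarrow> ('n, 'e) tree" where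
  "unit_tree b = \<lparr>nodes = {}, edges = {b}, tgt_edge = {}, tgt_node = {}, root = b\<rparr>"

definition corolla :: "'n \<Rightarrow> 'e set \<Rightarrow> 'e \<Rightarrow> ('n, 'e) tree" where
  "corolla a L r = \<lparr>nodes = {a}, edges = insert r L, tgt_edge = {(a, r)},
                    tgt_node = L \<times> {a}, root = r\<rparr>"

text \<open>A finite totally ordered set is given as the list of its elements in increasing order.\<close>

definition subdivision :: "('n, 'e) tree \<Rightarrow> ('e \<Rightarrow> 'w list) \<Rightarrow> bool" where
  "subdivision T W \<longleftrightarrow>
     (\<forall>b. b \<notin> edges T \<longrightarrow> W b = []) \<and> (\<forall>b\<in>edges T. distinct (W b)) \<and>
     (\<forall>b\<in>edges T. \<forall>b'\<in>edges T. b \<noteq> b' \<longrightarrow> set (W b) \<inter> set (W b') = {})"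

definition whitedots :: "('n, 'e) tree \<Rightarrow> ('e \<Rightarrow> 'w list) \<Rightarrow> 'w set" where
  "whitedots T W = (\<Union>b\<in>edges T. set (W b))"

datatype ('b, 'w) dot = Black 'b | White 'w

text \<open>The edge b of T is cut into the segments \<open>(b, 0), \<dots>, (b, length (W b))\<close>, numbered
  starting nearest the root; \<open>W b ! i\<close> is the node between the segments i and i + 1.\<close>

definition subdivided :: "('n, 'e) tree \<Rightarrow> ('e \<Rightarrow> 'w list) \<Rightarrow> (('n, 'w) dot, 'e \<times> nat) tree" where
  "subdivided T W =
     \<lparr>nodes = Black ` nodes T \<union> White ` whitedots T W,
      edges = {(b, i). b \<in> edges T \<and> i \<le> length (W b)},
      tgt_edge = {(Black a, (b, length (W b))) | a b. (a, b) \<in> tgt_edge T} \<union>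
                 {(White (W b ! i), (b, i)) | b i. b \<in> edges T \<and> i < length (W b)},
      tgt_node = {((b, 0), Black a) | a b. (b, a) \<in> tgt_node T} \<union>
                 {((b, Suc i), White (W b ! i)) | b i. b \<in> edges T \<and> i < length (W b)},
      root = (root T, 0)\<rparr>"

abbreviation "dots T W \<equiv> nodes (subdivided T W)"

definition adjacent :: "('n, 'e) tree \<Rightarrow> 'n \<Rightarrow> 'n \<Rightarrow> bool" where
  "adjacent T u v \<longleftrightarrow> (\<exists>b. (u, b) \<in> tgt_edge T \<and> (b, v) \<in> tgt_node T \<or>
                           (v, b) \<in> tgt_edge T \<and> (b, u) \<in> tgt_node T)"

definition induces_connected :: "('n, 'e) tree \<Rightarrow> 'n set \<Rightarrow> bool" where
  "induces_connected T A \<longleftrightarrow>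
     (\<forall>u\<in>A. \<forall>v\<in>A. (u, v) \<in> {(s, t). s \<in> A \<and> t \<in> A \<and> adjacent T s t}\<^sup>*)"


section \<open>Constellations and opetopes\<close>

fun dot_map :: "('n \<Rightarrow> 'f) \<Rightarrow> ('w \<Rightarrow> 'm) \<Rightarrow> ('n, 'w) dot \<Rightarrow> ('m, 'f) elt" where
  "dot_map \<sigma>b \<sigma>w (Black a) = Edge (\<sigma>b a)"
| "dot_map \<sigma>b \<sigma>w (White w) = Node (\<sigma>w w)"

definition constellation ::
  "('n, 'e) tree \<Rightarrow> ('e \<Rightarrow> 'w list) \<Rightarrow> ('m, 'f) tree \<Rightarrow> ('n \<Rightarrow> 'f) \<Rightarrow> ('w \<Rightarrow> 'm) \<Rightarrow> bool" where
  "constellation T W U \<sigma>b \<sigma>w \<longleftrightarrow>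
     rooted_tree T \<and> rooted_tree U \<and> subdivision T W \<and>
     bij_betw \<sigma>b (nodes T) (leaves U) \<and>
     bij_betw \<sigma>w (whitedots T W) (null_dots U) \<and>
     (\<forall>x\<in>nodes U. induces_connected (subdivided T W)
        {t \<in> dots T W. desc U (dot_map \<sigma>b \<sigma>w t) (Node x)})"

definition exact_constellation ::
  "('n, 'e) tree \<Rightarrow> ('e \<Rightarrow> 'w list) \<Rightarrow> ('w, 'n) tree \<Rightarrow> bool" where
  "exact_constellation T W U \<longleftrightarrow> constellation T W U id id"

text \<open>Exactness makes the leaves of each tree the nodes of the previous one, so nodes and edges
  of all trees are named by elements of one type. An opetope of dimension n has n + 1 trees and
  n subdivisions, the last tree not being subdivided.\<close>

record 'a opetope =
  trees :: "('a, 'a) tree list"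
  subs :: "('a \<Rightarrow> 'a list) list"

definition one_node_one_leaf :: "('n, 'e) tree \<Rightarrow> bool" where
  "one_node_one_leaf T \<longleftrightarrow> rooted_tree T \<and> card (nodes T) = 1 \<and> card (leaves T) = 1"

definition n_opetope :: "nat \<Rightarrow> 'a opetope \<Rightarrow> bool" where
  "n_opetope n Y \<longleftrightarrow>
     length (trees Y) = Suc n \<and> length (subs Y) = n \<and>
     (\<forall>k<n. exact_constellation (trees Y ! k) (subs Y ! k) (trees Y ! Suc k)) \<and>
     one_node_one_leaf (trees Y ! 0) \<and>
     (n \<ge> 1 \<longrightarrow> one_node_one_leaf (trees Y ! 1)) \<and>
     (n \<ge> 2 \<longrightarrow> linear_tree (trees Y ! 2))"

definition op_dim :: "'a opetope \<Rightarrow> nat" where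
  "op_dim Y = length (subs Y)"

definition sub_at :: "'a opetope \<Rightarrow> nat \<Rightarrow> 'a \<Rightarrow> 'a list" where
  "sub_at Y k = (if k < op_dim Y then subs Y ! k else (\<lambda>_. []))"

record ('n, 'e, 'w) tree_map =
  on_nodes :: "'n \<Rightarrow> 'n"
  on_edges :: "'e \<Rightarrow> 'e"
  on_white :: "'w \<Rightarrow> 'w"

definition subdivided_tree_iso ::
  "('n, 'e) tree \<Rightarrow> ('e \<Rightarrow> 'w list) \<Rightarrow> ('n, 'e) tree \<Rightarrow> ('e \<Rightarrow> 'w list) \<Rightarrow>
   ('n, 'e, 'w) tree_map \<Rightarrow> bool" where
  "subdivided_tree_iso T W T' W' f \<longleftrightarrow>
     on_nodes f \<in> extensional (nodes T) \<and> bij_betw (on_nodes f) (nodes T) (nodes T') \<and>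
     on_edges f \<in> extensional (edges T) \<and> bij_betw (on_edges f) (edges T) (edges T') \<and>
     on_white f \<in> extensional (whitedots T W) \<and>
     bij_betw (on_white f) (whitedots T W) (whitedots T' W') \<and>
     tgt_edge T' = map_prod (on_nodes f) (on_edges f) ` tgt_edge T \<and>
     tgt_node T' = map_prod (on_edges f) (on_nodes f) ` tgt_node T \<and>
     root T' = on_edges f (root T) \<and>
     (\<forall>b\<in>edges T. W' (on_edges f b) = map (on_white f) (W b))"

type_synonym 'a opetope_map = "('a, 'a, 'a) tree_map list"

text \<open>The last two conditions are compatibility with the structural maps of the constellations,
  which are identities.\<close>

definition opetope_iso :: "'a opetope \<Rightarrow> 'a opetope \<Rightarrow> 'a opetope_map \<Rightarrow> bool" where
  "opetope_iso Y Y' f \<longleftrightarrow>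
     op_dim Y' = op_dim Y \<and> length f = Suc (op_dim Y) \<and>
     (\<forall>k\<le>op_dim Y. subdivided_tree_iso (trees Y ! k) (sub_at Y k)
                       (trees Y' ! k) (sub_at Y' k) (f ! k)) \<and>
     (\<forall>k<op_dim Y.
        (\<forall>a\<in>nodes (trees Y ! k). on_edges (f ! Suc k) a = on_nodes (f ! k) a) \<and>
        (\<forall>w\<in>whitedots (trees Y ! k) (subs Y ! k). on_nodes (f ! Suc k) w = on_white (f ! k) w))"

definition opetope_id :: "'a opetope \<Rightarrow> 'a opetope_map" where
  "opetope_id Y = map (\<lambda>k.
     \<lparr>on_nodes = restrict id (nodes (trees Y ! k)),
      on_edges = restrict id (edges (trees Y ! k)),
      on_white = restrict id (whitedots (trees Y ! k) (sub_at Y k))\<rparr>) [0..<Suc (op_dim Y)]"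

definition opetope_comp :: "'a opetope \<Rightarrow> 'a opetope_map \<Rightarrow> 'a opetope_map \<Rightarrow> 'a opetope_map" where
  "opetope_comp Y g f = map (\<lambda>k.
     \<lparr>on_nodes = compose (nodes (trees Y ! k)) (on_nodes (g ! k)) (on_nodes (f ! k)),
      on_edges = compose (edges (trees Y ! k)) (on_edges (g ! k)) (on_edges (f ! k)),
      on_white = compose (whitedots (trees Y ! k) (sub_at Y k))
                   (on_white (g ! k)) (on_white (f ! k))\<rparr>) [0..<Suc (op_dim Y)]"

definition KJBM :: "('a opetope, 'a opetope_map) cat" where
  "KJBM = \<lparr>obj = {Y. \<exists>n. n_opetope n Y},
           hom = (\<lambda>Y Y'. Collect (opetope_iso Y Y')),
           ident = opetope_id,
           cmp = (\<lambda>Y Y' Y'' g f. opetope_comp Y g f)\<rparr>"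


section \<open>The extension of an opetope by two degrees\<close>

text \<open>\<open>Top\<close> names both the node of the added corolla and the edge of the added unit tree;
  \<open>Top_Root\<close> names the root edge of the corolla. The constructor \<open>Old\<close> makes both fresh.\<close>

datatype 'a ext = Old 'a | Top | Top_Root

definition old_tree :: "('a, 'a) tree \<Rightarrow> ('a ext, 'a ext) tree" where
  "old_tree T = \<lparr>nodes = Old ` nodes T, edges = Old ` edges T,
     tgt_edge = map_prod Old Old ` tgt_edge T, tgt_node = map_prod Old Old ` tgt_node T,
     root = Old (root T)\<rparr>"

definition ext_tree :: "'a opetope \<Rightarrow> nat \<Rightarrow> ('a ext, 'a ext) tree" where
  "ext_tree Y k =
     (if k \<le> op_dim Y then old_tree (trees Y ! k)
      else if k = Suc (op_dim Y) then corolla Top (Old ` nodes (trees Y ! op_dim Y)) Top_Root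
      else unit_tree Top)"

definition ext_sub :: "'a opetope \<Rightarrow> nat \<Rightarrow> 'a ext \<Rightarrow> 'a ext list" where
  "ext_sub Y k b = (case b of Old e \<Rightarrow> map Old (sub_at Y k e) | _ \<Rightarrow> [])"

definition ext_map_edges :: "'a opetope \<Rightarrow> 'a opetope_map \<Rightarrow> nat \<Rightarrow> 'a ext \<Rightarrow> 'a ext" where
  "ext_map_edges Y f k b = (case b of
       Old e \<Rightarrow> Old (if k \<le> op_dim Y then on_edges (f ! k) e else on_nodes (f ! op_dim Y) e)
     | Top \<Rightarrow> Top | Top_Root \<Rightarrow> Top_Root)"


section \<open>The construction P\<close>

definition Oset :: "'a opetope \<Rightarrow> nat \<Rightarrow> ('a ext, 'a ext) elt \<Rightarrow> ('a ext, 'a ext) dot set" where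
  "Oset Y k x = {y \<in> dots (ext_tree Y k) (ext_sub Y k).
                   desc (ext_tree Y (Suc k)) (dot_map id id y) x}"

text \<open>The underlying tree of the subdivided subtree induced by a connected set A of dots.
  If A has no black dot, it is the unit tree on the edge carrying A. The set A can be
  empty here: this happens exactly when the last tree of the opetope has no node, so that the node
  of the added corolla has no source; that last tree is then a unit tree, and the edge below
  is its only edge.\<close>

definition induced_tree ::
  "('n, 'e) tree \<Rightarrow> ('e \<Rightarrow> 'w list) \<Rightarrow> ('n, 'w) dot set \<Rightarrow> ('n, 'e) tree" where
  "induced_tree T W A =
     (let B = {a. Black a \<in> A} in
      if B = {} then unit_tree (THE b. b \<in> edges T \<and> (\<forall>w. White w \<in> A \<longrightarrow> w \<in> set (W b)))
      else \<lparr>nodes = B,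
            edges = {b \<in> edges T. \<exists>a\<in>B. (a, b) \<in> tgt_edge T \<or> (b, a) \<in> tgt_node T},
            tgt_edge = {(a, b) \<in> tgt_edge T. a \<in> B},
            tgt_node = {(b, a) \<in> tgt_node T. a \<in> B},
            root = (THE b. (\<exists>a\<in>B. (a, b) \<in> tgt_edge T) \<and> (\<forall>a\<in>B. (b, a) \<notin> tgt_node T))\<rparr>)"

definition Stree :: "'a opetope \<Rightarrow> nat \<Rightarrow> ('a ext, 'a ext) elt \<Rightarrow> ('a ext, 'a ext) tree" where
  "Stree Y k x = induced_tree (ext_tree Y k) (ext_sub Y k) (Oset Y k x)"

text \<open>A cell of dimension k is the pair of k and its name.\<close>

type_synonym 'a cell = "int \<times> 'a ext"

definition P_cells :: "'a opetope \<Rightarrow> 'a cell set" where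
  "P_cells Y = {(-1, root (ext_tree Y 1))} \<union>
               {(int k, x) | k x. k \<le> op_dim Y \<and> x \<in> edges (ext_tree Y (k + 2))}"

definition P_faces :: "'a opetope \<Rightarrow> 'a cell mop" where
  "P_faces Y =
     \<lparr>cells = P_cells Y,
      dim = restrict fst (P_cells Y),
      dlt = (\<lambda>(d, x). if (d, x) \<in> P_cells Y \<and> d > 0
                      then Pair (d - 1) ` leaves (Stree Y (nat (d + 1)) (Edge x)) else {}),
      gam = (\<lambda>(d, x). if (d, x) \<in> P_cells Y \<and> d \<ge> 0
                      then {(d - 1, root (Stree Y (nat (d + 1)) (Edge x)))} else {}),
      lord = (\<lambda>x z. {})\<rparr>"

text \<open>\<open>dots_before Y k z A B\<close>: all dots of A precede all dots of B in the order of the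
  subdivision of the edge z of the k-th tree.\<close>

definition dots_before ::
  "'a opetope \<Rightarrow> nat \<Rightarrow> 'a ext \<Rightarrow> ('a ext, 'a ext) dot set \<Rightarrow> ('a ext, 'a ext) dot set \<Rightarrow> bool" where
  "dots_before Y k z A B \<longleftrightarrow>
     (\<forall>i<length (ext_sub Y k z). \<forall>j<length (ext_sub Y k z).
        White (ext_sub Y k z ! i) \<in> A \<and> White (ext_sub Y k z ! j) \<in> B \<longrightarrow> i < j)"

definition P_obj :: "'a opetope \<Rightarrow> 'a cell mop" where
  "P_obj Y = (let C = P_faces Y in
     C\<lparr>lord := (\<lambda>x z. if x \<in> Lam C \<and> z \<in> bd2 C x
         then {(y, y'). y \<noteq> y' \<and> y \<in> loops_at C x z \<and> y' \<in> loops_at C x z \<and>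
                 dots_before Y (nat (fst x)) (snd z)
                   (Oset Y (nat (fst x)) (Edge (snd y))) (Oset Y (nat (fst x)) (Edge (snd y')))}
         else {})\<rparr>)"

definition P_arr :: "'a opetope \<Rightarrow> 'a opetope \<Rightarrow> 'a opetope_map \<Rightarrow> 'a cell \<Rightarrow> 'a cell" where
  "P_arr Y Y' f = restrict (\<lambda>(d, x). (d, ext_map_edges Y f (nat (d + 2)) x)) (P_cells Y)"

end

theory Submission
  imports Defs
begin

text \<open>
  Let \<open>T \<rightarrow> U\<close> be an exact constellation. By the kernel rule, the dots lying above an edge \<open>e\<close> of \<open>U\<close> form
  a connected set, and the faces of \<open>e\<close> can be read off its black dots: an edge of \<open>T\<close> is a
  positive face if its source node belongs to the set and its target node does not, and a negative
  face in the opposite case; if there is no black dot, then all the white dots lie on a single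
  edge, on which \<open>e\<close> is a loop. Everything that connectedness is used for comes from one remark:
  cutting a segment of the subdivided tree separates a connected set only if both ends of that
  segment belong to it.

  For \<open>x\<close> that is not a loop, the black dots above \<open>\<gamma>(x)\<close> are the disjoint union of those above the
  negative faces of \<open>x\<close>. Hence the source (or target) node of an edge \<open>z\<close> lies above \<open>\<gamma>(x)\<close> iff it lies
  above exactly one of these faces, which is oriented thinness. For acyclicity, the roots in
  a cycle would descend strictly to one another.
\<close>

section \<open>Rooted trees\<close>

text \<open>Exactness turns the nodes of one tree into edges of the next and its white dots into
  nodes of the next. Hence every axiom reduces to one constellation, or to two consecutive ones
  carrying a cell, its faces and their faces. The difficulties sit at the two ends of the sequence.
  At the upper end, the constellation to the added corolla fails to be exact when the last tree has
  no node; an auxiliary subdivision restores exactness, and faces and local orders must be shown not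
  to notice it. At the lower end, a cell of dimension 0 has no sources although the tree attached to
  it has a leaf. The signs read off the trees therefore agree with those of the poset in dimension 0
  only for faces equal to the bottom cell, and the shape of the trees of index 1 and 2 is what
  excludes loops there. Functoriality needs no further geometry: signs and positions of white dots
  are invariant under renaming, and the inverse renaming supplies the inverse morphism.\<close>

lemma desc_refl: "x \<in> elts T \<Longrightarrow> desc T x x"
  by (simp add: desc_def)

lemma desc_trans: "desc T x y \<Longrightarrow> desc T y z \<Longrightarrow> desc T x z"
  by (auto simp: desc_def)

lemma Node_elts [simp]: "Node a \<in> elts T \<longleftrightarrow> a \<in> nodes T"
  and Edge_elts [simp]: "Edge b \<in> elts T \<longleftrightarrow> b \<in> edges T"
  by (auto simp: elts_def)

lemma Node_step: "(Node a, y) \<in> target_step T \<longleftrightarrow> (\<exists>b. y = Edge b \<and> (a, b) \<in> tgt_edge T)"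
  and Edge_step: "(Edge b, y) \<in> target_step T \<longleftrightarrow> (\<exists>a. y = Node a \<and> (b, a) \<in> tgt_node T)"
  and step_Node: "(x, Node a) \<in> target_step T \<longleftrightarrow> (\<exists>b. x = Edge b \<and> (b, a) \<in> tgt_node T)"
  and step_Edge: "(x, Edge b) \<in> target_step T \<longleftrightarrow> (\<exists>a. x = Node a \<and> (a, b) \<in> tgt_edge T)"
  by (auto simp: target_step_def)

locale rtree =
  fixes T :: "('n, 'e) tree"
  assumes rooted: "rooted_tree T"
begin

lemma finite_nodes: "finite (nodes T)" and finite_edges: "finite (edges T)"
  using rooted by (auto simp: rooted_tree_def)

lemma te_sub: "(a, b) \<in> tgt_edge T \<Longrightarrow> a \<in> nodes T \<and> b \<in> edges T"
  and tn_sub: "(b, a) \<in> tgt_node T \<Longrightarrow> b \<in> edges T \<and> a \<in> nodes T"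
  using rooted unfolding rooted_tree_def by blast+

lemma te_fun: "(a, b) \<in> tgt_edge T \<Longrightarrow> (a, b') \<in> tgt_edge T \<Longrightarrow> b = b'"
  using rooted te_sub unfolding rooted_tree_def by metis

lemma te_inj: "(a, b) \<in> tgt_edge T \<Longrightarrow> (a', b) \<in> tgt_edge T \<Longrightarrow> a = a'"
  using rooted unfolding rooted_tree_def by metis

lemma tn_fun: "(b, a) \<in> tgt_node T \<Longrightarrow> (b, a') \<in> tgt_node T \<Longrightarrow> a = a'"
  using rooted unfolding rooted_tree_def by metis

lemma te_ex: "a \<in> nodes T \<Longrightarrow> \<exists>b. (a, b) \<in> tgt_edge T"
  using rooted unfolding rooted_tree_def by metis

lemma root_edge: "root T \<in> edges T" and root_tn: "(root T, a) \<notin> tgt_node T"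
  using rooted by (auto simp: rooted_tree_def)

lemma edge_desc_root: "b \<in> edges T \<Longrightarrow> desc T (Edge b) (Edge (root T))"
  using rooted by (auto simp: rooted_tree_def)

lemma step_elts: "(x, y) \<in> target_step T \<Longrightarrow> x \<in> elts T \<and> y \<in> elts T"
  using te_sub tn_sub by (auto simp: target_step_def)

lemma desc_step: "(x, y) \<in> target_step T \<Longrightarrow> desc T x y"
  by (auto simp: desc_def step_elts)

lemma desc_root: "x \<in> elts T \<Longrightarrow> desc T x (Edge (root T))"
proof (cases x)
  case (Node a)
  assume "x \<in> elts T"
  then obtain b where "(a, b) \<in> tgt_edge T" using Node te_ex by auto
  then show ?thesis using Node edge_desc_root te_sub desc_trans desc_step[of x "Edge b"]
    by (metis Node_step)
qed (auto simp: edge_desc_root)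

lemma step_sv: "single_valued (target_step T)"
  using te_fun tn_fun by (auto simp: single_valued_def target_step_def)

text \<open>Steps are deterministic, so whatever is reachable from a point of a cycle leads back to
  that point. The root edge is reachable from everywhere but has no outgoing step.\<close>

lemma step_irrefl: "(x, x) \<notin> (target_step T)\<^sup>+"
proof
  assume c: "(x, x) \<in> (target_step T)\<^sup>+"
  have cyc: "(z, x) \<in> (target_step T)\<^sup>+" if "(x, z) \<in> (target_step T)\<^sup>*" for z
    using that
  proof (induction rule: rtrancl_induct)
    case (step z z')
    then obtain z'' where "(z, z'') \<in> target_step T" "(z'', x) \<in> (target_step T)\<^sup>*"
      by (meson tranclD)
    then have "(z', x) \<in> (target_step T)\<^sup>*"
      using step_sv step.hyps by (metis single_valuedD)
    then show ?case using c by simp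
  qed (use c in simp)
  from c have "x \<in> elts T" by (meson step_elts tranclD)
  then have "(x, Edge (root T)) \<in> (target_step T)\<^sup>*" using desc_root by (auto simp: desc_def)
  from cyc[OF this] have "\<exists>y. (Edge (root T), y) \<in> target_step T" by (meson tranclD)
  then show False by (auto simp: Edge_step root_tn)
qed

lemma desc_antisym: "desc T x y \<Longrightarrow> desc T y x \<Longrightarrow> x = y"
  unfolding desc_def by (metis rtrancl_eq_or_trancl rtrancl_trancl_trancl step_irrefl)

lemma step_not_desc: "(x, y) \<in> target_step T \<Longrightarrow> \<not> desc T y x"
  using desc_antisym desc_step step_irrefl by blast

lemma desc_comparable: "desc T x y \<Longrightarrow> desc T x z \<Longrightarrow> desc T y z \<or> desc T z y"
  unfolding desc_def using single_valued_confluent[OF step_sv] by blast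

lemma desc_bottom: "desc T x y \<Longrightarrow> x = y \<or> (\<exists>x'. (x, x') \<in> target_step T \<and> desc T x' y)"
  unfolding desc_def by (metis converse_rtranclE step_elts)

lemma desc_top: "desc T x y \<Longrightarrow> x = y \<or> (\<exists>y'. (y', y) \<in> target_step T \<and> desc T x y')"
  unfolding desc_def by (metis rtranclE step_elts)

lemma desc_Edge_iff:
  "desc T x (Edge b) \<longleftrightarrow> (x = Edge b \<and> b \<in> edges T) \<or> (\<exists>a. (a, b) \<in> tgt_edge T \<and> desc T x (Node a))"
proof -
  have "(a, b) \<in> tgt_edge T \<Longrightarrow> desc T (Node a) (Edge b)" for a
    by (simp add: desc_step step_Edge)
  then show ?thesis using desc_top[of x "Edge b"]
    by (metis Edge_elts desc_def desc_refl desc_trans step_Edge)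
qed

lemma desc_Node_iff:
  "desc T x (Node a) \<longleftrightarrow> (x = Node a \<and> a \<in> nodes T) \<or> (\<exists>b. (b, a) \<in> tgt_node T \<and> desc T x (Edge b))"
proof -
  have "(b, a) \<in> tgt_node T \<Longrightarrow> desc T (Edge b) (Node a)" for b
    by (simp add: desc_step step_Node)
  then show ?thesis using desc_top[of x "Node a"]
    by (metis Node_elts desc_def desc_refl desc_trans step_Node)
qed

lemma Node_desc_iff:
  "desc T (Node a) y \<longleftrightarrow> (y = Node a \<and> a \<in> nodes T) \<or> (\<exists>b. (a, b) \<in> tgt_edge T \<and> desc T (Edge b) y)"
proof -
  have "(a, b) \<in> tgt_edge T \<Longrightarrow> desc T (Node a) (Edge b)" for b
    by (simp add: desc_step step_Edge)
  then show ?thesis using desc_bottom[of "Node a" y]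
    by (metis Node_elts desc_def desc_refl desc_trans Node_step)
qed

lemma Edge_desc_iff:
  "desc T (Edge b) y \<longleftrightarrow> (y = Edge b \<and> b \<in> edges T) \<or> (\<exists>a. (b, a) \<in> tgt_node T \<and> desc T (Node a) y)"
proof -
  have "(b, a) \<in> tgt_node T \<Longrightarrow> desc T (Edge b) (Node a)" for a
    by (simp add: desc_step step_Node)
  then show ?thesis using desc_bottom[of "Edge b" y]
    by (metis Edge_elts desc_def desc_refl desc_trans Edge_step)
qed

lemma desc_leaf: "b \<in> leaves T \<Longrightarrow> desc T x (Edge b) \<longleftrightarrow> x = Edge b"
  by (auto simp: desc_Edge_iff leaves_def)

lemma finite_elts: "finite (elts T)"
  by (simp add: elts_def finite_nodes finite_edges)

text \<open>Induction along this order assumes the claim for the elements directly above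
  \<open>x\<close>; the minimal elements are the leaves and the null dots.\<close>

lemma wf_converse_step: "wf (target_step T)"
proof (rule finite_acyclic_wf)
  have "target_step T \<subseteq> elts T \<times> elts T" using step_elts by auto
  then show "finite (target_step T)" using finite_elts by (meson finite_SigmaI finite_subset)
  show "acyclic (target_step T)" using step_irrefl by (auto simp: acyclic_def)
qed

lemma extremal_above:
  "x \<in> elts T \<Longrightarrow> (\<exists>b\<in>leaves T. desc T (Edge b) x) \<or> (\<exists>a\<in>null_dots T. desc T (Node a) x)"
proof (induction x rule: wf_induct[OF wf_converse_step])
  case (1 x)
  show ?case
  proof (cases "\<exists>y. (y, x) \<in> target_step T")
    case True
    then obtain y where "(y, x) \<in> target_step T" by blast
    then show ?thesis using 1 desc_step desc_trans step_elts by meson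
  next
    case False
    then show ?thesis using 1 desc_refl[of x T]
      by (cases x) (force simp: step_Edge step_Node leaves_def null_dots_def)+
  qed
qed

end

section \<open>Connected sets of dots\<close>

text \<open>The form in which connectedness enters the cutting argument; there \<open>P\<close> is
  \<open>above T W b i\<close>.\<close>

lemma connected_constant:
  assumes "induces_connected T A" "s \<in> A" "t \<in> A"
    and "\<And>u v. u \<in> A \<Longrightarrow> v \<in> A \<Longrightarrow> adjacent T u v \<Longrightarrow> P u \<longleftrightarrow> P v"
  shows "P s \<longleftrightarrow> P t"
proof -
  have "(s, t) \<in> {(s, t). s \<in> A \<and> t \<in> A \<and> adjacent T s t}\<^sup>*"
    using assms(1-3) by (auto simp: induces_connected_def)
  then show ?thesis
    by (induction rule: rtrancl_induct) (auto simp: assms(4))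
qed

text \<open>The dots lying above the segment \<open>(b, i)\<close> of the subdivided tree.\<close>

fun above :: "('n, 'e) tree \<Rightarrow> ('e \<Rightarrow> 'w list) \<Rightarrow> 'e \<Rightarrow> nat \<Rightarrow> ('n, 'w) dot \<Rightarrow> bool" where
  "above T W b i (Black a) \<longleftrightarrow> desc T (Node a) (Edge b)"
| "above T W b i (White w) \<longleftrightarrow> (\<exists>c j. c \<in> edges T \<and> j < length (W c) \<and> w = W c ! j \<and>
     (if c = b then i \<le> j else desc T (Edge c) (Edge b)))"

lemma subdivision_nth_inj:
  assumes "subdivision T W" "c \<in> edges T" "c' \<in> edges T" "j < length (W c)" "j' < length (W c')"
    "W c ! j = W c' ! j'"
  shows "c = c' \<and> j = j'"
proof -
  have "c = c'"
    using assms unfolding subdivision_def by (metis disjoint_iff nth_mem)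
  then show ?thesis using assms unfolding subdivision_def by (metis nth_eq_iff_index_eq)
qed

locale subdivided_rtree = rtree T for T :: "('n, 'e) tree" +
  fixes W :: "'e \<Rightarrow> 'w list"
  assumes subdiv: "subdivision T W"
begin

abbreviation "T' \<equiv> subdivided T W"

text \<open>The white dot \<open>W b ! j\<close> has target segment \<open>(b, j)\<close>, whence
  the test \<open>i \<le> j\<close>. A dot has only one position in a subdivision, so this rule can
  replace the existential in \<open>above.simps(2)\<close>.\<close>

lemma above_White:
  assumes "c \<in> edges T" "j < length (W c)"
  shows "above T W b i (White (W c ! j)) \<longleftrightarrow> (if c = b then i \<le> j else desc T (Edge c) (Edge b))"
  using assms subdivision_nth_inj[OF subdiv] by auto

lemma te_subdivided: "(u, (c, j)) \<in> tgt_edge T' \<longleftrightarrow>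
    (\<exists>a. u = Black a \<and> (a, c) \<in> tgt_edge T \<and> j = length (W c)) \<or>
    (u = White (W c ! j) \<and> c \<in> edges T \<and> j < length (W c))"
  and tn_subdivided: "((c, j), v) \<in> tgt_node T' \<longleftrightarrow>
    (\<exists>a. v = Black a \<and> (c, a) \<in> tgt_node T \<and> j = 0) \<or>
    (\<exists>i. j = Suc i \<and> v = White (W c ! i) \<and> c \<in> edges T \<and> i < length (W c))"
  by (auto simp: subdivided_def)

text \<open>On the edge \<open>b\<close>, the upper end of \<open>(b, j)\<close> is above
  \<open>(b, i)\<close> iff \<open>i \<le> j\<close> and the lower end iff \<open>i < j\<close>, so
  they disagree only at \<open>j = i\<close>. On another edge \<open>c\<close>, both ends are above
  iff \<open>c\<close> descends to \<open>b\<close>. The bound on \<open>i\<close> serves a black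
  upper end, which sits on the segment numbered \<open>length (W b)\<close>.\<close>

lemma above_across:
  assumes "(u, (c, j)) \<in> tgt_edge T'" "((c, j), v) \<in> tgt_node T'" "(c, j) \<noteq> (b, i)"
    "i \<le> length (W b)"
  shows "above T W b i u \<longleftrightarrow> above T W b i v"
proof (cases "c = b")
  case True
  have u: "above T W b i u \<longleftrightarrow> i \<le> j"
    using assms(1,4) True unfolding te_subdivided
    by (auto simp del: above.simps(2) simp: above_White dest: desc_step simp flip: step_Edge)
      (metis desc_step step_Edge)
  have v: "above T W b i v \<longleftrightarrow> i < j"
    using assms(2) True unfolding tn_subdivided
    by (auto simp del: above.simps(2) simp: above_White dest: step_not_desc simp flip: Edge_step)
      (metis Edge_step step_not_desc)
  from u v assms(3) True show ?thesis by auto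
next
  case False
  have u: "above T W b i u \<longleftrightarrow> desc T (Edge c) (Edge b)"
    using assms(1) False unfolding te_subdivided
    by (auto simp del: above.simps(2) simp: above_White Node_desc_iff[of _ "Edge b"] dest: te_fun)
  have v: "above T W b i v \<longleftrightarrow> desc T (Edge c) (Edge b)"
    using assms(2) False unfolding tn_subdivided
    by (auto simp del: above.simps(2) simp: above_White Edge_desc_iff[of c] dest: tn_fun)
  from u v show ?thesis by simp
qed

text \<open>By \<open>above_across\<close>, \<open>(b, i)\<close> is the only segment across which
  \<open>above T W b i\<close> can change, and by hypothesis it does not join two dots of
  \<open>A\<close>.\<close>

lemma cut:
  assumes "induces_connected T' A" "s \<in> A" "t \<in> A" "i \<le> length (W b)"
    and "\<not> (\<exists>u\<in>A. \<exists>v\<in>A. (u, (b, i)) \<in> tgt_edge T' \<and> ((b, i), v) \<in> tgt_node T')"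
  shows "above T W b i s \<longleftrightarrow> above T W b i t"
proof (rule connected_constant[OF assms(1-3)])
  fix u v assume uv: "u \<in> A" "v \<in> A" "adjacent T' u v"
  then show "above T W b i u \<longleftrightarrow> above T W b i v"
    unfolding adjacent_def using assms(4,5) above_across
    by (metis surj_pair)
qed

text \<open>One missing end is enough for a cut. The lower end of \<open>(b, 0)\<close> is the
  target node of \<open>b\<close>; in \<open>cut_top\<close> the missing end is the source node of
  \<open>b\<close>, and in \<open>cut_white\<close> it is the upper end \<open>W b ! i\<close> of
  \<open>(b, i)\<close>.\<close>

lemma cut_bottom:
  assumes "induces_connected T' A" "s \<in> A" "t \<in> A"
    and "\<And>a. (b, a) \<in> tgt_node T \<Longrightarrow> Black a \<notin> A"
  shows "above T W b 0 s \<longleftrightarrow> above T W b 0 t"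
  using assms(4) by (intro cut[OF assms(1-3)]) (auto simp: tn_subdivided)

lemma cut_top:
  assumes "induces_connected T' A" "s \<in> A" "t \<in> A"
    and "\<And>a. (a, b) \<in> tgt_edge T \<Longrightarrow> Black a \<notin> A"
  shows "above T W b (length (W b)) s \<longleftrightarrow> above T W b (length (W b)) t"
  using assms(4) by (intro cut[OF assms(1-3)]) (auto simp: te_subdivided)

lemma cut_white:
  assumes "induces_connected T' A" "s \<in> A" "t \<in> A" "i < length (W b)" "White (W b ! i) \<notin> A"
  shows "above T W b i s \<longleftrightarrow> above T W b i t"
  using assms(4,5) by (auto intro!: cut[OF assms(1-3)] simp: te_subdivided tn_subdivided)

lemma nodes_subdivided: "dots T W = Black ` nodes T \<union> White ` whitedots T W"
  by (simp add: subdivided_def)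

lemma white_nth:
  assumes "w \<in> whitedots T W"
  obtains c j where "c \<in> edges T" "j < length (W c)" "w = W c ! j"
  using assms by (auto simp: whitedots_def in_set_conv_nth)

end

section \<open>Signed faces in an exact constellation\<close>

text \<open>In an exact constellation from \<open>T\<close> to \<open>U\<close>, the set \<open>blk U e\<close> consists of the nodes of \<open>T\<close> and
  \<open>wht U e\<close> of the white dots on edges of \<open>T\<close> lying above the edge \<open>e\<close> of \<open>U\<close>.\<close>

definition blk :: "('m, 'f) tree \<Rightarrow> 'f \<Rightarrow> 'f set" where
  "blk U e = {a \<in> leaves U. desc U (Edge a) (Edge e)}"

definition wht :: "('m, 'f) tree \<Rightarrow> 'f \<Rightarrow> 'm set" where
  "wht U e = {w \<in> null_dots U. desc U (Node w) (Edge e)}"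

definition src_in :: "('n, 'e) tree \<Rightarrow> ('m, 'n) tree \<Rightarrow> 'e \<Rightarrow> 'n \<Rightarrow> bool" where
  "src_in T U z e \<longleftrightarrow> (\<exists>a\<in>blk U e. (a, z) \<in> tgt_edge T)"

definition tgt_in :: "('n, 'e) tree \<Rightarrow> ('m, 'n) tree \<Rightarrow> 'e \<Rightarrow> 'n \<Rightarrow> bool" where
  "tgt_in T U z e \<longleftrightarrow> (\<exists>a\<in>blk U e. (z, a) \<in> tgt_node T)"

definition fplus :: "('n, 'e) tree \<Rightarrow> ('m, 'n) tree \<Rightarrow> 'e \<Rightarrow> 'n \<Rightarrow> bool" where
  "fplus T U z e \<longleftrightarrow> src_in T U z e \<and> \<not> tgt_in T U z e"

definition fminus :: "('n, 'e) tree \<Rightarrow> ('m, 'n) tree \<Rightarrow> 'e \<Rightarrow> 'n \<Rightarrow> bool" where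
  "fminus T U z e \<longleftrightarrow> tgt_in T U z e \<and> \<not> src_in T U z e"

text \<open>A single common white dot suffices: without black dots in the set, all its white dots
  lie on one edge (\<open>floop_wht\<close>).\<close>

definition floop :: "('n, 'e) tree \<Rightarrow> ('e \<Rightarrow> 'w list) \<Rightarrow> ('w, 'n) tree \<Rightarrow> 'e \<Rightarrow> 'n \<Rightarrow> bool" where
  "floop T W U z e \<longleftrightarrow> blk U e = {} \<and> z \<in> edges T \<and> set (W z) \<inter> wht U e \<noteq> {}"

text \<open>The counterpart of \<open>Oset\<close> for arbitrary trees, so that a single
  constellation can be studied without an opetope around it.\<close>

definition odots ::
  "('n, 'e) tree \<Rightarrow> ('e \<Rightarrow> 'w list) \<Rightarrow> ('w, 'n) tree \<Rightarrow> ('w, 'n) elt \<Rightarrow> ('n, 'w) dot set" where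
  "odots T W U x = {y \<in> dots T W. desc U (dot_map id id y) x}"

locale exact =
  fixes T :: "('n, 'e) tree" and W :: "'e \<Rightarrow> 'w list" and U :: "('w, 'n) tree"
  assumes exact: "exact_constellation T W U"
begin

sublocale T: subdivided_rtree T W
  using exact by unfold_locales (auto simp: exact_constellation_def constellation_def)

sublocale U: rtree U
  using exact by unfold_locales (auto simp: exact_constellation_def constellation_def)

lemma nodes_eq_leaves: "nodes T = leaves U"
  using exact by (auto simp: exact_constellation_def constellation_def bij_betw_def)

lemma white_eq_null: "whitedots T W = null_dots U"
  using exact by (auto simp: exact_constellation_def constellation_def bij_betw_def)

lemma Black_odots [simp]: "Black a \<in> odots T W U (Edge e) \<longleftrightarrow> a \<in> blk U e"
  and White_odots [simp]: "White w \<in> odots T W U (Edge e) \<longleftrightarrow> w \<in> wht U e"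
  by (auto simp: odots_def T.nodes_subdivided nodes_eq_leaves white_eq_null blk_def wht_def)

lemma odots_eq: "odots T W U (Edge e) = Black ` blk U e \<union> White ` wht U e"
  using Black_odots White_odots by (auto simp del: Black_odots White_odots)
    (metis Black_odots White_odots dot.exhaust image_eqI)

lemma odots_nonempty:
  assumes "e \<in> edges U"
  shows "blk U e \<noteq> {} \<or> wht U e \<noteq> {}"
  using U.extremal_above[of "Edge e"] assms by (auto simp: blk_def wht_def)

text \<open>The kernel rule speaks of nodes of \<open>U\<close> only. An edge with source node
  \<open>c\<close> has the same dots above it as \<open>c\<close>, and a leaf has only itself, as
  one black dot.\<close>

lemma odots_connected:
  assumes "e \<in> edges U"
  shows "induces_connected (subdivided T W) (odots T W U (Edge e))"
proof (cases "e \<in> leaves U")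
  case True
  then have "blk U e = {e}" "wht U e = {}"
    using assms by (auto simp: blk_def wht_def U.desc_leaf leaves_def)
  then show ?thesis by (simp add: odots_eq induces_connected_def)
next
  case False
  with assms obtain c where c: "(c, e) \<in> tgt_edge U" by (auto simp: leaves_def)
  have "desc U x (Edge e) \<longleftrightarrow> desc U x (Node c)" if "x \<noteq> Edge e" for x
    using that c U.te_inj by (auto simp: U.desc_Edge_iff[of x e])
  moreover have "dot_map id id t \<noteq> Edge e" if "t \<in> dots T W" for t
    using that False by (cases t) (auto simp: T.nodes_subdivided nodes_eq_leaves)
  ultimately have "odots T W U (Edge e) = {t \<in> dots T W. desc U (dot_map id id t) (Node c)}"
    by (auto simp: odots_def)
  then show ?thesis
    using exact c U.te_sub by (auto simp: exact_constellation_def constellation_def)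
qed

lemma blk_nodes: "a \<in> blk U e \<Longrightarrow> a \<in> nodes T"
  by (simp add: nodes_eq_leaves blk_def)

lemma wht_nth:
  assumes "w \<in> wht U e"
  obtains c j where "c \<in> edges T" "j < length (W c)" "w = W c ! j"
  using assms T.white_nth by (auto simp: wht_def simp flip: white_eq_null)

text \<open>The target edge of a lowest node of the set works, since a target node of that edge
  inside the set would be lower still. Steps are reversed so that minimal means lowest.\<close>

lemma fplus_exists:
  assumes "blk U e \<noteq> {}"
  shows "\<exists>z. fplus T U z e"
proof -
  have "finite (target_step T)"
    by (rule finite_subset[of _ "elts T \<times> elts T"]) (auto simp: T.finite_elts dest: T.step_elts)
  then have wf: "wf (((target_step T)\<inverse>)\<^sup>+)"
    using finite_acyclic_wf_converse T.step_irrefl by (metis acyclicI wf_trancl)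
  from assms obtain a0 where "a0 \<in> blk U e" by auto
  then obtain x where "x \<in> Node ` blk U e"
    and min: "\<And>y. (y, x) \<in> ((target_step T)\<inverse>)\<^sup>+ \<Longrightarrow> y \<notin> Node ` blk U e"
    using wfE_min[OF wf, of "Node a0" "Node ` blk U e"] by blast
  then obtain a where a: "x = Node a" "a \<in> blk U e" by auto
  obtain z where z: "(a, z) \<in> tgt_edge T" using a T.te_ex blk_nodes by blast
  have "\<not> tgt_in T U z e"
  proof
    assume "tgt_in T U z e"
    then obtain a' where "a' \<in> blk U e" "(z, a') \<in> tgt_node T" by (auto simp: tgt_in_def)
    moreover have "(Node a', Edge z) \<in> (target_step T)\<inverse>" "(Edge z, x) \<in> (target_step T)\<inverse>"
      using a z calculation by (auto simp: target_step_def)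
    then have "(Node a', x) \<in> ((target_step T)\<inverse>)\<^sup>+" by (meson r_into_trancl' trancl_into_trancl)
    ultimately show False using min by blast
  qed
  then show ?thesis using a z by (auto simp: fplus_def src_in_def)
qed

lemma fplus_edges: "fplus T U z e \<Longrightarrow> z \<in> edges T"
  and fminus_edges: "fminus T U z e \<Longrightarrow> z \<in> edges T"
  and fplus_blk: "fplus T U z e \<Longrightarrow> blk U e \<noteq> {}"
  and fminus_blk: "fminus T U z e \<Longrightarrow> blk U e \<noteq> {}"
  by (auto simp: fplus_def fminus_def src_in_def tgt_in_def dest: T.te_sub T.tn_sub)

lemma blk_edges: "blk U e \<noteq> {} \<Longrightarrow> e \<in> edges U"
  by (auto simp: blk_def desc_def)

text \<open>The lower end of the segment \<open>(z, 0)\<close> is missing from the set, so the whole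
  set lies on the same side of the cut as the source node \<open>s\<close> of
  \<open>z\<close>.\<close>

lemma blk_desc_root:
  assumes "fplus T U z e" "a \<in> blk U e"
  shows "desc T (Node a) (Edge z)"
proof -
  obtain s where s: "s \<in> blk U e" "(s, z) \<in> tgt_edge T"
    using assms by (auto simp: fplus_def src_in_def)
  have "above T W z 0 (Black s) \<longleftrightarrow> above T W z 0 (Black a)"
    using assms s blk_edges
    by (intro T.cut_bottom[OF odots_connected[of e]]) (auto simp: fplus_def tgt_in_def)
  then show ?thesis using s T.desc_step by (auto simp: step_Edge)
qed

text \<open>The source node of \<open>z\<close> is in the set, so it descends to \<open>z'\<close>,
  and its path passes through \<open>z\<close>. Exchanging the two faces and using antisymmetry
  finishes.\<close>

lemma fplus_unique: "fplus T U z e \<Longrightarrow> fplus T U z' e \<Longrightarrow> z = z'"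
proof -
  have *: "desc T (Edge z) (Edge z')" if z: "fplus T U z e" "fplus T U z' e" for z z'
  proof -
    obtain s where s: "s \<in> blk U e" "(s, z) \<in> tgt_edge T"
      using z by (auto simp: fplus_def src_in_def)
    from blk_desc_root[OF z(2) s(1)] show ?thesis
      using s(2) T.te_fun by (auto simp: T.Node_desc_iff[of s])
  qed
  show "fplus T U z e \<Longrightarrow> fplus T U z' e \<Longrightarrow> z = z'" using * T.desc_antisym by blast
qed

text \<open>Strict descent from sources to the target is what acyclicity rests on.\<close>

lemma fminus_desc_root:
  assumes "fplus T U r e" "fminus T U y e"
  shows "desc T (Edge y) (Edge r)" "y \<noteq> r"
proof -
  obtain a where "a \<in> blk U e" "(y, a) \<in> tgt_node T"
    using assms by (auto simp: fminus_def tgt_in_def)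
  then show "desc T (Edge y) (Edge r)"
    using blk_desc_root[OF assms(1)] by (auto simp: T.Edge_desc_iff[of y])
  show "y \<noteq> r" using assms by (auto simp: fminus_def fplus_def)
qed

text \<open>Climbing from \<open>r\<close>, one can leave the subtree only through an edge whose
  target node is in the set and whose source node is not, that is, through a negative face.\<close>

lemma desc_root_cases:
  assumes "fplus T U r e" "desc T t (Edge r)"
  shows "(\<exists>a\<in>blk U e. t = Node a) \<or> (\<exists>b. t = Edge b \<and> src_in T U b e) \<or>
    (\<exists>y. fminus T U y e \<and> desc T t (Edge y))"
proof -
  from assms(2) have "(t, Edge r) \<in> (target_step T)\<^sup>*" by (simp add: desc_def)
  then show ?thesis
  proof (induction rule: converse_rtrancl_induct)
    case base
    then show ?case using assms(1) by (auto simp: fplus_def)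
  next
    case (step t t')
    from step.IH show ?case
    proof (elim disjE exE conjE bexE)
      fix a assume a: "a \<in> blk U e" "t' = Node a"
      then obtain b where b: "t = Edge b" "(b, a) \<in> tgt_node T" using step by (auto simp: step_Node)
      then have "fminus T U b e \<or> src_in T U b e" using a by (auto simp: fminus_def tgt_in_def)
      then show ?thesis using b desc_refl[of t T] T.tn_sub by auto
    next
      fix b assume "t' = Edge b" "src_in T U b e"
      then show ?thesis using step.hyps(1) by (auto simp: step_Edge src_in_def dest: T.te_inj)
    next
      fix y assume "fminus T U y e" "desc T t' (Edge y)"
      then show ?thesis using T.desc_step step.hyps(1) desc_trans by metis
    qed
  qed
qed

text \<open>Two negative faces below a common \<open>t\<close> would be comparable, say
  \<open>y\<close> strictly above \<open>y'\<close>. Then the target node of \<open>y\<close> lies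
  above \<open>y'\<close> and that of \<open>y'\<close> does not, although the source node of
  \<open>y'\<close> is missing from the set and the cut at the top of \<open>y'\<close> cannot
  separate them.\<close>

lemma fminus_disjoint:
  assumes "fminus T U y e" "fminus T U y' e" "desc T t (Edge y)" "desc T t (Edge y')"
  shows "y = y'"
proof -
  have *: "y = y'" if y: "fminus T U y e" "fminus T U y' e" "desc T (Edge y) (Edge y')" for y y'
  proof (rule ccontr)
    assume "y \<noteq> y'"
    obtain c where c: "c \<in> blk U e" "(y, c) \<in> tgt_node T"
      using y by (auto simp: fminus_def tgt_in_def)
    obtain d where d: "d \<in> blk U e" "(y', d) \<in> tgt_node T"
      using y by (auto simp: fminus_def tgt_in_def)
    have "above T W y' (length (W y')) (Black c) \<longleftrightarrow> above T W y' (length (W y')) (Black d)"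
      using y c d blk_edges
      by (intro T.cut_top[OF odots_connected[of e]]) (auto simp: fminus_def src_in_def)
    moreover have "desc T (Node c) (Edge y')"
      using y(3) c T.tn_fun \<open>y \<noteq> y'\<close> by (auto simp: T.Edge_desc_iff[of y])
    moreover have "\<not> desc T (Node d) (Edge y')"
      using d T.step_not_desc by (auto simp: Edge_step)
    ultimately show False by simp
  qed
  show ?thesis using T.desc_comparable[OF assms(3,4)] * assms(1,2) by metis
qed

text \<open>The lower end of \<open>(z', 0)\<close> could only be a black dot, and there is none. So
  all white dots are on the same side of that cut as the one on \<open>z'\<close>, and every edge
  carrying one descends to \<open>z'\<close>.\<close>

lemma floop_unique:
  assumes "floop T W U z e" "floop T W U z' e" "e \<in> edges U"
  shows "z = z'"
proof -
  have *: "desc T (Edge z) (Edge z')" if z: "floop T W U z e" "floop T W U z' e" for z z'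
  proof -
    obtain i j where i: "i < length (W z)" "W z ! i \<in> wht U e" "z \<in> edges T"
      and j: "j < length (W z')" "W z' ! j \<in> wht U e" "z' \<in> edges T"
      using z by (auto simp: floop_def set_conv_nth)
    have "above T W z' 0 (White (W z ! i)) \<longleftrightarrow> above T W z' 0 (White (W z' ! j))"
      using i j z assms(3) by (intro T.cut_bottom[OF odots_connected[of e]]) (auto simp: floop_def)
    then have "z = z' \<or> desc T (Edge z) (Edge z')"
      using i j by (auto simp del: above.simps(2) simp: T.above_White split: if_splits)
    then show ?thesis using i(3) by (auto simp: desc_refl)
  qed
  show "z = z'" using * assms T.desc_antisym by blast
qed

lemma floop_exists:
  assumes "blk U e = {}" "e \<in> edges U"
  shows "\<exists>z. floop T W U z e"
proof -
  obtain w where w: "w \<in> wht U e" using odots_nonempty assms by blast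
  then obtain c j where "c \<in> edges T" "j < length (W c)" "w = W c ! j" using wht_nth by blast
  then show ?thesis using w assms nth_mem by (fastforce simp: floop_def)
qed

lemma floop_wht:
  assumes "floop T W U z e" "e \<in> edges U" "w \<in> wht U e"
  shows "w \<in> set (W z)"
proof -
  obtain c j where "c \<in> edges T" "j < length (W c)" "w = W c ! j" using wht_nth assms by blast
  moreover from this have "floop T W U c e"
    using assms(1,3) nth_mem by (fastforce simp: floop_def)
  ultimately show ?thesis using floop_unique assms(1,2) by (metis nth_mem)
qed

text \<open>If both end nodes of \<open>z\<close> were missing, cuts would be possible at the bottom
  and at the top of \<open>z\<close>. A white dot on \<open>z\<close> lies between the two cuts,
  whereas a black dot is above both or above neither.\<close>

lemma wht_adjacent:
  assumes "blk U e \<noteq> {}" "z \<in> edges T" "i < length (W z)" "W z ! i \<in> wht U e"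
  shows "src_in T U z e \<or> tgt_in T U z e"
proof (rule ccontr)
  assume n: "\<not> (src_in T U z e \<or> tgt_in T U z e)"
  obtain a where a: "a \<in> blk U e" using assms by auto
  have "above T W z 0 (White (W z ! i)) \<longleftrightarrow> above T W z 0 (Black a)"
    using assms a n blk_edges by (intro T.cut_bottom[OF odots_connected[of e]]) (auto simp: tgt_in_def)
  moreover have "above T W z (length (W z)) (White (W z ! i)) \<longleftrightarrow> above T W z (length (W z)) (Black a)"
    using assms a n blk_edges by (intro T.cut_top[OF odots_connected[of e]]) (auto simp: src_in_def)
  ultimately show False using assms by (auto simp del: above.simps(2) simp: T.above_White)
qed

text \<open>The two end nodes of \<open>z\<close> are on different sides of every white dot of
  \<open>z\<close>, so connectedness cannot skip any of them.\<close>

lemma wht_between: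
  assumes "src_in T U z e" "tgt_in T U z e" "z \<in> edges T" "i < length (W z)"
  shows "W z ! i \<in> wht U e"
proof (rule ccontr)
  assume n: "W z ! i \<notin> wht U e"
  obtain a where a: "a \<in> blk U e" "(a, z) \<in> tgt_edge T" using assms by (auto simp: src_in_def)
  obtain b where b: "b \<in> blk U e" "(z, b) \<in> tgt_node T" using assms by (auto simp: tgt_in_def)
  have "above T W z i (Black a) \<longleftrightarrow> above T W z i (Black b)"
    using a b n assms(4) blk_edges by (intro T.cut_white[OF odots_connected[of e]]) auto
  then show False using a b T.desc_step[of "Node a" "Edge z"] T.step_not_desc[of "Edge z" "Node b"]
    by (auto simp: step_Edge Edge_step)
qed

lemma wht_interval:
  assumes "z \<in> edges T" "i \<le> j" "j \<le> k" "k < length (W z)" "W z ! i \<in> wht U e" "W z ! k \<in> wht U e"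
    "e \<in> edges U"
  shows "W z ! j \<in> wht U e"
proof (rule ccontr)
  assume n: "W z ! j \<notin> wht U e"
  then have "i \<noteq> j" using assms by auto
  have "above T W z j (White (W z ! i)) \<longleftrightarrow> above T W z j (White (W z ! k))"
    using n assms by (intro T.cut_white[OF odots_connected[of e]]) auto
  then show False using assms \<open>i \<noteq> j\<close> by (auto simp del: above.simps(2) simp: T.above_White)
qed

text \<open>Resolves both definite descriptions in \<open>induced_tree\<close>. Exactly one
  \<open>z\<close> satisfies the right-hand side, and the block being empty or not decides which
  alternative holds.\<close>

lemma root_induced:
  assumes "e \<in> edges U"
  shows "root (induced_tree T W (odots T W U (Edge e))) = z \<longleftrightarrow> fplus T U z e \<or> floop T W U z e"
proof -
  let ?I = "induced_tree T W (odots T W U (Edge e))"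
  have B: "{a. Black a \<in> odots T W U (Edge e)} = blk U e" by simp
  show ?thesis
  proof (cases "blk U e = {}")
    case True
    then obtain c where c: "floop T W U c e" using floop_exists assms by blast
    have "(THE b. b \<in> edges T \<and> (\<forall>w. White w \<in> odots T W U (Edge e) \<longrightarrow> w \<in> set (W b))) = c"
    proof (rule the_equality)
      show "c \<in> edges T \<and> (\<forall>w. White w \<in> odots T W U (Edge e) \<longrightarrow> w \<in> set (W c))"
        using c floop_wht[OF c assms] by (simp add: floop_def)
      fix b assume "b \<in> edges T \<and> (\<forall>w. White w \<in> odots T W U (Edge e) \<longrightarrow> w \<in> set (W b))"
      moreover have "wht U e \<noteq> {}" using c by (auto simp: floop_def)
      ultimately have "floop T W U b e" using True by (auto simp: floop_def)
      then show "b = c" by (rule floop_unique[OF _ c assms])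
    qed
    then have "root ?I = c"
      using True unfolding induced_tree_def Let_def B by (simp add: unit_tree_def)
    then show ?thesis using c floop_unique[OF c _ assms, of z] fplus_blk[of z e] True by auto
  next
    case False
    then obtain c where c: "fplus T U c e" using fplus_exists by blast
    have "(THE b. (\<exists>a\<in>blk U e. (a, b) \<in> tgt_edge T) \<and> (\<forall>a\<in>blk U e. (b, a) \<notin> tgt_node T)) = c"
    proof (rule the_equality)
      fix b assume "(\<exists>a\<in>blk U e. (a, b) \<in> tgt_edge T) \<and> (\<forall>a\<in>blk U e. (b, a) \<notin> tgt_node T)"
      then have "fplus T U b e" by (simp add: fplus_def src_in_def tgt_in_def)
      then show "b = c" using c by (rule fplus_unique)
    qed (use c in \<open>simp add: fplus_def src_in_def tgt_in_def\<close>)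
    then have "root ?I = c" using False unfolding induced_tree_def Let_def B by simp
    then show ?thesis using c fplus_unique[OF c, of z] False by (auto simp: floop_def)
  qed
qed

text \<open>The single edge of a unit tree is both root and leaf, which is why a loop base is a
  source and a target at once. With black dots present, a leaf is an edge adjacent to the block
  whose source node is outside it.\<close>

lemma leaves_induced:
  assumes "e \<in> edges U"
  shows "z \<in> leaves (induced_tree T W (odots T W U (Edge e))) \<longleftrightarrow> fminus T U z e \<or> floop T W U z e"
proof -
  let ?I = "induced_tree T W (odots T W U (Edge e))"
  have B: "{a. Black a \<in> odots T W U (Edge e)} = blk U e" by simp
  show ?thesis
  proof (cases "blk U e = {}")
    case True
    then have "\<exists>b. ?I = unit_tree b" unfolding induced_tree_def Let_def B by auto
    then have "leaves ?I = {root ?I}" by (auto simp: unit_tree_def leaves_def)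
    moreover have "\<not> fplus T U z e" "\<not> fminus T U z e"
      using True fplus_blk[of z e] fminus_blk[of z e] by auto
    ultimately show ?thesis using root_induced[OF assms, of z] by auto
  next
    case False
    then have I: "edges ?I = {b \<in> edges T. src_in T U b e \<or> tgt_in T U b e}"
      "tgt_edge ?I = {(a, b) \<in> tgt_edge T. a \<in> blk U e}"
      unfolding induced_tree_def Let_def B src_in_def tgt_in_def by auto
    have "z \<in> leaves ?I \<longleftrightarrow> z \<in> edges T \<and> (src_in T U z e \<or> tgt_in T U z e) \<and> \<not> src_in T U z e"
      by (simp add: leaves_def I src_in_def) blast
    moreover have "tgt_in T U z e \<Longrightarrow> z \<in> edges T" by (auto simp: tgt_in_def dest: T.tn_sub)
    ultimately show ?thesis using False unfolding floop_def fminus_def by metis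
  qed
qed

lemma fplus_not_fminus: "fplus T U z e \<Longrightarrow> \<not> fminus T U z e"
  by (simp add: fplus_def fminus_def)

lemma fplus_not_floop: "fplus T U z e \<Longrightarrow> \<not> floop T W U z' e"
  and fminus_not_floop: "fminus T U z e \<Longrightarrow> \<not> floop T W U z' e"
  using fplus_blk[of z e] fminus_blk[of z e] by (simp_all add: floop_def)

end

section \<open>Signs, and the order of loops on an edge\<close>

definition fsign ::
  "('n, 'e) tree \<Rightarrow> ('e \<Rightarrow> 'w list) \<Rightarrow> ('w, 'n) tree \<Rightarrow> int \<Rightarrow> 'e \<Rightarrow> 'n \<Rightarrow> bool" where
  "fsign T W U s z e \<longleftrightarrow>
     s = -1 \<and> fminus T U z e \<or> s = 1 \<and> fplus T U z e \<or> s = 0 \<and> floop T W U z e"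

definition before :: "('e \<Rightarrow> 'w list) \<Rightarrow> ('w, 'n) tree \<Rightarrow> 'e \<Rightarrow> 'n \<Rightarrow> 'n \<Rightarrow> bool" where
  "before W U z y y' \<longleftrightarrow> (\<forall>i<length (W z). \<forall>j<length (W z).
     W z ! i \<in> wht U y \<and> W z ! j \<in> wht U y' \<longrightarrow> i < j)"

lemma (in exact) floop_nth:
  assumes "floop T W U z y"
  obtains i where "i < length (W z)" "W z ! i \<in> wht U y"
  using assms by (auto simp: floop_def in_set_conv_nth)

text \<open>By \<open>wht_interval\<close> the two sets occupy nonempty disjoint intervals of
  positions on \<open>z\<close>, so comparing one position of each decides their order.\<close>

lemma (in exact) before_total:
  assumes "floop T W U z y" "floop T W U z y'" "y \<in> edges U" "y' \<in> edges U"
    and disj: "wht U y \<inter> wht U y' = {}"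
  shows "before W U z y y' \<or> before W U z y' y"
proof -
  have z: "z \<in> edges T" using assms by (simp add: floop_def)
  have *: "before W U z y y'" if i: "i < length (W z)" "W z ! i \<in> wht U y"
    and j: "j < length (W z)" "W z ! j \<in> wht U y'" and "i < j"
    and y: "y \<in> edges U" "y' \<in> edges U" "wht U y \<inter> wht U y' = {}" for y y' i j
    unfolding before_def
  proof (intro allI impI, elim conjE, rule ccontr)
    fix i' j'
    assume i': "i' < length (W z)" "W z ! i' \<in> wht U y"
      and j': "j' < length (W z)" "W z ! j' \<in> wht U y'" and "\<not> i' < j'"
    \<comment> \<open>Otherwise \<open>j\<close> would lie between \<open>i\<close> and
      \<open>i'\<close>, hence in the interval of \<open>y\<close>.\<close>
    have "i' \<le> j" using wht_interval[OF z _ _ i'(1) i(2) i'(2) y(1), of j] \<open>i < j\<close> j(2) y(3) by force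
    then have "W z ! i' \<in> wht U y'"
      using wht_interval[OF z _ _ j(1) j'(2) j(2) y(2), of i'] \<open>\<not> i' < j'\<close> by simp
    then show False using i'(2) y(3) by auto
  qed
  obtain i where i: "i < length (W z)" "W z ! i \<in> wht U y" using floop_nth assms(1) by blast
  obtain j where j: "j < length (W z)" "W z ! j \<in> wht U y'" using floop_nth assms(2) by blast
  have "i \<noteq> j" using i j disj by auto
  then show ?thesis using *[OF i j] *[OF j i] assms(3,4) disj by (metis inf_commute nat_neq_iff)
qed

text \<open>\<open>before\<close> holds vacuously when one of the sets has no dot on
  \<open>z\<close>; the loop in the middle supplies the position to compare through.\<close>

lemma (in exact) before_trans:
  assumes "before W U z y y'" "before W U z y' y''" "floop T W U z y'"
  shows "before W U z y y''"
proof -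
  obtain i where "i < length (W z)" "W z ! i \<in> wht U y'" using floop_nth assms(3) by blast
  then show ?thesis using assms(1,2) unfolding before_def by (meson less_trans)
qed

lemma (in exact) before_irrefl:
  assumes "floop T W U z y"
  shows "\<not> before W U z y y"
proof -
  obtain i where "i < length (W z)" "W z ! i \<in> wht U y" using floop_nth assms by blast
  then show ?thesis unfolding before_def by auto
qed

section \<open>Two consecutive exact constellations\<close>

text \<open>The setting for faces of faces: cells \<open>x\<close>, \<open>y\<close>,
  \<open>z\<close> of consecutive dimensions are edges of \<open>U\<close>, \<open>T\<close>,
  \<open>S\<close>. The upper constellation tells the faces \<open>y\<close> of \<open>x\<close>,
  the lower one the faces \<open>z\<close> of \<open>y\<close>.\<close>

locale exact2 = lower: exact S W T + upper: exact T V U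
  for S :: "('n, 'e) tree" and W :: "'e \<Rightarrow> 'w list" and T :: "('w, 'n) tree"
    and V :: "'n \<Rightarrow> 'v list" and U :: "('v, 'w) tree"
begin

lemma blk_desc: "desc T (Edge y) (Edge r) \<Longrightarrow> blk T y \<subseteq> blk T r"
  and wht_desc: "desc T (Edge y) (Edge r) \<Longrightarrow> wht T y \<subseteq> wht T r"
  by (auto simp: blk_def wht_def intro: desc_trans)

text \<open>A black dot of \<open>S\<close> is a leaf of \<open>T\<close>, so it has no source node
  and cannot be an edge inside the subtree of \<open>x\<close>. Of the cases in
  \<open>desc_root_cases\<close> only the negative faces remain.\<close>

lemma blk_partition:
  assumes "fplus T U r x"
  shows "a \<in> blk T r \<longleftrightarrow> (\<exists>y. fminus T U y x \<and> a \<in> blk T y)"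
proof
  assume a: "a \<in> blk T r"
  then have "\<not> src_in T U a x" by (auto simp: blk_def leaves_def src_in_def)
  then show "\<exists>y. fminus T U y x \<and> a \<in> blk T y"
    using a upper.desc_root_cases[OF assms, of "Edge a"] by (auto simp: blk_def)
qed (use upper.fminus_desc_root[OF assms] blk_desc in blast)

lemma fminus_blk_disjoint:
  "fminus T U y x \<Longrightarrow> fminus T U y' x \<Longrightarrow> a \<in> blk T y \<Longrightarrow> a \<in> blk T y' \<Longrightarrow> y = y'"
  and fminus_wht_disjoint:
  "fminus T U y x \<Longrightarrow> fminus T U y' x \<Longrightarrow> w \<in> wht T y \<Longrightarrow> w \<in> wht T y' \<Longrightarrow> y = y'"
  using upper.fminus_disjoint[of y x y'] by (auto simp: blk_def wht_def)

lemma src_in_partition: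
  assumes "fplus T U r x"
  shows "src_in S T z r \<longleftrightarrow> (\<exists>y. fminus T U y x \<and> src_in S T z y)"
  and "tgt_in S T z r \<longleftrightarrow> (\<exists>y. fminus T U y x \<and> tgt_in S T z y)"
  unfolding src_in_def tgt_in_def using blk_partition[OF assms] by blast+

lemma src_in_unique:
  "fminus T U y x \<Longrightarrow> fminus T U y' x \<Longrightarrow> src_in S T z y \<Longrightarrow> src_in S T z y' \<Longrightarrow> y = y'"
  and tgt_in_unique:
  "fminus T U y x \<Longrightarrow> fminus T U y' x \<Longrightarrow> tgt_in S T z y \<Longrightarrow> tgt_in S T z y' \<Longrightarrow> y = y'"
  unfolding src_in_def tgt_in_def using fminus_blk_disjoint lower.T.te_inj lower.T.tn_fun by metis+

lemma oriented_thinness: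
  assumes zy: "fsign S W T \<beta> z y" and yx: "fsign T V U \<alpha> y x" and "\<alpha> \<noteq> 0" "\<beta> \<noteq> 0"
  shows "\<exists>!y'. y' \<noteq> y \<and> (\<exists>\<alpha>' \<beta>'. fsign S W T \<beta>' z y' \<and> fsign T V U \<alpha>' y' x \<and> \<alpha> * \<beta> = - (\<alpha>' * \<beta>'))"
proof -
  have blk: "blk U x \<noteq> {}" using yx \<open>\<alpha> \<noteq> 0\<close> upper.fplus_blk upper.fminus_blk by (auto simp: fsign_def)
  then obtain r where r: "fplus T U r x" using upper.fplus_exists by blast
  have up: "fplus T U y x \<longleftrightarrow> y = r" for y using r upper.fplus_unique by blast
  have nr: "\<not> fminus T U r x" using r upper.fplus_not_fminus by blast
  \<comment> \<open>From here on the argument is combinatorial: \<open>s\<close> and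
    \<open>t\<close> tell whether the source and target node of \<open>z\<close> lie above a cell.
    Each holds for at most one source of \<open>x\<close>, and for \<open>r\<close> iff it holds for
    some source.\<close>
  define M where "M y \<longleftrightarrow> fminus T U y x" for y
  define s where "s y \<longleftrightarrow> src_in S T z y" for y
  define t where "t y \<longleftrightarrow> tgt_in S T z y" for y
  have part: "s r \<longleftrightarrow> (\<exists>y. M y \<and> s y)" "t r \<longleftrightarrow> (\<exists>y. M y \<and> t y)"
    using src_in_partition[OF r] by (auto simp: M_def s_def t_def)
  have uniq: "M y \<Longrightarrow> M y' \<Longrightarrow> s y \<Longrightarrow> s y' \<Longrightarrow> y = y'" "M y \<Longrightarrow> M y' \<Longrightarrow> t y \<Longrightarrow> t y' \<Longrightarrow> y = y'" for y y'
    using src_in_unique[of y x y'] tgt_in_unique[of y x y'] by (auto simp: M_def s_def t_def)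
  have sgn: "fsign T V U \<alpha>' y' x \<longleftrightarrow> \<alpha>' = 1 \<and> y' = r \<or> \<alpha>' = -1 \<and> M y'" for \<alpha>' y'
    using blk by (auto simp: fsign_def up M_def floop_def)
  have sgn': "fsign S W T \<beta>' z y' \<longleftrightarrow> \<beta>' = 1 \<and> s y' \<and> \<not> t y' \<or> \<beta>' = -1 \<and> t y' \<and> \<not> s y'"
    if "\<beta>' \<noteq> 0" for \<beta>' y'
    using that by (auto simp: fsign_def fplus_def fminus_def s_def t_def)
  \<comment> \<open>The sign of \<open>y'\<close> in \<open>x\<close> and the product together fix
    the sign that \<open>z\<close> must have in \<open>y'\<close>; this eliminates \<alpha>' and
    \<beta>'.\<close>
  let ?Q = "\<lambda>y'. y' = r \<and> (\<alpha> * \<beta> = -1 \<and> s r \<and> \<not> t r \<or> \<alpha> * \<beta> = 1 \<and> t r \<and> \<not> s r) \<or>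
    M y' \<and> (\<alpha> * \<beta> = 1 \<and> s y' \<and> \<not> t y' \<or> \<alpha> * \<beta> = -1 \<and> t y' \<and> \<not> s y')"
  have "(\<exists>\<alpha>' \<beta>'. fsign S W T \<beta>' z y' \<and> fsign T V U \<alpha>' y' x \<and> \<alpha> * \<beta> = - (\<alpha>' * \<beta>')) \<longleftrightarrow> ?Q y'" for y'
  proof -
    have "(fsign S W T \<beta>' z y' \<and> fsign T V U \<alpha>' y' x \<and> \<alpha> * \<beta> = - (\<alpha>' * \<beta>')) \<longleftrightarrow>
      (\<beta>' = 1 \<and> s y' \<and> \<not> t y' \<or> \<beta>' = -1 \<and> t y' \<and> \<not> s y') \<and>
        (\<alpha>' = 1 \<and> y' = r \<or> \<alpha>' = -1 \<and> M y') \<and> \<alpha> * \<beta> = - (\<alpha>' * \<beta>')" for \<alpha>' \<beta>'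
      \<comment> \<open>A loop of \<open>y'\<close> on \<open>z\<close> has sign 0, which the
        nonzero product rules out.\<close>
      using sgn'[of \<beta>' y'] \<open>\<alpha> \<noteq> 0\<close> \<open>\<beta> \<noteq> 0\<close> unfolding sgn by (cases "\<beta>' = 0") auto
    then have "(\<exists>\<alpha>' \<beta>'. fsign S W T \<beta>' z y' \<and> fsign T V U \<alpha>' y' x \<and> \<alpha> * \<beta> = - (\<alpha>' * \<beta>')) \<longleftrightarrow>
      (\<exists>\<alpha>' \<beta>'. (\<beta>' = 1 \<and> s y' \<and> \<not> t y' \<or> \<beta>' = -1 \<and> t y' \<and> \<not> s y') \<and>
        (\<alpha>' = 1 \<and> y' = r \<or> \<alpha>' = -1 \<and> M y') \<and> \<alpha> * \<beta> = - (\<alpha>' * \<beta>'))"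
      by simp
    also have "\<dots> \<longleftrightarrow> ?Q y'" by auto
    finally show ?thesis .
  qed
  moreover have "\<exists>!y'. y' \<noteq> y \<and> ?Q y'"
  proof -
    from zy yx consider "y = r" "\<alpha> * \<beta> = 1" "s y" "\<not> t y" | "y = r" "\<alpha> * \<beta> = -1" "t y" "\<not> s y"
      | "M y" "\<alpha> * \<beta> = -1" "s y" "\<not> t y" | "M y" "\<alpha> * \<beta> = 1" "t y" "\<not> s y"
      unfolding sgn sgn'[OF \<open>\<beta> \<noteq> 0\<close>] by auto
    then show ?thesis
    proof cases
      case 1
      then obtain y' where "M y'" "s y'" using part by auto
      then show ?thesis using 1 part uniq nr by (intro ex1I[of _ y']) (auto simp: M_def)
    next
      case 2
      then obtain y' where "M y'" "t y'" using part by auto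
      then show ?thesis using 2 part uniq nr by (intro ex1I[of _ y']) (auto simp: M_def)
    next
      case 3
      \<comment> \<open>If the target node of \<open>z\<close> is above \<open>r\<close>, the
        solution is the source of \<open>x\<close> above which it lies. Otherwise \<open>z\<close>
        is a positive face of \<open>r\<close>, and \<open>r\<close> is the solution. The next case
        exchanges \<open>s\<close> and \<open>t\<close>.\<close>
      have sr: "s r" using 3 part by auto
      show ?thesis
      proof (cases "t r")
        case True
        then obtain y' where y': "M y'" "t y'" using part by auto
        then have "y' \<noteq> y" "\<not> s y'" using 3 uniq by auto
        then show ?thesis using 3 y' True uniq by (intro ex1I[of _ y']) auto
      next
        case False
        then show ?thesis using 3 sr part nr by (intro ex1I[of _ r]) (auto simp: M_def)
      qed
    next
      case 4
      have tr: "t r" using 4 part by auto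
      show ?thesis
      proof (cases "s r")
        case True
        then obtain y' where y': "M y'" "s y'" using part by auto
        then have "y' \<noteq> y" "\<not> t y'" using 4 uniq by auto
        then show ?thesis using 4 y' True uniq by (intro ex1I[of _ y']) auto
      next
        case False
        then show ?thesis using 4 tr part nr by (intro ex1I[of _ r]) (auto simp: M_def)
      qed
    qed
  qed
  ultimately show ?thesis by simp
qed

text \<open>A white dot of \<open>y\<close> on \<open>z\<close> also lies above the target
  \<open>r\<close>, so \<open>r\<close> itself works unless both end nodes of \<open>z\<close> lie
  above it. In that case take the source \<open>y1\<close> containing the source node of
  \<open>z\<close>: if it contained the target node as well, it would contain all white dots of
  \<open>z\<close>, including one of \<open>y\<close>.\<close>

lemma loop_thinness:
  assumes zy: "floop S W T z y" and yx: "fminus T U y x"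
  shows "\<exists>y' \<alpha> \<beta>. y' \<noteq> y \<and> fsign S W T \<beta> z y' \<and> fsign T V U \<alpha> y' x \<and> (\<alpha>, \<beta>) \<noteq> (-1, 0)"
proof -
  obtain r where r: "fplus T U r x" using upper.fplus_exists upper.fminus_blk yx by blast
  have yr: "desc T (Edge y) (Edge r)" "y \<noteq> r" using upper.fminus_desc_root[OF r yx] by auto
  obtain i where i: "i < length (W z)" "W z ! i \<in> wht T y" using lower.floop_nth zy by blast
  have z: "z \<in> edges S" using zy by (simp add: floop_def)
  have ir: "W z ! i \<in> wht T r" using i yr wht_desc by blast
  have *: ?thesis if "fsign S W T \<beta> z r" for \<beta>
    using that yr(2) r by (intro exI[of _ r] exI[of _ 1] exI[of _ \<beta>]) (auto simp: fsign_def)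
  consider "blk T r = {}" | "fplus S T z r" | "fminus S T z r" | "src_in S T z r" "tgt_in S T z r"
    using lower.wht_adjacent[OF _ z i(1) ir] by (auto simp: fplus_def fminus_def)
  then show ?thesis
  proof cases
    case 1
    then have "floop S W T z r" using z nth_mem[OF i(1)] ir by (auto simp: floop_def)
    then show ?thesis using *[of 0] by (simp add: fsign_def)
  next
    case 2 then show ?thesis using *[of 1] by (simp add: fsign_def)
  next
    case 3 then show ?thesis using *[of "-1"] by (simp add: fsign_def)
  next
    case 4
    then obtain y1 y2 where y1: "fminus T U y1 x" "src_in S T z y1"
      and y2: "fminus T U y2 x" "tgt_in S T z y2"
      using src_in_partition[OF r] by blast
    have "y1 \<noteq> y" using y1 zy by (auto simp: src_in_def floop_def)
    moreover have "\<not> tgt_in S T z y1"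
    proof
      assume "tgt_in S T z y1"
      then have "W z ! i \<in> wht T y1" using lower.wht_between y1 z i by blast
      then show False using fminus_wht_disjoint y1 yx i \<open>y1 \<noteq> y\<close> by blast
    qed
    ultimately show ?thesis using y1
      by (intro exI[of _ y1] exI[of _ "-1"] exI[of _ 1]) (auto simp: fsign_def fplus_def)
  qed
qed

text \<open>Distinct sources of \<open>x\<close> have disjoint sets of white dots, which is what
  \<open>before_total\<close> asks for.\<close>

lemma loop_order:
  "strict_total_order_on {y. floop S W T z y \<and> fminus T U y x}
     {(y, y'). y \<noteq> y' \<and> (floop S W T z y \<and> fminus T U y x) \<and> (floop S W T z y' \<and> fminus T U y' x) \<and>
        before W T z y y'}" (is "strict_total_order_on ?L ?R")
  unfolding strict_total_order_on_def
proof (intro conjI)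
  show "trans ?R"
  proof (rule transI)
    fix a b c assume ab: "(a, b) \<in> ?R" and bc: "(b, c) \<in> ?R"
    then have ac: "before W T z a c" using lower.before_trans by auto
    have "a \<noteq> c"
      using ab ac lower.before_irrefl by auto
    with ab bc ac show "(a, c) \<in> ?R" by auto
  qed
  show "total_on ?L ?R"
  proof (rule total_onI)
    fix y y' assume y: "y \<in> ?L" "y' \<in> ?L" "y \<noteq> y'"
    have "wht T y \<inter> wht T y' = {}" using y fminus_wht_disjoint by blast
    moreover have "y \<in> edges T" "y' \<in> edges T" using y upper.fminus_edges by auto
    ultimately show "(y, y') \<in> ?R \<or> (y', y) \<in> ?R"
      using y lower.before_total by auto
  qed
qed (auto simp: irrefl_def)

lemma no_cycle:
  assumes "p \<ge> 1"
    and "\<And>i. i < p \<Longrightarrow> fplus S T (z (Suc i mod p)) (y (Suc i mod p))"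
    and "\<And>i. i < p \<Longrightarrow> fminus S T (z (Suc i mod p)) (y i)"
  shows False
proof -
  \<comment> \<open>The hypothesis speaks of successor indices only; modulo \<open>p\<close> every
    index is a successor.\<close>
  have plus: "fplus S T (z i) (y i)" if "i < p" for i
  proof -
    have "\<exists>j<p. Suc j mod p = i"
    proof (cases i)
      case 0 then show ?thesis using \<open>p \<ge> 1\<close> by (intro exI[of _ "p - 1"]) auto
    next
      case (Suc j) then show ?thesis using that by (intro exI[of _ j]) auto
    qed
    then show ?thesis using assms(2) by auto
  qed
  have step: "desc S (Edge (z (Suc i mod p))) (Edge (z i))" "z (Suc i mod p) \<noteq> z i" if "i < p" for i
    using lower.fminus_desc_root[OF plus assms(3)] that by auto
  have chain: "desc S (Edge (z i)) (Edge (z 0))" if "i < p" for i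
    using that
  proof (induction i)
    case 0
    then show ?case using lower.fplus_edges[OF plus[of 0]] by (auto intro!: desc_refl)
  next
    case (Suc i)
    then have "desc S (Edge (z (Suc i))) (Edge (z i))" using step(1)[of i] by simp
    then show ?case using Suc desc_trans by (metis Suc_lessD)
  qed
  \<comment> \<open>At the last index the cycle closes: \<open>z 0\<close> descends strictly to
    \<open>z (p - 1)\<close>, which descends to \<open>z 0\<close>.\<close>
  have "Suc (p - 1) mod p = 0" "p - 1 < p" using \<open>p \<ge> 1\<close> by auto
  then show False using step[of "p - 1"] chain[of "p - 1"] lower.T.desc_antisym
    by (metis elt.inject(2))
qed

text \<open>A loop has no black dot above it, so it is not a leaf of \<open>T\<close>. Its source
  node \<open>a\<close> is a leaf of \<open>U\<close>, hence a cell whose block is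
  \<open>{a}\<close>, and this cell has \<open>y\<close> as its target.\<close>

lemma loop_is_target:
  assumes "floop S W T z y" "y \<in> edges T"
  shows "\<exists>x\<in>edges U. fplus T U y x"
proof -
  have "y \<notin> leaves T" using assms desc_refl[of "Edge y" T] by (auto simp: floop_def blk_def)
  then obtain a where a: "(a, y) \<in> tgt_edge T" using assms(2) by (auto simp: leaves_def)
  then have "a \<in> leaves U" using upper.nodes_eq_leaves lower.U.te_sub by auto
  then have "blk U a = {a}" by (auto simp: blk_def upper.U.desc_leaf leaves_def)
  moreover have "(y, a) \<notin> tgt_node T"
    using a lower.U.step_not_desc[of "Node a" "Edge y"] lower.U.desc_step[of "Edge y" "Node a"]
    by (auto simp: Node_step Edge_step)
  ultimately show ?thesis using a \<open>a \<in> leaves U\<close>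
    by (intro bexI[of _ a]) (auto simp: fplus_def src_in_def tgt_in_def leaves_def)
qed

end

context exact
begin

text \<open>Used to climb to the greatest cell. A node adjacent to \<open>z\<close> is an edge of
  \<open>U\<close> with \<open>z\<close> among its faces; with no adjacent node, \<open>T\<close> is
  the unit tree on \<open>z\<close> and every edge of \<open>U\<close> is a loop on
  \<open>z\<close>.\<close>

lemma edge_is_face:
  assumes "z \<in> edges T"
  shows "\<exists>x\<in>edges U. \<exists>s. fsign T W U s z x"
proof (cases "\<exists>a. (a, z) \<in> tgt_edge T \<or> (z, a) \<in> tgt_node T")
  case True
  then obtain a where a: "(a, z) \<in> tgt_edge T \<or> (z, a) \<in> tgt_node T" by blast
  then have "a \<in> leaves U" using nodes_eq_leaves T.te_sub T.tn_sub by auto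
  then have blk: "blk U a = {a}" by (auto simp: blk_def U.desc_leaf leaves_def)
  have "\<not> ((a, z) \<in> tgt_edge T \<and> (z, a) \<in> tgt_node T)"
    using T.step_not_desc[of "Node a" "Edge z"] T.desc_step[of "Edge z" "Node a"]
    by (auto simp: Node_step Edge_step)
  then have "fplus T U z a \<or> fminus T U z a"
    using a blk by (auto simp: fplus_def fminus_def src_in_def tgt_in_def)
  then show ?thesis using \<open>a \<in> leaves U\<close> unfolding fsign_def leaves_def by blast
next
  case False
  have edges: "b = z" if "b \<in> edges T" for b
  proof -
    have "desc T x (Edge z) \<Longrightarrow> x = Edge z" "desc T (Edge z) x \<Longrightarrow> x = Edge z" for x
      using False by (auto simp: T.desc_Edge_iff T.Edge_desc_iff)
    then have "z = root T" using T.edge_desc_root[OF assms] by auto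
    then show ?thesis using T.edge_desc_root[OF that] False by (auto simp: T.desc_Edge_iff[of _ "root T"])
  qed
  \<comment> \<open>Any edge of \<open>U\<close> would do; the root is one that surely
    exists.\<close>
  define x where "x = root U"
  have x: "x \<in> edges U" by (simp add: x_def U.root_edge)
  have "blk U x = {}"
  proof (rule ccontr)
    assume "blk U x \<noteq> {}"
    then obtain a where "a \<in> nodes T" using blk_nodes by blast
    then show False using T.te_ex edges False T.te_sub by metis
  qed
  then obtain c where "floop T W U c x" using floop_exists x by blast
  then show ?thesis using edges x unfolding fsign_def floop_def by metis
qed

end

section \<open>Isomorphisms of rooted trees\<close>

lemma target_step_image:
  "target_step T = (\<lambda>(a, b). (Node a, Edge b)) ` tgt_edge T \<union> (\<lambda>(b, a). (Edge b, Node a)) ` tgt_node T"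
  by (auto simp: target_step_def)

text \<open>\<open>T'\<close> is not assumed rooted: \<open>rooted_image\<close> derives it, and
  this is how the renaming by \<open>Old\<close> yields rooted trees.\<close>

locale tree_iso = rtree T for T :: "('n, 'e) tree" +
  fixes fn :: "'n \<Rightarrow> 'm" and fe :: "'e \<Rightarrow> 'f" and T' :: "('m, 'f) tree"
  assumes inj_nodes: "inj_on fn (nodes T)" and inj_edges: "inj_on fe (edges T)"
    and nodes_image: "nodes T' = fn ` nodes T" and edges_image: "edges T' = fe ` edges T"
    and te_image: "tgt_edge T' = map_prod fn fe ` tgt_edge T"
    and tn_image: "tgt_node T' = map_prod fe fn ` tgt_node T"
    and root_image: "root T' = fe (root T)"
begin

lemma te_iff:
  assumes "a \<in> nodes T" "b \<in> edges T"
  shows "(fn a, fe b) \<in> tgt_edge T' \<longleftrightarrow> (a, b) \<in> tgt_edge T"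
proof
  assume "(fn a, fe b) \<in> tgt_edge T'"
  then obtain a' b' where "(a', b') \<in> tgt_edge T" "fn a' = fn a" "fe b' = fe b"
    unfolding te_image by auto
  then show "(a, b) \<in> tgt_edge T" using assms inj_nodes inj_edges te_sub by (metis inj_on_eq_iff)
qed (auto simp: te_image)

lemma tn_iff:
  assumes "b \<in> edges T" "a \<in> nodes T"
  shows "(fe b, fn a) \<in> tgt_node T' \<longleftrightarrow> (b, a) \<in> tgt_node T"
proof
  assume "(fe b, fn a) \<in> tgt_node T'"
  then obtain b' a' where "(b', a') \<in> tgt_node T" "fn a' = fn a" "fe b' = fe b"
    unfolding tn_image by auto
  then show "(b, a) \<in> tgt_node T" using assms inj_nodes inj_edges tn_sub by (metis inj_on_eq_iff)
qed (auto simp: tn_image)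

abbreviation "h \<equiv> map_elt fn fe"

lemma step_image: "target_step T' = map_prod h h ` target_step T"
  by (simp add: target_step_image te_image tn_image image_Un image_image case_prod_unfold)

lemma inj_elts: "inj_on h (elts T)"
proof (rule inj_onI)
  fix x y assume "x \<in> elts T" "y \<in> elts T" "h x = h y"
  then show "x = y" by (cases x; cases y) (auto dest: inj_onD[OF inj_nodes] inj_onD[OF inj_edges])
qed

lemma elts_image: "elts T' = h ` elts T"
  by (simp add: elts_def nodes_image edges_image image_Un image_image)

lemma steps_image: "(x, y) \<in> (target_step T)\<^sup>* \<Longrightarrow> (h x, h y) \<in> (target_step T')\<^sup>*"
  by (induction rule: rtrancl_induct) (auto intro: rtrancl_into_rtrancl simp: step_image)

text \<open>Injectivity on the elements of \<open>T\<close> identifies the start of each step of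
  \<open>T'\<close> with the point already reached, so paths of \<open>T'\<close> lift one step at a
  time.\<close>

lemma steps_lift:
  assumes "(h x, y') \<in> (target_step T')\<^sup>*" "x \<in> elts T"
  shows "\<exists>y\<in>elts T. y' = h y \<and> (x, y) \<in> (target_step T)\<^sup>*"
  using assms(1)
proof (induction rule: rtrancl_induct)
  case base
  then show ?case using assms(2) by auto
next
  case (step y' z')
  then obtain y where y: "y \<in> elts T" "y' = h y" "(x, y) \<in> (target_step T)\<^sup>*" by blast
  obtain u v where u: "(u, v) \<in> target_step T" "y' = h u" "z' = h v"
    using step.hyps(2) by (auto simp: step_image)
  then have "u = y" using y inj_elts step_elts by (metis inj_on_eq_iff)
  then have "(x, v) \<in> (target_step T)\<^sup>*" "v \<in> elts T"
    using u(1) y(3) step_elts by (auto intro: rtrancl_into_rtrancl)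
  then show ?case using u(3) by blast
qed

lemma desc_iff:
  assumes "x \<in> elts T" "y \<in> elts T"
  shows "desc T' (h x) (h y) \<longleftrightarrow> desc T x y"
proof
  assume "desc T' (h x) (h y)"
  then obtain y' where "y' \<in> elts T" "h y = h y'" "(x, y') \<in> (target_step T)\<^sup>*"
    using steps_lift[OF _ assms(1)] by (auto simp: desc_def)
  then show "desc T x y" using assms inj_elts by (metis desc_def inj_on_eq_iff)
next
  assume "desc T x y"
  then show "desc T' (h x) (h y)" using steps_image by (auto simp: desc_def elts_image)
qed

lemma desc_EE: "a \<in> edges T \<Longrightarrow> b \<in> edges T \<Longrightarrow> desc T' (Edge (fe a)) (Edge (fe b)) \<longleftrightarrow> desc T (Edge a) (Edge b)"
  and desc_NE: "v \<in> nodes T \<Longrightarrow> b \<in> edges T \<Longrightarrow> desc T' (Node (fn v)) (Edge (fe b)) \<longleftrightarrow> desc T (Node v) (Edge b)"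
  using desc_iff[of "Edge a" "Edge b"] desc_iff[of "Node v" "Edge b"] by auto

lemma leaves_image: "leaves T' = fe ` leaves T"
proof -
  have "(\<exists>a. (a, fe b) \<in> tgt_edge T') \<longleftrightarrow> (\<exists>a. (a, b) \<in> tgt_edge T)" if "b \<in> edges T" for b
  proof
    assume "\<exists>a. (a, fe b) \<in> tgt_edge T'"
    then obtain a b' where "(a, b') \<in> tgt_edge T" "fe b' = fe b" unfolding te_image by auto
    then show "\<exists>a. (a, b) \<in> tgt_edge T" using that inj_edges te_sub by (metis inj_on_eq_iff)
  qed (auto simp: te_image)
  then show ?thesis by (auto simp: leaves_def edges_image)
qed

lemma null_image: "null_dots T' = fn ` null_dots T"
proof -
  have "(\<exists>b. (b, fn a) \<in> tgt_node T') \<longleftrightarrow> (\<exists>b. (b, a) \<in> tgt_node T)" if "a \<in> nodes T" for a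
  proof
    assume "\<exists>b. (b, fn a) \<in> tgt_node T'"
    then obtain b a' where "(b, a') \<in> tgt_node T" "fn a' = fn a" unfolding tn_image by auto
    then show "\<exists>b. (b, a) \<in> tgt_node T" using that inj_nodes tn_sub by (metis inj_on_eq_iff)
  qed (auto simp: tn_image)
  then show ?thesis by (auto simp: null_dots_def nodes_image)
qed

lemma blk_image:
  assumes "e \<in> edges T"
  shows "blk T' (fe e) = fe ` blk T e"
proof -
  have "desc T' (Edge (fe b)) (Edge (fe e)) \<longleftrightarrow> desc T (Edge b) (Edge e)" if "b \<in> leaves T" for b
    using that assms by (intro desc_EE) (auto simp: leaves_def)
  then show ?thesis unfolding blk_def leaves_image by blast
qed

lemma wht_image:
  assumes "e \<in> edges T"
  shows "wht T' (fe e) = fn ` wht T e"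
proof -
  have "desc T' (Node (fn b)) (Edge (fe e)) \<longleftrightarrow> desc T (Node b) (Edge e)" if "b \<in> null_dots T" for b
    using that assms by (intro desc_NE) (auto simp: null_dots_def)
  then show ?thesis unfolding wht_def null_image by blast
qed

lemma rooted_image: "rooted_tree T'"
proof -
  have te: "a \<in> nodes T" "b \<in> edges T" if "(a, b) \<in> tgt_edge T" for a b using that te_sub by auto
  have tn: "a \<in> nodes T" "b \<in> edges T" if "(b, a) \<in> tgt_node T" for a b using that tn_sub by auto
  have ex: "\<exists>!b. (a, b) \<in> tgt_edge T'" if a: "a \<in> nodes T'" for a
  proof -
    obtain a0 where a0: "a = fn a0" "a0 \<in> nodes T" using a nodes_image by auto
    then obtain b0 where "(a0, b0) \<in> tgt_edge T" using te_ex by blast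
    then show ?thesis unfolding te_image using a0
      by (intro ex1I[of _ "fe b0"]) (auto simp: inj_on_eq_iff[OF inj_nodes] te dest: te_fun)
  qed
  have te_inj': "a = a'" if "(a, b) \<in> tgt_edge T'" "(a', b) \<in> tgt_edge T'" for a a' b
    using that unfolding te_image by (auto simp: inj_on_eq_iff[OF inj_edges] te dest: te_inj)
  have tn_fun': "a = a'" if "(b, a) \<in> tgt_node T'" "(b, a') \<in> tgt_node T'" for a a' b
    using that unfolding tn_image by (auto simp: inj_on_eq_iff[OF inj_edges] tn dest: tn_fun)
  have root': "(root T', a) \<notin> tgt_node T'" for a
    using root_tn root_edge tn unfolding tn_image root_image
    by (auto simp: inj_on_eq_iff[OF inj_edges])
  have desc': "desc T' (Edge b) (Edge (root T'))" if "b \<in> edges T'" for b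
    using that desc_EE root_edge edge_desc_root by (auto simp: edges_image root_image)
  have sub': "tgt_edge T' \<subseteq> nodes T' \<times> edges T'" "tgt_node T' \<subseteq> edges T' \<times> nodes T'"
    using te tn by (auto simp: te_image tn_image nodes_image edges_image)
  have mem': "root T' \<in> edges T'" using root_edge by (simp add: root_image edges_image)
  have fin': "finite (nodes T')" "finite (edges T')"
    using finite_nodes finite_edges by (simp_all add: nodes_image edges_image)
  show ?thesis unfolding rooted_tree_def
    by (intro conjI ballI allI impI; (elim conjE)?)
      (fact fin' sub' mem' root' | erule ex desc' | erule te_inj', assumption | erule tn_fun', assumption)+
qed

end

text \<open>Exactness forces the sharing of maps: \<open>fn\<close> acts on the nodes of
  \<open>T\<close> and on the edges of \<open>U\<close>, because the former are leaves of the
  latter; \<open>fw\<close> acts on the nodes of \<open>U\<close>, hence on the white dots of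
  \<open>T\<close>.\<close>

locale exact_iso = exact T W U + T: tree_iso T fn fe T' + U: tree_iso U fw fn U'
  for T :: "('n, 'e) tree" and W :: "'e \<Rightarrow> 'w list" and U :: "('w, 'n) tree"
    and fw :: "'w \<Rightarrow> 'v" and fn :: "'n \<Rightarrow> 'm" and fe :: "'e \<Rightarrow> 'f"
    and T' :: "('m, 'f) tree" and U' :: "('v, 'm) tree" +
  fixes W' :: "'f \<Rightarrow> 'v list"
  assumes W_image: "b \<in> edges T \<Longrightarrow> W' (fe b) = map fw (W b)"
begin

lemma src_in_image: "z \<in> edges T \<Longrightarrow> e \<in> edges U \<Longrightarrow> src_in T' U' (fe z) (fn e) \<longleftrightarrow> src_in T U z e"
  and tgt_in_image: "z \<in> edges T \<Longrightarrow> e \<in> edges U \<Longrightarrow> tgt_in T' U' (fe z) (fn e) \<longleftrightarrow> tgt_in T U z e"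
  using T.te_iff T.tn_iff by (auto simp: src_in_def tgt_in_def U.blk_image blk_nodes)

lemma wht_image_iff:
  assumes "z \<in> edges T" "e \<in> edges U" "i < length (W z)"
  shows "W' (fe z) ! i \<in> wht U' (fn e) \<longleftrightarrow> W z ! i \<in> wht U e"
proof -
  have "W z ! i \<in> whitedots T W" using assms nth_mem by (force simp: whitedots_def)
  then have "W z ! i \<in> nodes U" by (simp add: white_eq_null null_dots_def)
  moreover have "wht U e \<subseteq> nodes U" by (auto simp: wht_def null_dots_def)
  ultimately show ?thesis
    using assms inj_on_image_mem_iff[OF U.inj_nodes] by (simp add: W_image U.wht_image)
qed

lemma floop_image:
  assumes "z \<in> edges T" "e \<in> edges U"
  shows "floop T' W' U' (fe z) (fn e) \<longleftrightarrow> floop T W U z e"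
proof -
  have "set (W' (fe z)) \<inter> wht U' (fn e) \<noteq> {} \<longleftrightarrow> (\<exists>i<length (W' (fe z)). W' (fe z) ! i \<in> wht U' (fn e))"
    by (auto simp: set_conv_nth)
  also have "\<dots> \<longleftrightarrow> (\<exists>i<length (W z). W z ! i \<in> wht U e)"
    using wht_image_iff[OF assms] W_image[OF assms(1)] by auto
  also have "\<dots> \<longleftrightarrow> set (W z) \<inter> wht U e \<noteq> {}" by (auto simp: set_conv_nth)
  finally show ?thesis using assms by (auto simp: floop_def U.blk_image T.edges_image)
qed

lemma before_image:
  "z \<in> edges T \<Longrightarrow> y \<in> edges U \<Longrightarrow> y' \<in> edges U \<Longrightarrow>
    before W' U' (fe z) (fn y) (fn y') \<longleftrightarrow> before W U z y y'"
  unfolding before_def using wht_image_iff W_image by auto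

text \<open>Serves to rename the trees of an opetope by \<open>Old\<close>, where exactness of the
  image is not known beforehand.\<close>

lemma exact_image:
  assumes W'_empty: "\<And>b. b \<notin> edges T' \<Longrightarrow> W' b = []"
  shows "exact_constellation T' W' U'"
proof -
  let ?d = "map_dot fn fw"
  have whites: "whitedots T' W' = fw ` whitedots T W"
    by (auto simp: whitedots_def T.edges_image W_image)
  have white_nodes: "whitedots T W \<subseteq> nodes U" by (auto simp: white_eq_null null_dots_def)
  have inj: "inj_on fw (whitedots T W)" using U.inj_nodes white_nodes by (rule inj_on_subset)
  have sub: "subdivision T' W'"
    unfolding subdivision_def
  proof (intro conjI ballI allI impI)
    fix b assume "b \<in> edges T'"
    then obtain c where c: "b = fe c" "c \<in> edges T" by (auto simp: T.edges_image)
    then have "inj_on fw (set (W c))" using inj by (rule_tac inj_on_subset) (auto simp: whitedots_def)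
    then show "distinct (W' b)" using c T.subdiv by (simp add: W_image distinct_map subdivision_def)
    fix b' assume "b' \<in> edges T'" "b \<noteq> b'"
    then obtain c' where c': "b' = fe c'" "c' \<in> edges T" by (auto simp: T.edges_image)
    then have "set (W c) \<inter> set (W c') = {}"
      using c \<open>b \<noteq> b'\<close> T.subdiv unfolding subdivision_def by metis
    moreover have "set (W c) \<subseteq> whitedots T W" "set (W c') \<subseteq> whitedots T W"
      using c c' by (auto simp: whitedots_def)
    ultimately have "fw ` set (W c) \<inter> fw ` set (W c') = {}"
      using inj_on_image_Int[OF inj] by (metis image_empty)
    then show "set (W' b) \<inter> set (W' b') = {}" using c c' by (simp add: W_image)
  qed (use W'_empty in simp)
  interpret T': subdivided_rtree T' W' using T.rooted_image sub by unfold_locales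
  have dots: "dots T' W' = ?d ` dots T W"
    by (simp add: T.nodes_subdivided T'.nodes_subdivided T.nodes_image whites image_Un image_image)
  have cross: "\<exists>c'. (?d u, c') \<in> tgt_edge (subdivided T' W') \<and> (c', ?d v) \<in> tgt_node (subdivided T' W')"
    if "(u, c) \<in> tgt_edge (subdivided T W)" "(c, v) \<in> tgt_node (subdivided T W)" for u v c
  proof -
    obtain b i where c: "c = (b, i)" by force
    have b: "b \<in> edges T" using that(1) T.te_sub unfolding c T.te_subdivided by blast
    have "(?d u, (fe b, i)) \<in> tgt_edge (subdivided T' W')"
      using that(1) b T.te_sub T.te_iff unfolding c T.te_subdivided T'.te_subdivided
      by (auto simp: W_image T.edges_image)
    moreover have "((fe b, i), ?d v) \<in> tgt_node (subdivided T' W')"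
      using that(2) b T.tn_sub T.tn_iff unfolding c T.tn_subdivided T'.tn_subdivided
      by (auto simp: W_image T.edges_image)
    ultimately show ?thesis by blast
  qed
  have adj: "adjacent (subdivided T' W') (?d u) (?d v)" if "adjacent (subdivided T W) u v" for u v
    using that cross unfolding adjacent_def by blast
  have conn: "induces_connected (subdivided T' W') (?d ` A)"
    if A: "induces_connected (subdivided T W) A" for A
    unfolding induces_connected_def
  proof (intro ballI, elim imageE)
    fix u' v' u v assume u: "u' = ?d u" "u \<in> A" and v: "v' = ?d v" "v \<in> A"
    then have "(u, v) \<in> {(s, t). s \<in> A \<and> t \<in> A \<and> adjacent (subdivided T W) s t}\<^sup>*"
      using A by (auto simp: induces_connected_def)
    then have "(?d u, ?d v) \<in> {(s, t). s \<in> ?d ` A \<and> t \<in> ?d ` A \<and> adjacent (subdivided T' W') s t}\<^sup>*"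
    proof (induction rule: rtrancl_induct)
      case (step t v)
      then have "(?d t, ?d v) \<in> {(s, t). s \<in> ?d ` A \<and> t \<in> ?d ` A \<and> adjacent (subdivided T' W') s t}"
        using adj by auto
      with step.IH show ?case by (rule rtrancl_into_rtrancl)
    qed simp
    then show "(u', v') \<in> {(s, t). s \<in> ?d ` A \<and> t \<in> ?d ` A \<and> adjacent (subdivided T' W') s t}\<^sup>*"
      by (simp add: u v)
  qed
  \<comment> \<open>Descent is invariant, so the sets of the kernel rule correspond under
    \<open>?d\<close>, and \<open>conn\<close> keeps them connected.\<close>
  have kernel: "{t \<in> dots T' W'. desc U' (dot_map id id t) (Node (fw x))} =
      ?d ` {t \<in> dots T W. desc U (dot_map id id t) (Node x)}" if "x \<in> nodes U" for x
  proof -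
    have "desc U' (dot_map id id (?d t)) (Node (fw x)) \<longleftrightarrow> desc U (dot_map id id t) (Node x)"
      if t: "t \<in> dots T W" for t
    proof -
      have "dot_map id id t \<in> elts U"
        using t white_nodes by (cases t) (auto simp: T.nodes_subdivided nodes_eq_leaves leaves_def)
      moreover have "dot_map id id (?d t) = map_elt fw fn (dot_map id id t)" by (cases t) auto
      ultimately show ?thesis using U.desc_iff[of _ "Node x"] \<open>x \<in> nodes U\<close> by simp
    qed
    then show ?thesis unfolding dots by blast
  qed
  have "nodes T' = leaves U'" by (simp add: T.nodes_image U.leaves_image nodes_eq_leaves)
  moreover have "whitedots T' W' = null_dots U'" by (simp add: whites white_eq_null U.null_image)
  moreover have "induces_connected (subdivided T' W') {t \<in> dots T' W'. desc U' (dot_map id id t) (Node x)}"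
    if x: "x \<in> nodes U'" for x
  proof -
    obtain x0 where "x = fw x0" "x0 \<in> nodes U" using x U.nodes_image by auto
    then show ?thesis using exact kernel conn by (auto simp: exact_constellation_def constellation_def)
  qed
  ultimately show ?thesis
    using T.rooted_image U.rooted_image sub by (simp add: exact_constellation_def constellation_def)
qed

end

section \<open>The extended opetope\<close>

lemma rooted_corolla:
  assumes "finite L" "r \<notin> L"
  shows "rooted_tree (corolla a L r)"
proof -
  have st: "target_step (corolla a L r) = insert (Node a, Edge r) ((\<lambda>b. (Edge b, Node a)) ` L)"
    by (auto simp: target_step_def corolla_def)
  have "(Edge b, Edge r) \<in> (target_step (corolla a L r))\<^sup>*" if "b \<in> insert r L" for b
  proof (cases "b = r")
    case False
    then have "(Edge b, Node a) \<in> target_step (corolla a L r)"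
      "(Node a, Edge r) \<in> target_step (corolla a L r)" using that by (auto simp: st)
    then show ?thesis by (meson converse_rtrancl_into_rtrancl rtrancl.rtrancl_refl)
  qed simp
  then have "\<forall>b\<in>edges (corolla a L r). desc (corolla a L r) (Edge b) (Edge (root (corolla a L r)))"
    by (auto simp: desc_def) (auto simp: corolla_def)
  then show ?thesis using assms by (auto simp: rooted_tree_def) (auto simp: corolla_def)
qed

lemma rooted_unit: "rooted_tree (unit_tree b)"
  by (auto simp: rooted_tree_def unit_tree_def desc_def)

lemma leaves_corolla: "r \<notin> L \<Longrightarrow> leaves (corolla a L r) = L"
  and null_dots_corolla: "null_dots (corolla a L r) = (if L = {} then {a} else {})"
  and leaves_unit: "leaves (unit_tree b) = {b}"
  and null_dots_unit: "null_dots (unit_tree b) = {}"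
  by (auto simp: leaves_def null_dots_def corolla_def unit_tree_def)

text \<open>This is the kernel rule at the node of the added corolla: every node is joined to the
  one directly above the root edge.\<close>

lemma (in rtree) connected_dots:
  "induces_connected (subdivided T (\<lambda>_. [] :: 'w list)) (dots T (\<lambda>_. []))"
proof -
  let ?W = "\<lambda>_ :: 'e. [] :: 'w list"
  interpret subdivided_rtree T ?W by unfold_locales (simp add: subdivision_def)
  let ?R = "{(s, t). s \<in> dots T ?W \<and> t \<in> dots T ?W \<and> adjacent (subdivided T ?W) s t}"
  have dots: "dots T ?W = Black ` nodes T" by (simp add: nodes_subdivided whitedots_def)
  have adj: "(Black a, Black c) \<in> ?R" if "(a, b) \<in> tgt_edge T" "(b, c) \<in> tgt_node T" for a b c
    using that te_sub tn_sub unfolding dots adjacent_def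
    by (auto simp: te_subdivided tn_subdivided intro!: exI[of _ b] exI[of _ "0::nat"])
  have sym: "sym ?R" by (auto simp: sym_def adjacent_def)
  let ?P = "\<lambda>a. \<exists>c. (c, root T) \<in> tgt_edge T \<and> (Black a, Black c) \<in> ?R\<^sup>*"
  \<comment> \<open>For an edge the claim concerns its source node, because \<open>?R\<close>
    relates nodes only.\<close>
  have "\<forall>a. (x = Node a \<longrightarrow> ?P a) \<and> (\<forall>b. x = Edge b \<and> (a, b) \<in> tgt_edge T \<longrightarrow> ?P a)"
    if "(x, Edge (root T)) \<in> (target_step T)\<^sup>*" for x
    using that
  proof (induction rule: converse_rtrancl_induct)
    case base
    then show ?case by auto
  next
    case (step x y)
    show ?case
    proof (cases x)
      case (Node a)
      then show ?thesis using step by (auto simp: Node_step)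
    next
      case (Edge b)
      then obtain c where c: "(b, c) \<in> tgt_node T" "y = Node c" using step.hyps(1) by (auto simp: Edge_step)
      then obtain d where d: "(d, root T) \<in> tgt_edge T" "(Black c, Black d) \<in> ?R\<^sup>*"
        using step.IH by blast
      have "?P a" if "(a, b) \<in> tgt_edge T" for a
        using adj[OF that c(1)] d by (meson converse_rtrancl_into_rtrancl)
      then show ?thesis using Edge by auto
    qed
  qed
  then have bot: "?P a" if "a \<in> nodes T" for a
    using desc_root[of "Node a"] that by (auto simp: desc_def)
  have "(Black u, Black v) \<in> ?R\<^sup>*" if uv: "u \<in> nodes T" "v \<in> nodes T" for u v
  proof -
    obtain c c' where c: "(c, root T) \<in> tgt_edge T" "(Black u, Black c) \<in> ?R\<^sup>*"
      and c': "(c', root T) \<in> tgt_edge T" "(Black v, Black c') \<in> ?R\<^sup>*"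
      using bot[OF uv(1)] bot[OF uv(2)] by blast
    have "c = c'" using te_inj[OF c(1) c'(1)] .
    moreover have "(Black c', Black v) \<in> ?R\<^sup>*" using sym_rtrancl[OF sym] c'(2) by (rule symD)
    ultimately show ?thesis using rtrancl_trans[OF c(2)] by simp
  qed
  then show ?thesis unfolding induces_connected_def dots by blast
qed

lemma op_dim_eq: "n_opetope n Y \<Longrightarrow> op_dim Y = n"
  by (simp add: n_opetope_def op_dim_def)

text \<open>If the last tree of \<open>Y\<close> is a unit tree, the node \<open>Top\<close> of the corolla is a null dot, so exactness
  needs one white dot on that unit tree. The construction P does not see it.\<close>

definition ext_white :: "'a opetope \<Rightarrow> nat \<Rightarrow> 'a ext \<Rightarrow> 'a ext list" where
  "ext_white Y k = (if k = op_dim Y \<and> nodes (trees Y ! k) = {}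
     then (\<lambda>b. if b \<in> edges (ext_tree Y k) then [Top] else []) else ext_sub Y k)"

lemma old_tree_iso:
  assumes "rooted_tree T"
  shows "tree_iso T Old Old (old_tree T)"
proof -
  interpret rtree T using assms by unfold_locales
  show ?thesis by unfold_locales (auto simp: old_tree_def inj_on_def)
qed

lemma exact_old:
  assumes "exact_constellation T W U" and W': "\<And>b. W' (Old b) = map Old (W b)"
    "W' Top = []" "W' Top_Root = []"
  shows "exact_constellation (old_tree T) W' (old_tree U)"
proof -
  interpret exact T W U using assms by unfold_locales
  interpret T: tree_iso T Old Old "old_tree T" using T.rooted by (rule old_tree_iso)
  interpret U: tree_iso U Old Old "old_tree U" using U.rooted by (rule old_tree_iso)
  interpret exact_iso T W U Old Old Old "old_tree T" "old_tree U" W'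
    by unfold_locales (simp add: W')
  show ?thesis
  proof (rule exact_image)
    fix b assume "b \<notin> edges (old_tree T)"
    moreover have "W c = []" if "c \<notin> edges T" for c
      using T.subdiv that by (simp add: subdivision_def)
    ultimately show "W' b = []" using W' by (cases b) (auto simp: old_tree_def)
  qed
qed

text \<open>Without nodes, \<open>T\<close> is a unit tree and \<open>a\<close> is a null dot,
  matched by the single white dot. Otherwise all dots of \<open>T\<close> are leaves directly above
  \<open>a\<close>, and the kernel rule is the connectedness of all of \<open>T\<close>.\<close>

lemma exact_corolla:
  assumes T: "rooted_tree T" and fresh: "r \<notin> nodes T"
    and W: "W = (if nodes T = {} then (\<lambda>b. if b \<in> edges T then [a] else []) else (\<lambda>_. []))"
  shows "exact_constellation T W (corolla a (nodes T) r)"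
proof -
  interpret rtree T using T by unfold_locales
  have no_nodes: "edges T = {root T}" if "nodes T = {}"
    using that edge_desc_root root_edge te_sub by (auto simp: desc_Edge_iff)
  then have sub: "subdivision T W" by (auto simp: subdivision_def W)
  then interpret subdivided_rtree T W by unfold_locales
  have "whitedots T W = null_dots (corolla a (nodes T) r)"
    using no_nodes by (auto simp: W whitedots_def null_dots_corolla)
  moreover have "induces_connected (subdivided T W)
    {t \<in> dots T W. desc (corolla a (nodes T) r) (dot_map id id t) (Node x)}"
    if "x \<in> nodes (corolla a (nodes T) r)" for x
  proof (cases "nodes T = {}")
    case True
    then have "dots T W \<subseteq> {White a}" using no_nodes unfolding nodes_subdivided by (auto simp: whitedots_def W)
    then show ?thesis by (auto simp: induces_connected_def)
  next
    case False
    then have W0: "W = (\<lambda>_. [])" by (simp add: W)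
    have "{t \<in> dots T W. desc (corolla a (nodes T) r) (dot_map id id t) (Node x)} = dots T W"
    proof -
      have "desc (corolla a (nodes T) r) (Edge b) (Node x)" if "b \<in> nodes T" for b
        using that \<open>x \<in> nodes (corolla a (nodes T) r)\<close>
        by (auto simp: desc_def target_step_def corolla_def intro!: r_into_rtrancl)
      then show ?thesis unfolding nodes_subdivided by (auto simp: whitedots_def W0)
    qed
    then show ?thesis using connected_dots W0 by simp
  qed
  ultimately show ?thesis
    using T sub fresh rooted_corolla[OF finite_nodes fresh]
    by (simp add: exact_constellation_def constellation_def leaves_corolla)
qed

lemma exact_unit:
  assumes "finite L" "r \<notin> L"
  shows "exact_constellation (corolla a L r) (\<lambda>_. []) (unit_tree a)"
  using assms
  by (simp add: rooted_corolla rooted_unit exact_constellation_def constellation_def leaves_unit null_dots_unit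
      subdivision_def whitedots_def) (simp add: corolla_def unit_tree_def)

lemma ext_sub_empty: "op_dim Y \<le> k \<Longrightarrow> ext_sub Y k = (\<lambda>_. [])"
  by (auto simp: ext_sub_def sub_at_def fun_eq_iff split: ext.split)

lemma opetope_rooted:
  assumes Y: "n_opetope n Y" and "k \<le> n"
  shows "rooted_tree (trees Y ! k)"
proof (cases k)
  case 0
  then show ?thesis using Y by (auto simp: n_opetope_def one_node_one_leaf_def)
next
  case (Suc j)
  then have "exact_constellation (trees Y ! j) (subs Y ! j) (trees Y ! k)"
    using assms by (auto simp: n_opetope_def)
  then show ?thesis by (simp add: exact_constellation_def constellation_def)
qed

lemma exact_ext:
  assumes Y: "n_opetope n Y" and "k \<le> Suc n"
  shows "exact_constellation (ext_tree Y k) (ext_white Y k) (ext_tree Y (Suc k))"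
proof -
  have n: "op_dim Y = n" using Y by (rule op_dim_eq)
  have root: "rooted_tree (old_tree (trees Y ! n))"
    using tree_iso.rooted_image[OF old_tree_iso] opetope_rooted[OF Y] by blast
  consider "k < n" | "k = n" | "k = Suc n" using assms by linarith
  then show ?thesis
  proof cases
    case 1
    have "exact_constellation (old_tree (trees Y ! k)) (ext_sub Y k) (old_tree (trees Y ! Suc k))"
    proof (rule exact_old)
      show "exact_constellation (trees Y ! k) (subs Y ! k) (trees Y ! Suc k)"
        using Y 1 by (simp add: n_opetope_def)
    qed (use 1 n in \<open>auto simp: ext_sub_def sub_at_def\<close>)
    then show ?thesis using 1 n by (simp add: ext_tree_def ext_white_def)
  next
    case 2
    have T: "ext_tree Y n = old_tree (trees Y ! n)"
      "ext_tree Y (Suc n) = corolla Top (nodes (old_tree (trees Y ! n))) Top_Root"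
      using n by (simp_all add: ext_tree_def old_tree_def)
    have "ext_white Y n = (if nodes (old_tree (trees Y ! n)) = {}
        then (\<lambda>b. if b \<in> edges (old_tree (trees Y ! n)) then [Top] else []) else (\<lambda>_. []))"
      using n by (simp add: ext_white_def T ext_sub_empty) (simp add: old_tree_def)
    then show ?thesis unfolding 2 T
      by (rule exact_corolla[OF root, rotated]) (auto simp: old_tree_def)
  next
    case 3
    have "finite (Old ` nodes (trees Y ! n))" using opetope_rooted[OF Y, of n] by (simp add: rooted_tree_def)
    then show ?thesis using 3 n exact_unit[of "Old ` nodes (trees Y ! n)" Top_Root Top]
      by (auto simp: ext_tree_def ext_white_def ext_sub_empty)
  qed
qed

text \<open>Where \<open>ext_white\<close> and \<open>ext_sub\<close> differ, the tree has a single
  edge and no node. With either subdivision the induced tree is then the unit tree on that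
  edge.\<close>

lemma induced_ext:
  assumes Y: "n_opetope n Y" and "k \<le> Suc n"
  shows "Stree Y k (Edge e) =
    induced_tree (ext_tree Y k) (ext_white Y k) (odots (ext_tree Y k) (ext_white Y k) (ext_tree Y (Suc k)) (Edge e))"
proof (cases "ext_white Y k = ext_sub Y k")
  case True
  then show ?thesis by (simp add: Stree_def Oset_def odots_def)
next
  case False
  then have k: "k = op_dim Y" "nodes (trees Y ! k) = {}"
    and W: "ext_white Y k = (\<lambda>b. if b \<in> edges (ext_tree Y k) then [Top] else [])"
    by (auto simp: ext_white_def split: if_splits)
  interpret exact "ext_tree Y k" "ext_white Y k" "ext_tree Y (Suc k)"
    by unfold_locales (rule exact_ext[OF assms])
  have nodes: "nodes (ext_tree Y k) = {}" using k by (simp add: ext_tree_def old_tree_def)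
  then have edges: "edges (ext_tree Y k) = {root (ext_tree Y k)}"
    using T.edge_desc_root T.root_edge T.te_sub by (auto simp: T.desc_Edge_iff)
  have blacks: "Black a \<notin> dots (ext_tree Y k) V" for a and V :: "'a ext \<Rightarrow> 'a ext list"
    using nodes by (simp add: subdivided_def) blast
  have whites: "w = Top" if "White w \<in> odots (ext_tree Y k) (ext_white Y k) (ext_tree Y (Suc k)) (Edge e)" for w
    using that edges unfolding odots_def T.nodes_subdivided by (auto simp: whitedots_def W)
  have "White w \<notin> Oset Y k (Edge e)" for w
    using k by (auto simp: Oset_def subdivided_def whitedots_def ext_sub_empty)
  moreover have "Black a \<notin> Oset Y k (Edge e)"
    "Black a \<notin> odots (ext_tree Y k) (ext_white Y k) (ext_tree Y (Suc k)) (Edge e)" for a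
    using blacks by (auto simp: Oset_def odots_def)
  \<comment> \<open>The only possible white dot is \<open>Top\<close>, and it lies on every edge in
    question. So the condition on white dots is void, as it is for the empty
    \<open>Oset\<close>.\<close>
  moreover have "(\<lambda>b. b \<in> edges (ext_tree Y k) \<and> (\<forall>w. White w \<in> odots (ext_tree Y k) (ext_white Y k)
      (ext_tree Y (Suc k)) (Edge e) \<longrightarrow> w \<in> set (ext_white Y k b))) = (\<lambda>b. b \<in> edges (ext_tree Y k))"
    using whites unfolding W by auto
  ultimately show ?thesis unfolding Stree_def induced_tree_def Let_def by simp
qed

lemma ext_tree_top: "op_dim Y = n \<Longrightarrow> ext_tree Y (Suc (Suc n)) = unit_tree Top"
  by (simp add: ext_tree_def)

text \<open>In dimension 0 this tree is the added corolla, with the single node of the bottom tree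
  as its leaf.\<close>

lemma ext_tree_1:
  assumes Y: "n_opetope n Y"
  shows "one_node_one_leaf (ext_tree Y 1)"
proof (cases "n = 0")
  case True
  then have n: "op_dim Y = 0" using Y op_dim_eq by auto
  interpret T: rtree "trees Y ! 0" using opetope_rooted[OF Y] by unfold_locales simp
  have "card (nodes (trees Y ! 0)) = 1" using Y by (simp add: n_opetope_def one_node_one_leaf_def)
  moreover have "Top_Root \<notin> Old ` nodes (trees Y ! 0)" by auto
  moreover have "ext_tree Y 1 = corolla Top (Old ` nodes (trees Y ! 0)) Top_Root"
    using n by (simp add: ext_tree_def)
  ultimately show ?thesis using T.finite_nodes
    by (simp add: one_node_one_leaf_def leaves_corolla rooted_corolla card_image inj_on_def)
      (simp add: corolla_def)
next
  case False
  then have n: "op_dim Y \<ge> 1" "one_node_one_leaf (trees Y ! 1)" "1 \<le> n"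
    using Y False op_dim_eq[OF Y] unfolding n_opetope_def by linarith+
  interpret T: tree_iso "trees Y ! 1" Old Old "old_tree (trees Y ! 1)"
    using opetope_rooted[OF Y n(3)] by (rule old_tree_iso)
  show ?thesis using n T.rooted_image T.nodes_image T.leaves_image
    by (simp add: ext_tree_def one_node_one_leaf_def card_image inj_on_def)
qed

text \<open>Excludes loops in dimension 0. Depending on \<open>n\<close>, the tree of index 2 is a
  unit tree, a corolla with one source or a linear tree, so it has no null dot and the extremal
  element above \<open>e\<close> is a leaf.\<close>

lemma blk_ext_tree_2:
  assumes Y: "n_opetope n Y" and e: "e \<in> edges (ext_tree Y 2)"
  shows "blk (ext_tree Y 2) e \<noteq> {}"
proof -
  interpret ex: exact "ext_tree Y 1" "ext_white Y 1" "ext_tree Y 2"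
    using exact_ext[OF Y, of 1] by unfold_locales (simp add: numeral_2_eq_2)
  have nn: "op_dim Y = n" using Y by (rule op_dim_eq)
  have "null_dots (ext_tree Y 2) = {}"
  proof -
    consider "n = 0" | "n = 1" | "n \<ge> 2" by linarith
    then show ?thesis
    proof cases
      case 1
      then show ?thesis using nn by (simp add: ext_tree_def null_dots_unit)
    next
      case 2
      then have "card (nodes (trees Y ! 1)) = 1" using Y by (simp add: n_opetope_def one_node_one_leaf_def)
      then have "nodes (trees Y ! 1) \<noteq> {}" by auto
      then show ?thesis using 2 nn by (simp add: ext_tree_def null_dots_corolla numeral_2_eq_2)
    next
      case 3
      interpret T: tree_iso "trees Y ! 2" Old Old "old_tree (trees Y ! 2)"
        using opetope_rooted[OF Y 3] by (rule old_tree_iso)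
      have "linear_tree (trees Y ! 2)" using Y 3 by (simp add: n_opetope_def)
      then have "null_dots (trees Y ! 2) = {}" by (auto simp: linear_tree_def null_dots_def)
      then show ?thesis using 3 nn by (simp add: ext_tree_def T.null_image)
    qed
  qed
  then show ?thesis using ex.odots_nonempty[OF e] by (auto simp: wht_def)
qed

section \<open>Faces of P(Y)\<close>

lemma mop_lord_update [simp]:
  "bd (C\<lparr>lord := l\<rparr>) = bd C" "prec (C\<lparr>lord := l\<rparr>) = prec C"
  "prec_minus (C\<lparr>lord := l\<rparr>) = prec_minus C" "prec_plus (C\<lparr>lord := l\<rparr>) = prec_plus C"
  "prec_loop (C\<lparr>lord := l\<rparr>) = prec_loop C" "Lam (C\<lparr>lord := l\<rparr>) = Lam C"
  "bd2 (C\<lparr>lord := l\<rparr>) = bd2 C" "loops_at (C\<lparr>lord := l\<rparr>) = loops_at C"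
  by (auto simp: fun_eq_iff bd_def prec_def prec_minus_def prec_plus_def prec_loop_def
      Lam_def gam_plus_def bd2_def loops_at_def)

text \<open>Applied to \<open>Pair d\<close>, which attaches the dimension to the names ordered by
  \<open>loop_order\<close>.\<close>

lemma strict_total_order_image:
  assumes "strict_total_order_on A r" "inj f"
  shows "strict_total_order_on (f ` A) (map_prod f f ` r)"
proof -
  have mem: "(f x, f y) \<in> map_prod f f ` r \<longleftrightarrow> (x, y) \<in> r" for x y
    using assms(2) by (auto simp: inj_eq)
  have trans: "trans (map_prod f f ` r)"
  proof (rule transI)
    fix x y z assume "(x, y) \<in> map_prod f f ` r" "(y, z) \<in> map_prod f f ` r"
    then obtain a b c where "x = f a" "y = f b" "z = f c" "(a, b) \<in> r" "(b, c) \<in> r"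
      using assms(2) by (auto simp: inj_eq)
    then show "(x, z) \<in> map_prod f f ` r"
      using assms(1) by (auto simp: strict_total_order_on_def mem dest: transD)
  qed
  have "total_on (f ` A) (map_prod f f ` r)"
    using assms(1) by (auto simp: strict_total_order_on_def total_on_def mem)
  moreover have "irrefl (map_prod f f ` r)"
    using assms by (auto simp: strict_total_order_on_def irrefl_def inj_eq)
  moreover have "map_prod f f ` r \<subseteq> f ` A \<times> f ` A"
    using assms(1) by (auto simp: strict_total_order_on_def)
  ultimately show ?thesis using trans by (simp add: strict_total_order_on_def)
qed

locale opetopic =
  fixes Y :: "'a opetope" and n :: nat
  assumes Y: "n_opetope n Y"
begin

abbreviation "S \<equiv> ext_tree Y"
abbreviation "W \<equiv> ext_white Y"
abbreviation "C \<equiv> P_obj Y"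

lemma dim_Y: "op_dim Y = n"
  using Y by (rule op_dim_eq)

lemma exact_level: "k \<le> Suc n \<Longrightarrow> exact (S k) (W k) (S (Suc k))"
  by unfold_locales (rule exact_ext[OF Y])

lemma exact2_level: "k \<le> n \<Longrightarrow> exact2 (S k) (W k) (S (Suc k)) (W (Suc k)) (S (Suc (Suc k)))"
  by (auto simp: exact2_def intro: exact_level)

lemma mem_cells:
  "(d, x) \<in> P_cells Y \<longleftrightarrow> d = -1 \<and> x = root (S 1) \<or> (\<exists>k\<le>n. d = int k \<and> x \<in> edges (S (Suc (Suc k))))"
  by (auto simp: P_cells_def dim_Y)

lemma P_obj_fields [simp]: "cells C = P_cells Y" "dim C = restrict fst (P_cells Y)"
  "dlt C = dlt (P_faces Y)" "gam C = gam (P_faces Y)"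
  by (simp_all add: P_obj_def Let_def) (simp_all add: P_faces_def)

lemma cell_cases:
  assumes "c \<in> P_cells Y"
  obtains "c = (-1, root (S 1))" | k x where "k \<le> n" "x \<in> edges (S (Suc (Suc k)))" "c = (int k, x)"
  using assms by (cases c) (auto simp: mem_cells)

lemma cell [simp]: "k \<le> n \<Longrightarrow> (int k, x) \<in> P_cells Y \<longleftrightarrow> x \<in> edges (S (Suc (Suc k)))"
  by (auto simp: mem_cells)

lemma bottom_cell [simp]: "(-1, x) \<in> P_cells Y \<longleftrightarrow> x = root (S 1)"
  by (auto simp: mem_cells)

text \<open>A cell of dimension \<open>k\<close> is an edge of the tree of index
  \<open>k + 2\<close>, so its faces are read in the constellation ending there.\<close>

lemma mem_gam:
  assumes "k \<le> n" "x \<in> edges (S (Suc (Suc k)))"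
  shows "(d, z) \<in> gam (P_faces Y) (int k, x) \<longleftrightarrow> d = int k - 1 \<and>
    (fplus (S (Suc k)) (S (Suc (Suc k))) z x \<or> floop (S (Suc k)) (W (Suc k)) (S (Suc (Suc k))) z x)"
proof -
  interpret exact "S (Suc k)" "W (Suc k)" "S (Suc (Suc k))" using assms by (intro exact_level) simp
  have "nat (int k + 1) = Suc k" by simp
  then show ?thesis
    using assms root_induced[OF assms(2), of z] induced_ext[OF Y, of "Suc k" x]
    by (auto simp: P_faces_def)
qed

text \<open>The factor \<open>k > 0\<close> reflects that sources are empty by definition in
  dimension 0, although the tree attached to the cell has a leaf.\<close>

lemma mem_dlt:
  assumes "k \<le> n" "x \<in> edges (S (Suc (Suc k)))"
  shows "(d, z) \<in> dlt (P_faces Y) (int k, x) \<longleftrightarrow> k > 0 \<and> d = int k - 1 \<and>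
    (fminus (S (Suc k)) (S (Suc (Suc k))) z x \<or> floop (S (Suc k)) (W (Suc k)) (S (Suc (Suc k))) z x)"
proof -
  interpret exact "S (Suc k)" "W (Suc k)" "S (Suc (Suc k))" using assms by (intro exact_level) simp
  have "nat (int k + 1) = Suc k" by simp
  then show ?thesis
    using assms leaves_induced[OF assms(2), of z] induced_ext[OF Y, of "Suc k" x]
    by (auto simp: P_faces_def)
qed

lemma bottom_faces: "dlt (P_faces Y) (-1, x) = {}" "gam (P_faces Y) (-1, x) = {}"
  by (auto simp: P_faces_def)

lemma no_faces: "c \<notin> P_cells Y \<Longrightarrow> dlt (P_faces Y) c = {}" "c \<notin> P_cells Y \<Longrightarrow> gam (P_faces Y) c = {}"
  by (auto simp: P_faces_def split: prod.splits)

text \<open>The tree of index 1 has a single node \<open>v\<close>, which is the whole block of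
  \<open>x\<close>. The target edge of \<open>v\<close> is the root, because its target node could
  only be \<open>v\<close> again.\<close>

lemma fplus_bottom:
  assumes "x \<in> edges (S (Suc (Suc 0)))"
  shows "fplus (S (Suc 0)) (S (Suc (Suc 0))) z x \<longleftrightarrow> z = root (S 1)"
proof -
  interpret exact "S (Suc 0)" "W (Suc 0)" "S (Suc (Suc 0))" by (intro exact_level) simp
  have one: "one_node_one_leaf (S (Suc 0))" using ext_tree_1[OF Y] by simp
  obtain v where v: "nodes (S (Suc 0)) = {v}"
    using one by (auto simp: one_node_one_leaf_def card_1_singleton_iff)
  have "blk (S (Suc (Suc 0))) x \<noteq> {}" using blk_ext_tree_2[OF Y, of x] assms by (simp add: numeral_2_eq_2)
  moreover have "blk (S (Suc (Suc 0))) x \<subseteq> {v}" using blk_nodes[of _ x] v by auto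
  ultimately have blk: "blk (S (Suc (Suc 0))) x = {v}" by auto
  obtain b where b: "(v, b) \<in> tgt_edge (S (Suc 0))" using T.te_ex v by auto
  have "b = root (S (Suc 0))"
  proof (rule ccontr)
    assume "b \<noteq> root (S (Suc 0))"
    then obtain a where a: "(b, a) \<in> tgt_node (S (Suc 0))"
      using T.edge_desc_root[of b] T.te_sub[OF b] by (auto simp: T.Edge_desc_iff[of b])
    then have "a = v" using T.tn_sub v by auto
    then show False using a b T.step_not_desc[of "Node v" "Edge b"] T.desc_step[of "Edge b" "Node v"]
      by (auto simp: Node_step Edge_step)
  qed
  then have "fplus (S (Suc 0)) (S (Suc (Suc 0))) (root (S 1)) x"
    using b blk T.root_tn by (auto simp: fplus_def src_in_def tgt_in_def)
  then show ?thesis using fplus_unique by blast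
qed

lemma floop_bottom:
  assumes "x \<in> edges (S (Suc (Suc 0)))"
  shows "\<not> floop (S (Suc 0)) V (S (Suc (Suc 0))) z x"
  using blk_ext_tree_2[OF Y, of x] assms by (simp add: numeral_2_eq_2 floop_def)

lemma prec_plus_iff:
  assumes "k \<le> n" "x \<in> edges (S (Suc (Suc k)))"
  shows "prec_plus C (d, z) (int k, x) \<longleftrightarrow> d = int k - 1 \<and> fplus (S (Suc k)) (S (Suc (Suc k))) z x"
  and prec_minus_iff:
    "prec_minus C (d, z) (int k, x) \<longleftrightarrow> k > 0 \<and> d = int k - 1 \<and> fminus (S (Suc k)) (S (Suc (Suc k))) z x"
  and prec_loop_iff:
    "prec_loop C (d, z) (int k, x) \<longleftrightarrow> d = int k - 1 \<and> floop (S (Suc k)) (W (Suc k)) (S (Suc (Suc k))) z x"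
proof -
  interpret exact "S (Suc k)" "W (Suc k)" "S (Suc (Suc k))" using assms by (intro exact_level) simp
  \<comment> \<open>A loop base must lie in the sources, which are empty in dimension 0; there are
    no loops there to contradict this.\<close>
  have k0: "floop (S (Suc k)) (W (Suc k)) (S (Suc (Suc k))) z x \<Longrightarrow> 0 < k"
    using floop_bottom assms by (cases k) auto
  note mem = mem_gam[OF assms] mem_dlt[OF assms]
  show "prec_plus C (d, z) (int k, x) \<longleftrightarrow> d = int k - 1 \<and> fplus (S (Suc k)) (S (Suc (Suc k))) z x"
    using assms k0 fplus_not_fminus fplus_not_floop by (auto simp: prec_plus_def mem)
  show "prec_minus C (d, z) (int k, x) \<longleftrightarrow> k > 0 \<and> d = int k - 1 \<and> fminus (S (Suc k)) (S (Suc (Suc k))) z x"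
    using assms k0 fplus_not_fminus fminus_not_floop by (auto simp: prec_minus_def mem)
  show "prec_loop C (d, z) (int k, x) \<longleftrightarrow> d = int k - 1 \<and> floop (S (Suc k)) (W (Suc k)) (S (Suc (Suc k))) z x"
    using assms k0 fplus_not_floop fplus_not_fminus by (auto simp: prec_loop_def mem)
qed

text \<open>For \<open>k = 0\<close> the leaf of the tree of index 1 is negative in the sense of
  \<open>fminus\<close> but is not a face. Restricting \<open>z\<close> to the root avoids it, since
  the root has no target node.\<close>

lemma prec_sign_iff:
  assumes "k \<le> n" "x \<in> edges (S (Suc (Suc k)))" "k = 0 \<Longrightarrow> z = root (S 1)"
  shows "prec_sign C s (d, z) (int k, x) \<longleftrightarrow>
    d = int k - 1 \<and> fsign (S (Suc k)) (W (Suc k)) (S (Suc (Suc k))) s z x"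
proof -
  interpret exact "S (Suc k)" "W (Suc k)" "S (Suc (Suc k))" using assms by (intro exact_level) simp
  have "fminus (S (Suc k)) (S (Suc (Suc k))) z x \<Longrightarrow> 0 < k"
    using T.root_tn assms(3) by (cases k) (auto simp: fminus_def tgt_in_def)
  then show ?thesis
    by (auto simp: prec_sign_def fsign_def prec_plus_iff[OF assms(1,2)] prec_minus_iff[OF assms(1,2)]
        prec_loop_iff[OF assms(1,2)])
qed

lemma fsign_edges:
  assumes "k \<le> n" "fsign (S (Suc k)) (W (Suc k)) (S (Suc (Suc k))) s z x"
  shows "z \<in> edges (S (Suc k))"
proof -
  interpret exact "S (Suc k)" "W (Suc k)" "S (Suc (Suc k))" using assms by (intro exact_level) simp
  show ?thesis using assms(2) fplus_edges fminus_edges by (auto simp: fsign_def floop_def)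
qed

lemma prec_signE:
  assumes "prec_sign C s c c'"
  obtains k x z where "k \<le> n" "x \<in> edges (S (Suc (Suc k)))" "c' = (int k, x)" "c = (int k - 1, z)"
    "fsign (S (Suc k)) (W (Suc k)) (S (Suc (Suc k))) s z x" "z \<in> edges (S (Suc k))"
    "k = 0 \<Longrightarrow> z = root (S 1)"
proof -
  have "c' \<in> P_cells Y" using assms by (auto simp: prec_sign_def prec_plus_def prec_minus_def prec_loop_def)
  then show thesis
  proof (cases rule: cell_cases)
    case 1
    then show ?thesis using assms
      by (auto simp: prec_sign_def prec_plus_def prec_minus_def prec_loop_def bottom_faces)
  next
    case (2 k x)
    obtain d z where c: "c = (d, z)" by force
    have *: "d = int k - 1 \<and> fsign (S (Suc k)) (W (Suc k)) (S (Suc (Suc k))) s z x \<and> (k = 0 \<longrightarrow> s = 1)"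
      using assms floop_bottom[of x] 2(2)
      by (auto simp: prec_sign_def fsign_def 2(3) c prec_plus_iff[OF 2(1,2)] prec_minus_iff[OF 2(1,2)]
        prec_loop_iff[OF 2(1,2)])
    have "z = root (S 1)" if "k = 0" using * that fplus_bottom[of x z] 2(2) by (auto simp: fsign_def)
    then show ?thesis using that[OF 2] * c fsign_edges[OF 2(1)] by auto
  qed
qed

lemma prec_iff_sign: "prec C c c' \<longleftrightarrow> (\<exists>s. prec_sign C s c c')"
  by (auto simp: prec_def prec_sign_def prec_plus_def prec_minus_def prec_loop_def bd_def)

text \<open>Two levels are involved: the loop \<open>y\<close> on \<open>z\<close> is seen in the
  constellation starting at index \<open>k\<close>, and \<open>y\<close> as a source of
  \<open>x\<close> in the next one.\<close>

lemma mem_loops_at: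
  assumes k: "k \<le> n" and x: "x \<in> edges (S (Suc (Suc k)))"
  shows "(d, y) \<in> loops_at C (int k, x) (e, z) \<longleftrightarrow> k > 0 \<and> d = int k - 1 \<and> e = int k - 2 \<and>
    floop (S k) (W k) (S (Suc k)) z y \<and> fminus (S (Suc k)) (S (Suc (Suc k))) y x"
proof (cases k)
  case 0
  then show ?thesis using prec_minus_iff[OF k x] by (auto simp: loops_at_def)
next
  case (Suc j)
  interpret exact "S (Suc k)" "W (Suc k)" "S (Suc (Suc k))" using k by (intro exact_level) simp
  have "prec_loop C (e, z) (int k - 1, y) \<longleftrightarrow> e = int k - 2 \<and> floop (S k) (W k) (S (Suc k)) z y"
    if "fminus (S (Suc k)) (S (Suc (Suc k))) y x"
    using prec_loop_iff[of j y e z] fminus_edges[OF that] k Suc by simp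
  then show ?thesis using prec_minus_iff[OF k x] Suc by (auto simp: loops_at_def)
qed

lemma mem_lord:
  assumes k: "k \<le> n" and x: "x \<in> edges (S (Suc (Suc k)))"
  shows "((d, y), (d', y')) \<in> lord C (int k, x) (e, z) \<longleftrightarrow>
    (int k, x) \<in> Lam C \<and> (e, z) \<in> bd2 C (int k, x) \<and>
    k > 0 \<and> d = int k - 1 \<and> d' = int k - 1 \<and> e = int k - 2 \<and> y \<noteq> y' \<and>
    (floop (S k) (W k) (S (Suc k)) z y \<and> fminus (S (Suc k)) (S (Suc (Suc k))) y x) \<and>
    (floop (S k) (W k) (S (Suc k)) z y' \<and> fminus (S (Suc k)) (S (Suc (Suc k))) y' x) \<and>
    before (W k) (S (Suc k)) z y y'"
proof -
  have before: "dots_before Y k z (Oset Y k (Edge y)) (Oset Y k (Edge y')) \<longleftrightarrow> before (W k) (S (Suc k)) z y y'"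
    if "k > 0" "fminus (S (Suc k)) (S (Suc (Suc k))) y x"
  proof (cases "k = n \<and> nodes (trees Y ! n) = {}")
    \<comment> \<open>Here \<open>ext_white\<close> has the auxiliary dot. But the corolla has no
      source, so \<open>x\<close> has no negative face and there is nothing to compare.\<close>
    case True
    then have "S (Suc k) = corolla Top {} Top_Root" by (simp add: ext_tree_def dim_Y)
    then have "tgt_node (S (Suc k)) = {}" by (simp add: corolla_def)
    then show ?thesis using that(2) by (simp add: fminus_def tgt_in_def)
  next
    case False
    then have W: "W k = ext_sub Y k" by (auto simp: ext_white_def dim_Y)
    interpret exact "S k" "W k" "S (Suc k)" using k by (intro exact_level) simp
    have "Oset Y k (Edge y) = odots (S k) (W k) (S (Suc k)) (Edge y)" for y
      by (simp add: Oset_def odots_def W)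
    then show ?thesis by (simp add: dots_before_def before_def flip: W)
  qed
  have lord: "lord C (int k, x) (e, z) = (if (int k, x) \<in> Lam C \<and> (e, z) \<in> bd2 C (int k, x)
    then {(c, c'). c \<noteq> c' \<and> c \<in> loops_at C (int k, x) (e, z) \<and> c' \<in> loops_at C (int k, x) (e, z) \<and>
      dots_before Y k z (Oset Y k (Edge (snd c))) (Oset Y k (Edge (snd c')))} else {})"
    by (simp add: P_obj_def Let_def)
  show ?thesis unfolding lord using mem_loops_at[OF k x] before by auto
qed

section \<open>P(Y) is a dendritic face complex\<close>

lemma finite_cells: "finite (P_cells Y)"
proof -
  have "finite (edges (S (Suc (Suc k))))" if "k \<le> n" for k
  proof -
    interpret exact "S (Suc k)" "W (Suc k)" "S (Suc (Suc k))" using that by (intro exact_level) simp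
    show ?thesis by (rule U.finite_edges)
  qed
  moreover have "P_cells Y = insert (-1, root (S 1)) (\<Union>k\<le>n. Pair (int k) ` edges (S (Suc (Suc k))))"
    by (auto simp: P_cells_def dim_Y)
  ultimately show ?thesis by simp
qed

lemma bd_cells:
  assumes "k \<le> n" "x \<in> edges (S (Suc (Suc k)))" "c \<in> bd C (int k, x)"
  shows "c \<in> P_cells Y \<and> fst c = int k - 1"
proof -
  have "prec C c (int k, x)" using assms by (simp add: prec_def)
  then obtain s where "prec_sign C s c (int k, x)" using prec_iff_sign by blast
  then obtain z where z: "c = (int k - 1, z)" "z \<in> edges (S (Suc k))" "k = 0 \<Longrightarrow> z = root (S 1)"
    by (auto elim!: prec_signE)
  show ?thesis
  proof (cases k)
    case 0
    then show ?thesis using z by simp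
  next
    case (Suc j)
    then show ?thesis using z assms(1) by simp
  qed
qed

lemma is_singleton_gam:
  assumes "k \<le> n" "x \<in> edges (S (Suc (Suc k)))"
  shows "is_singleton (gam C (int k, x))"
  using assms by (simp add: P_faces_def)

lemma is_mop_P: "is_mop C"
  unfolding is_mop_def
proof (intro conjI)
  show "finite (cells C)" using finite_cells by simp
  show "dim C \<in> extensional (cells C)" by simp
  show "\<forall>x\<in>cells C. dim C x \<ge> -1" by (auto elim!: cell_cases)
  show "\<forall>x\<in>cells C. dim C x \<ge> 0 \<longrightarrow> bd C x \<subseteq> {y \<in> cells C. dim C y = dim C x - 1}"
    using bd_cells by (auto elim!: cell_cases)
  show "\<forall>x. x \<notin> cells C \<or> dim C x = -1 \<longrightarrow> dlt C x = {} \<and> gam C x = {}"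
  proof (intro allI impI)
    fix c assume "c \<notin> cells C \<or> dim C c = -1"
    then show "dlt C c = {} \<and> gam C c = {}"
    proof (cases "c \<in> P_cells Y")
      case True
      then show ?thesis using \<open>c \<notin> cells C \<or> dim C c = -1\<close> by (elim cell_cases) (auto simp: bottom_faces)
    qed (auto simp: no_faces)
  qed
  show "\<forall>x\<in>cells C. dim C x \<ge> 0 \<longrightarrow> is_singleton (gam C x)"
    using is_singleton_gam by (auto elim!: cell_cases)
  show "\<forall>x\<in>cells C. dlt C x \<inter> gam C x \<noteq> {} \<longrightarrow> dlt C x = gam C x"
  proof (intro ballI impI)
    fix c assume c: "c \<in> cells C" "dlt C c \<inter> gam C c \<noteq> {}"
    then have "c \<in> P_cells Y" by simp
    then show "dlt C c = gam C c"
    proof (cases rule: cell_cases)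
      case 1
      then show ?thesis by (simp add: bottom_faces)
    next
      case (2 k x)
      interpret exact "S (Suc k)" "W (Suc k)" "S (Suc (Suc k))" using 2 by (intro exact_level) simp
      from c(2) obtain d z where z: "(d, z) \<in> dlt C c \<inter> gam C c" by auto
      have "\<not> (fplus (S (Suc k)) (S (Suc (Suc k))) z x \<and> fminus (S (Suc k)) (S (Suc (Suc k))) z x)"
        using fplus_not_fminus by blast
      moreover have "k > 0" using z by (simp add: 2(3) mem_dlt[OF 2(1,2)])
      ultimately have "floop (S (Suc k)) (W (Suc k)) (S (Suc (Suc k))) z x" "k > 0"
        using z by (auto simp: 2(3) mem_dlt[OF 2(1,2)] mem_gam[OF 2(1,2)])
      then have "\<not> fplus (S (Suc k)) (S (Suc (Suc k))) z' x" "\<not> fminus (S (Suc k)) (S (Suc (Suc k))) z' x" for z'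
        using fplus_not_floop fminus_not_floop by blast+
      then show ?thesis using \<open>k > 0\<close> by (auto simp: 2(3) mem_dlt[OF 2(1,2)] mem_gam[OF 2(1,2)])
    qed
  qed
  show "\<exists>s. {x \<in> cells C. dim C x = -1} = {s} \<and> (\<forall>x\<in>cells C. dim C x = 0 \<longrightarrow> gam C x - dlt C x = {s})"
  \<comment> \<open>In dimension 0 the target is this cell by \<open>fplus_bottom\<close>, and loops
    are excluded by \<open>floop_bottom\<close>.\<close>
  proof (intro exI[of _ "(-1, root (S 1))"] conjI ballI impI)
    show "{x \<in> cells C. dim C x = -1} = {(-1, root (S 1))}" by (auto elim!: cell_cases)
    fix c assume c: "c \<in> cells C" "dim C c = 0"
    then have "c \<in> P_cells Y" by simp
    then obtain x where x: "c = (int 0, x)" "x \<in> edges (S (Suc (Suc 0)))"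
      using c(2) by (auto elim!: cell_cases)
    have "(d, z) \<in> gam C c - dlt C c \<longleftrightarrow> (d, z) = (-1, root (S 1))" for d z
      unfolding x(1) P_obj_fields Diff_iff mem_gam[OF le0 x(2)] mem_dlt[OF le0 x(2)]
      using fplus_bottom[OF x(2)] floop_bottom[OF x(2)] by simp
    then show "gam C c - dlt C c = {(-1, root (S 1))}" by auto
  qed
  show "\<forall>x z. if x \<in> Lam C \<and> z \<in> bd2 C x then strict_total_order_on (loops_at C x z) (lord C x z)
      else lord C x z = {}"
  proof (intro allI)
    fix c b
    show "if c \<in> Lam C \<and> b \<in> bd2 C c then strict_total_order_on (loops_at C c b) (lord C c b)
      else lord C c b = {}"
    proof (cases "c \<in> Lam C \<and> b \<in> bd2 C c")
      case True
      then have "c \<in> P_cells Y" by (auto simp: Lam_def)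
      moreover have "c \<noteq> (-1, root (S 1))" using True by (auto simp: bd2_def bd_def bottom_faces)
      ultimately obtain k x where k: "k \<le> n" "x \<in> edges (S (Suc (Suc k)))" "c = (int k, x)"
        by (auto elim!: cell_cases)
      obtain e z where b: "b = (e, z)" by force
      let ?L = "\<lambda>y. floop (S k) (W k) (S (Suc k)) z y \<and> fminus (S (Suc k)) (S (Suc (Suc k))) y x"
      let ?R = "{(y, y'). y \<noteq> y' \<and> ?L y \<and> ?L y' \<and> before (W k) (S (Suc k)) z y y'}"
      interpret exact2 "S k" "W k" "S (Suc k)" "W (Suc k)" "S (Suc (Suc k))"
        using k(1) by (rule exact2_level)
      have ord: "strict_total_order_on {y. ?L y} ?R" by (rule loop_order)
      show ?thesis
      proof (cases "k > 0 \<and> e = int k - 2")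
        case deg: True
        have lord: "lord C c b = map_prod (Pair (int k - 1)) (Pair (int k - 1)) ` ?R"
          using True deg unfolding k(3) b by (auto simp: mem_lord[OF k(1,2)])
        have loops: "loops_at C c b = Pair (int k - 1) ` {y. ?L y}"
          using deg mem_loops_at[OF k(1,2)] unfolding k(3) b by auto
        have "inj (Pair (int k - 1))" by (simp add: inj_on_def)
        from strict_total_order_image[OF ord this] show ?thesis
          using True unfolding lord loops by simp
      next
        case False
        then have "loops_at C c b = {}" "lord C c b = {}"
          using mem_loops_at[OF k(1,2)] mem_lord[OF k(1,2)] unfolding k(3) b by auto
        then show ?thesis using True by (simp add: strict_total_order_on_def irrefl_def)
      qed
    qed (auto simp: P_obj_def Let_def)
  qed
qed

text \<open>By \<open>edge_is_face\<close> every cell below dimension \<open>n\<close> is a face of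
  a cell of the next dimension, and the only cell of dimension \<open>n\<close> is
  \<open>Top\<close>.\<close>

lemma greatest_P: "has_greatest_cell C"
proof -
  have top: "S (Suc (Suc n)) = unit_tree Top" using dim_Y by (rule ext_tree_top)
  have up: "(prec C)\<^sup>*\<^sup>* (int k, x) (int n, Top)" if "k \<le> n" "x \<in> edges (S (Suc (Suc k)))" for k x
    using that
  proof (induction arbitrary: x rule: inc_induct)
    case base
    then show ?case using top by (simp add: unit_tree_def)
  next
    case (step k)
    interpret exact "S (Suc (Suc k))" "W (Suc (Suc k))" "S (Suc (Suc (Suc k)))"
      using step by (intro exact_level) simp
    obtain x' s where x': "x' \<in> edges (S (Suc (Suc (Suc k))))"
      "fsign (S (Suc (Suc k))) (W (Suc (Suc k))) (S (Suc (Suc (Suc k)))) s x x'"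
      using edge_is_face step.prems by blast
    then have "prec C (int k, x) (int (Suc k), x')"
      using step.hyps prec_sign_iff[of "Suc k" x' x s "int k"] prec_iff_sign by auto
    then show ?case using step.IH[OF x'(1)] by (rule converse_rtranclp_into_rtranclp)
  qed
  interpret exact "S (Suc 0)" "W (Suc 0)" "S (Suc (Suc 0))" by (intro exact_level) simp
  have "prec C (-1, root (S 1)) (int 0, root (S (Suc (Suc 0))))"
    using prec_sign_iff[of 0 "root (S (Suc (Suc 0)))" "root (S 1)" 1 "-1"] U.root_edge
      fplus_bottom[OF U.root_edge] prec_iff_sign by (auto simp: fsign_def)
  then have bottom: "(prec C)\<^sup>*\<^sup>* (-1, root (S 1)) (int n, Top)"
    using up[OF le0 U.root_edge] by (rule converse_rtranclp_into_rtranclp)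
  have Top: "(int n, Top) \<in> P_cells Y" using top by (simp add: unit_tree_def)
  have all: "(prec C)\<^sup>*\<^sup>* y (int n, Top)" if "y \<in> P_cells Y" for y
    using that up bottom by (elim cell_cases) auto
  then show ?thesis unfolding has_greatest_cell_def using Top by (intro bexI[of _ "(int n, Top)"]) auto
qed

lemma prec_plus_sign: "prec_plus C c c' \<longleftrightarrow> prec_sign C 1 c c'"
  and prec_minus_sign: "prec_minus C c c' \<longleftrightarrow> prec_sign C (-1) c c'"
  and prec_loop_sign: "prec_loop C c c' \<longleftrightarrow> prec_sign C 0 c c'"
  by (auto simp: prec_sign_def)

lemma loops_P: "loops_axiom C"
  unfolding loops_axiom_def
proof (intro allI impI)
  fix z y assume "prec_loop C z y"
  then obtain k y' z' where k: "k \<le> n" "y' \<in> edges (S (Suc (Suc k)))" "y = (int k, y')"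
    and loop: "floop (S (Suc k)) (W (Suc k)) (S (Suc (Suc k))) z' y'"
    unfolding prec_loop_sign by (auto elim!: prec_signE simp: fsign_def)
  \<comment> \<open>The only cell of dimension \<open>n\<close> is the leaf of a unit tree, so it
    has a black dot and is not a loop. This leaves room for the next constellation.\<close>
  have "k \<noteq> n"
  proof
    assume "k = n"
    then have "S (Suc (Suc k)) = unit_tree Top" using ext_tree_top[OF dim_Y] by simp
    then show False using loop k(2)
      by (auto simp: floop_def blk_def leaves_unit desc_def) (auto simp: unit_tree_def)
  qed
  then have kn: "Suc k \<le> n" using k by simp
  interpret exact2 "S (Suc k)" "W (Suc k)" "S (Suc (Suc k))" "W (Suc (Suc k))" "S (Suc (Suc (Suc k)))"
    using kn by (rule exact2_level)
  obtain x where "x \<in> edges (S (Suc (Suc (Suc k))))" "fplus (S (Suc (Suc k))) (S (Suc (Suc (Suc k)))) y' x"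
    using loop_is_target[OF loop k(2)] by blast
  then have "prec_plus C y (int (Suc k), x)" using prec_plus_iff[OF kn, of x "int k" y'] k(3) by simp
  then show "\<exists>x. prec_plus C y x" by blast
qed

text \<open>Moves both thinness clauses to two consecutive constellations. The last clause transfers
  all intermediate cells \<open>u\<close>, not just \<open>y\<close>, because existence and
  uniqueness of the other cell are needed.\<close>

lemma between:
  assumes "prec_sign C \<beta> z y" "prec_sign C \<alpha> y x"
  obtains k x' y' z' where "Suc k \<le> n" "x = (int (Suc k), x')" "y = (int k, y')" "z = (int k - 1, z')"
    "fsign (S (Suc k)) (W (Suc k)) (S (Suc (Suc k))) \<beta> z' y'"
    "fsign (S (Suc (Suc k))) (W (Suc (Suc k))) (S (Suc (Suc (Suc k)))) \<alpha> y' x'"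
    "\<And>\<alpha>' \<beta>' u. prec_sign C \<beta>' z u \<and> prec_sign C \<alpha>' u x \<longleftrightarrow> (\<exists>u'. u = (int k, u') \<and>
      fsign (S (Suc k)) (W (Suc k)) (S (Suc (Suc k))) \<beta>' z' u' \<and>
      fsign (S (Suc (Suc k))) (W (Suc (Suc k))) (S (Suc (Suc (Suc k)))) \<alpha>' u' x')"
proof -
  from assms(1) obtain k y' z' where y: "k \<le> n" "y' \<in> edges (S (Suc (Suc k)))" "y = (int k, y')" "z = (int k - 1, z')"
    "fsign (S (Suc k)) (W (Suc k)) (S (Suc (Suc k))) \<beta> z' y'" "k = 0 \<Longrightarrow> z' = root (S 1)"
    by (elim prec_signE) blast
  from assms(2) obtain k' x' y'' where x: "k' \<le> n" "x' \<in> edges (S (Suc (Suc k')))" "x = (int k', x')"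
    "y = (int k' - 1, y'')" "fsign (S (Suc k')) (W (Suc k')) (S (Suc (Suc k'))) \<alpha> y'' x'"
    by (elim prec_signE) blast
  have k': "k' = Suc k" "y'' = y'" using x(4) y(3) by auto
  have kn: "Suc k \<le> n" using x(1) k' by simp
  note x' = x(2)[unfolded k']
  have iff: "prec_sign C \<beta>' z u \<and> prec_sign C \<alpha>' u x \<longleftrightarrow> (\<exists>u'. u = (int k, u') \<and>
      fsign (S (Suc k)) (W (Suc k)) (S (Suc (Suc k))) \<beta>' z' u' \<and>
      fsign (S (Suc (Suc k))) (W (Suc (Suc k))) (S (Suc (Suc (Suc k)))) \<alpha>' u' x')" for \<alpha>' \<beta>' u
  proof -
    obtain d u' where u: "u = (d, u')" by force
    have "prec_sign C \<alpha>' u x \<longleftrightarrow> d = int k \<and>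
      fsign (S (Suc (Suc k))) (W (Suc (Suc k))) (S (Suc (Suc (Suc k)))) \<alpha>' u' x'"
      using prec_sign_iff[OF kn x', of u' \<alpha>' d] x(3) k' u by auto
    moreover have "prec_sign C \<beta>' z (int k, u') \<longleftrightarrow> fsign (S (Suc k)) (W (Suc k)) (S (Suc (Suc k))) \<beta>' z' u'"
      if "fsign (S (Suc (Suc k))) (W (Suc (Suc k))) (S (Suc (Suc (Suc k)))) \<alpha>' u' x'"
      using prec_sign_iff[OF y(1) fsign_edges[OF kn that] y(6)] y(4) by simp
    ultimately show ?thesis using u by auto
  qed
  show thesis using that[OF kn] iff x(3,5) y(3,4,5) k' by blast
qed

lemma thinness_P: "oriented_thinness C"
  unfolding oriented_thinness_def
proof (intro conjI allI impI)
  fix x y z \<alpha> \<beta>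
  assume a: "prec_sign C \<beta> z y \<and> prec_sign C \<alpha> y x \<and> \<alpha> \<noteq> 0 \<and> \<beta> \<noteq> 0"
  then have a': "prec_sign C \<beta> z y" "prec_sign C \<alpha> y x" by auto
  obtain k x' y' z' where k: "Suc k \<le> n" and "x = (int (Suc k), x')" and y: "y = (int k, y')"
    and "z = (int k - 1, z')"
    and f: "fsign (S (Suc k)) (W (Suc k)) (S (Suc (Suc k))) \<beta> z' y'"
      "fsign (S (Suc (Suc k))) (W (Suc (Suc k))) (S (Suc (Suc (Suc k)))) \<alpha> y' x'"
    and iff: "\<And>\<alpha>' \<beta>' u. prec_sign C \<beta>' z u \<and> prec_sign C \<alpha>' u x \<longleftrightarrow> (\<exists>u'. u = (int k, u') \<and>
      fsign (S (Suc k)) (W (Suc k)) (S (Suc (Suc k))) \<beta>' z' u' \<and>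
      fsign (S (Suc (Suc k))) (W (Suc (Suc k))) (S (Suc (Suc (Suc k)))) \<alpha>' u' x')"
    by (rule between[OF a']) (rule that)
  interpret exact2 "S (Suc k)" "W (Suc k)" "S (Suc (Suc k))" "W (Suc (Suc k))" "S (Suc (Suc (Suc k)))"
    using k by (rule exact2_level)
  let ?Q = "\<lambda>u'. \<exists>\<alpha>' \<beta>'. fsign (S (Suc k)) (W (Suc k)) (S (Suc (Suc k))) \<beta>' z' u' \<and>
      fsign (S (Suc (Suc k))) (W (Suc (Suc k))) (S (Suc (Suc (Suc k)))) \<alpha>' u' x' \<and> \<alpha> * \<beta> = - (\<alpha>' * \<beta>')"
  have "\<exists>!u'. u' \<noteq> y' \<and> ?Q u'" using oriented_thinness[OF f] a by simp
  then obtain u where u: "u \<noteq> y'" "?Q u" "\<And>v. v \<noteq> y' \<Longrightarrow> ?Q v \<Longrightarrow> v = u" by blast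
  have eq: "(\<exists>\<alpha>' \<beta>'. prec_sign C \<beta>' z v \<and> prec_sign C \<alpha>' v x \<and> \<alpha> * \<beta> = - (\<alpha>' * \<beta>')) \<longleftrightarrow>
      (\<exists>v'. v = (int k, v') \<and> ?Q v')" for v
  proof -
    have "(prec_sign C \<beta>' z v \<and> prec_sign C \<alpha>' v x \<and> \<alpha> * \<beta> = - (\<alpha>' * \<beta>')) \<longleftrightarrow> (\<exists>v'. v = (int k, v') \<and>
      fsign (S (Suc k)) (W (Suc k)) (S (Suc (Suc k))) \<beta>' z' v' \<and>
      fsign (S (Suc (Suc k))) (W (Suc (Suc k))) (S (Suc (Suc (Suc k)))) \<alpha>' v' x' \<and> \<alpha> * \<beta> = - (\<alpha>' * \<beta>'))" for \<alpha>' \<beta>'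
      using iff[of \<beta>' v \<alpha>'] by blast
    then show ?thesis by blast
  qed
  show "\<exists>!v. v \<noteq> y \<and> (\<exists>\<alpha>' \<beta>'. prec_sign C \<beta>' z v \<and> prec_sign C \<alpha>' v x \<and> \<alpha> * \<beta> = - (\<alpha>' * \<beta>'))"
    unfolding eq y
  proof (rule ex1I)
    show "(int k, u) \<noteq> (int k, y') \<and> (\<exists>v'. (int k, u) = (int k, v') \<and> ?Q v')" using u(1,2) by simp
    fix v assume "v \<noteq> (int k, y') \<and> (\<exists>v'. v = (int k, v') \<and> ?Q v')"
    then obtain v' where v: "v = (int k, v')" "?Q v'" "v' \<noteq> y'" by auto
    show "v = (int k, u)" using u(3)[OF v(3,2)] v(1) by simp
  qed
next
  fix x y z
  assume "prec_loop C z y \<and> prec_minus C y x"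
  then have a: "prec_sign C 0 z y" "prec_sign C (-1) y x" by (simp_all add: prec_loop_sign prec_minus_sign)
  obtain k x' y' z' where k: "Suc k \<le> n" and "x = (int (Suc k), x')" and y: "y = (int k, y')"
    and "z = (int k - 1, z')"
    and f: "fsign (S (Suc k)) (W (Suc k)) (S (Suc (Suc k))) 0 z' y'"
      "fsign (S (Suc (Suc k))) (W (Suc (Suc k))) (S (Suc (Suc (Suc k)))) (-1) y' x'"
    and iff: "\<And>\<alpha>' \<beta>' u. prec_sign C \<beta>' z u \<and> prec_sign C \<alpha>' u x \<longleftrightarrow> (\<exists>u'. u = (int k, u') \<and>
      fsign (S (Suc k)) (W (Suc k)) (S (Suc (Suc k))) \<beta>' z' u' \<and>
      fsign (S (Suc (Suc k))) (W (Suc (Suc k))) (S (Suc (Suc (Suc k)))) \<alpha>' u' x')"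
    by (rule between[OF a]) (rule that)
  interpret exact2 "S (Suc k)" "W (Suc k)" "S (Suc (Suc k))" "W (Suc (Suc k))" "S (Suc (Suc (Suc k)))"
    using k by (rule exact2_level)
  have "floop (S (Suc k)) (W (Suc k)) (S (Suc (Suc k))) z' y'"
    "fminus (S (Suc (Suc k))) (S (Suc (Suc (Suc k)))) y' x'" using f by (auto simp: fsign_def)
  from loop_thinness[OF this] obtain u \<alpha> \<beta> where u: "u \<noteq> y'"
    "fsign (S (Suc k)) (W (Suc k)) (S (Suc (Suc k))) \<beta> z' u"
    "fsign (S (Suc (Suc k))) (W (Suc (Suc k))) (S (Suc (Suc (Suc k)))) \<alpha> u x'" "(\<alpha>, \<beta>) \<noteq> (-1, 0)"
    by blast
  then have "prec_sign C \<beta> z (int k, u) \<and> prec_sign C \<alpha> (int k, u) x" using iff by blast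
  then show "\<exists>y' \<alpha> \<beta>. y' \<noteq> y \<and> prec_sign C \<beta> z y' \<and> prec_sign C \<alpha> y' x \<and> (\<alpha>, \<beta>) \<noteq> (- 1, 0)"
    using u y by blast
qed

lemma acyclicity_P: "acyclicity C"
  unfolding acyclicity_def
proof (intro ballI impI notI)
  fix x assume x: "x \<in> cells C" "dim C x \<ge> 1"
  assume "\<exists>p\<ge>1. \<exists>y. \<forall>i<p. prec_minus C (y i) x \<and>
      prec_plus C (the_elem (gam C (y (Suc i mod p)))) (y (Suc i mod p)) \<and>
      prec_minus C (the_elem (gam C (y (Suc i mod p)))) (y i)"
  then obtain p y where p: "p \<ge> 1" and y: "\<And>i. i < p \<Longrightarrow> prec_minus C (y i) x"
    and plus: "\<And>i. i < p \<Longrightarrow> prec_plus C (the_elem (gam C (y (Suc i mod p)))) (y (Suc i mod p))"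
    and minus: "\<And>i. i < p \<Longrightarrow> prec_minus C (the_elem (gam C (y (Suc i mod p)))) (y i)"
    by blast
  have "x \<in> P_cells Y" using x(1) by simp
  then obtain k' x' where "k' \<le> n" "x' \<in> edges (S (Suc (Suc k')))" "x = (int k', x')" "k' \<ge> 1"
    using x(2) by (auto elim!: cell_cases)
  then obtain k where x': "Suc k \<le> n" "x' \<in> edges (S (Suc (Suc (Suc k))))" "x = (int (Suc k), x')"
    by (cases k') auto
  interpret exact2 "S (Suc k)" "W (Suc k)" "S (Suc (Suc k))" "W (Suc (Suc k))" "S (Suc (Suc (Suc k)))"
    using x'(1) by (rule exact2_level)
  \<comment> \<open>\<open>v\<close> and \<open>z\<close> strip the dimensions. The value of
    \<open>the_elem\<close> is never computed: its signs in the neighbouring cells are all that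
    \<open>no_cycle\<close> uses.\<close>
  define v where "v i = snd (y i)" for i
  define z where "z i = snd (the_elem (gam C (y i)))" for i
  have v: "y i = (int k, v i)" "v i \<in> edges (S (Suc (Suc k)))" if i: "i < p" for i
  proof -
    obtain d u where "y i = (d, u)" by force
    then show "y i = (int k, v i)" "v i \<in> edges (S (Suc (Suc k)))"
      using y[OF i] prec_minus_iff[OF x'(1,2), of d u] upper.fminus_edges[of u x'] x'(3) by (auto simp: v_def)
  qed
  have mod: "Suc i mod p < p" for i using p by simp
  have kn: "k \<le> n" using x'(1) by simp
  show False
  proof (rule no_cycle[OF p])
    fix i assume i: "i < p"
    obtain d e where "the_elem (gam C (y (Suc i mod p))) = (d, e)" by force
    then have d: "the_elem (gam C (y (Suc i mod p))) = (d, z (Suc i mod p))" by (simp add: z_def)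
    show "fplus (S (Suc k)) (S (Suc (Suc k))) (z (Suc i mod p)) (v (Suc i mod p))"
      using plus[OF i, unfolded d, unfolded v(1)[OF mod]]
      by (simp only: prec_plus_iff[OF kn v(2)[OF mod]])
    show "fminus (S (Suc k)) (S (Suc (Suc k))) (z (Suc i mod p)) (v i)"
      using minus[OF i, unfolded d, unfolded v(1)[OF i]]
      by (simp only: prec_minus_iff[OF kn v(2)[OF i]])
  qed
qed

lemma is_dfc_P: "is_dfc C"
  by (simp add: is_dfc_def is_mop_P greatest_P loops_P thinness_P acyclicity_P)

end

section \<open>The categories\<close>

lemma is_category_full_subcat: "is_category C \<Longrightarrow> is_category (full_subcat C A)"
  by (simp add: is_category_def full_subcat_def)

lemma is_category_core:
  assumes C: "is_category C"
  shows "is_category (core C)"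
proof -
  have ident: "ident C X \<in> hom C X X" if "X \<in> obj C" for X
    using C that by (simp add: is_category_def)
  have cmp: "cmp C X Y Z g f \<in> hom C X Z"
    if "X \<in> obj C" "Y \<in> obj C" "Z \<in> obj C" "f \<in> hom C X Y" "g \<in> hom C Y Z" for X Y Z f g
    using C that by (simp add: is_category_def)
  have unit: "cmp C X Y Y (ident C Y) f = f" "cmp C X X Y f (ident C X) = f"
    if "X \<in> obj C" "Y \<in> obj C" "f \<in> hom C X Y" for X Y f
    using C that by (simp_all add: is_category_def)
  have assoc: "cmp C X Z V h (cmp C X Y Z g f) = cmp C X Y V (cmp C Y Z V h g) f"
    if "X \<in> obj C" "Y \<in> obj C" "Z \<in> obj C" "V \<in> obj C"
      "f \<in> hom C X Y" "g \<in> hom C Y Z" "h \<in> hom C Z V" for X Y Z V f g h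
    using C that unfolding is_category_def by blast
  have "\<exists>k\<in>hom C Z X. cmp C X Z X k (cmp C X Y Z g f) = ident C X \<and> cmp C Z X Z (cmp C X Y Z g f) k = ident C Z"
    if X: "X \<in> obj C" and Y: "Y \<in> obj C" and Z: "Z \<in> obj C" and f: "f \<in> hom C X Y" and g: "g \<in> hom C Y Z"
      and f': "f' \<in> hom C Y X" "cmp C X Y X f' f = ident C X" "cmp C Y X Y f f' = ident C Y"
      and g': "g' \<in> hom C Z Y" "cmp C Y Z Y g' g = ident C Y" "cmp C Z Y Z g g' = ident C Z"
    for X Y Z f g f' g'
  proof (intro bexI[of _ "cmp C Z Y X f' g'"] conjI)
    have "cmp C X Z X (cmp C Z Y X f' g') (cmp C X Y Z g f) = cmp C X Y X (cmp C Y Z X (cmp C Z Y X f' g') g) f"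
      by (rule assoc) (use assms X Y Z f g f' g' cmp in auto)
    also have "cmp C Y Z X (cmp C Z Y X f' g') g = f'"
      using assoc[OF Y Z Y X g g'(1) f'(1)] g'(2) unit(2)[OF Y X f'(1)] by simp
    finally show "cmp C X Z X (cmp C Z Y X f' g') (cmp C X Y Z g f) = ident C X" using f'(2) by simp
    have "cmp C Z X Z (cmp C X Y Z g f) (cmp C Z Y X f' g') = cmp C Z Y Z (cmp C Y X Z (cmp C X Y Z g f) f') g'"
      by (rule assoc) (use assms X Y Z f g f' g' cmp in auto)
    also have "cmp C Y X Z (cmp C X Y Z g f) f' = g"
      using assoc[OF Y X Y Z f'(1) f g] f'(3) unit(2)[OF Y Z g] by simp
    finally show "cmp C Z X Z (cmp C X Y Z g f) (cmp C Z Y X f' g') = ident C Z" using g'(3) by simp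
    show "cmp C Z Y X f' g' \<in> hom C Z X" using X Y Z f'(1) g'(1) cmp by simp
  qed
  then have comp: "cmp C X Y Z g f \<in> hom (core C) X Z"
    if "X \<in> obj C" "Y \<in> obj C" "Z \<in> obj C" "f \<in> hom (core C) X Y" "g \<in> hom (core C) Y Z" for X Y Z f g
    using that cmp unfolding core_def by (simp add: Bex_def) metis
  show ?thesis
    unfolding is_category_def
  proof (intro conjI ballI)
    fix X assume "X \<in> obj (core C)"
    then show "ident (core C) X \<in> hom (core C) X X"
      using ident unit[of X X "ident C X"] by (auto simp: core_def)
  next
    fix X Y Z f g
    assume "X \<in> obj (core C)" "Y \<in> obj (core C)" "Z \<in> obj (core C)" "f \<in> hom (core C) X Y" "g \<in> hom (core C) Y Z"
    then show "cmp (core C) X Y Z g f \<in> hom (core C) X Z" using comp[of X Y Z f g] by (simp add: core_def)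
  qed (auto simp: core_def unit intro: assoc)
qed

section \<open>The category of many-to-one posets\<close>

lemma mop_faces:
  assumes "is_mop C"
  shows "dlt C x \<subseteq> cells C" "gam C x \<subseteq> cells C" "bd C x \<subseteq> cells C"
proof -
  have "dlt C x = {} \<and> gam C x = {} \<or> bd C x \<subseteq> cells C"
  proof (cases "x \<in> cells C \<and> dim C x \<noteq> -1")
    case True
    then have "dim C x \<ge> 0" using assms by (force simp: is_mop_def)
    then have "bd C x \<subseteq> {y \<in> cells C. dim C y = dim C x - 1}" using assms True by (simp add: is_mop_def)
    then show ?thesis by auto
  next
    case False
    then show ?thesis using assms by (auto simp: is_mop_def)
  qed
  then show "dlt C x \<subseteq> cells C" "gam C x \<subseteq> cells C" "bd C x \<subseteq> cells C" by (auto simp: bd_def)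
qed

text \<open>Local orders are empty outside their domain, so a single pair in one certifies that
  \<open>x\<close> and \<open>z\<close> are in the domain.\<close>

lemma mop_lord:
  assumes "is_mop C" "(y, y') \<in> lord C x z"
  shows "x \<in> Lam C" "z \<in> bd2 C x" "x \<in> cells C" "y \<in> cells C" "y' \<in> cells C" "z \<in> cells C"
proof -
  have "if x \<in> Lam C \<and> z \<in> bd2 C x then strict_total_order_on (loops_at C x z) (lord C x z)
    else lord C x z = {}"
    using assms(1) unfolding is_mop_def by blast
  then have x: "x \<in> Lam C" "z \<in> bd2 C x" and "strict_total_order_on (loops_at C x z) (lord C x z)"
    using assms(2) by (auto split: if_splits)
  then have "y \<in> loops_at C x z" "y' \<in> loops_at C x z"
    using assms(2) by (auto simp: strict_total_order_on_def)
  then show "x \<in> Lam C" "z \<in> bd2 C x" "x \<in> cells C" "y \<in> cells C" "y' \<in> cells C" "z \<in> cells C"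
    using x mop_faces[OF assms(1)] by (auto simp: loops_at_def prec_loop_def prec_minus_def Lam_def bd2_def)
qed

lemma mop_morphism_id:
  assumes "is_mop C"
  shows "mop_morphism C C (restrict id (cells C))"
proof -
  note f = mop_faces[OF assms]
  have "bij_betw (restrict id (cells C)) (dlt C x) (dlt C x)" for x
    using f(1)[of x] by (intro bij_betwI[of _ _ _ "restrict id (cells C)"]) auto
  moreover have "restrict id (cells C) ` gam C x = gam C x" for x
    using f(2)[of x] by force
  ultimately show ?thesis using mop_lord[OF assms] by (auto simp: mop_morphism_def)
qed

lemma mop_morphism_comp:
  assumes C: "is_mop C" and D: "is_mop D" and f: "mop_morphism C D f" and g: "mop_morphism D E g"
  shows "mop_morphism C E (compose (cells C) g f)"
proof -
  have fc: "f x \<in> cells D" if "x \<in> cells C" for x using f that by (auto simp: mop_morphism_def)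
  have gc: "g x \<in> cells E" if "x \<in> cells D" for x using g that by (auto simp: mop_morphism_def)
  have on: "compose (cells C) g f ` A = g ` f ` A" if "A \<subseteq> cells C" for A
    using that by (auto simp: compose_def image_image subset_iff intro!: image_cong)
  have bij: "bij_betw (compose (cells C) g f) (dlt C x) (dlt E (compose (cells C) g f x))"
    "compose (cells C) g f ` gam C x = gam E (compose (cells C) g f x)"
    if x: "x \<in> cells C" "dim C x \<ge> 0" for x
  proof -
    have dim: "dim D (f x) \<ge> 0" using f x by (simp add: mop_morphism_def)
    have "bij_betw f (dlt C x) (dlt D (f x))" "bij_betw g (dlt D (f x)) (dlt E (g (f x)))"
      using f g x fc dim by (simp_all add: mop_morphism_def)
    then have "bij_betw (g \<circ> f) (dlt C x) (dlt E (g (f x)))" by (rule bij_betw_trans)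
    moreover have "bij_betw (compose (cells C) g f) (dlt C x) (dlt E (g (f x))) \<longleftrightarrow>
        bij_betw (g \<circ> f) (dlt C x) (dlt E (g (f x)))"
      using mop_faces(1)[OF C, of x] by (intro bij_betw_cong) (auto simp: compose_def)
    ultimately show "bij_betw (compose (cells C) g f) (dlt C x) (dlt E (compose (cells C) g f x))"
      using x by (simp add: compose_def)
    show "compose (cells C) g f ` gam C x = gam E (compose (cells C) g f x)"
      using f g x fc dim on[OF mop_faces(2)[OF C]] by (simp add: mop_morphism_def compose_def)
  qed
  have lord: "(compose (cells C) g f y, compose (cells C) g f y') \<in>
      lord E (compose (cells C) g f x) (compose (cells C) g f z)"
    if "x \<in> Lam C" "z \<in> bd2 C x" "(y, y') \<in> lord C x z" for x y y' z
  proof -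
    have "(f y, f y') \<in> lord D (f x) (f z)" using f that by (auto simp: mop_morphism_def)
    \<comment> \<open>That a morphism maps the domain of the local orders into the domain is not
      part of its definition; the preserved pair itself forces it here.\<close>
    moreover from mop_lord[OF D this] have "f x \<in> Lam D" "f z \<in> bd2 D (f x)" by auto
    ultimately have "(g (f y), g (f y')) \<in> lord E (g (f x)) (g (f z))"
      using g by (auto simp: mop_morphism_def)
    then show ?thesis using mop_lord[OF C that(3)] by (simp add: compose_def)
  qed
  have "dim E (compose (cells C) g f x) = dim C x" if "x \<in> cells C" for x
    using f g fc that by (simp add: mop_morphism_def compose_def)
  then show ?thesis using bij lord fc gc unfolding mop_morphism_def by (auto simp: compose_def)
qed

lemma is_category_MOP: "is_category MOP"
  unfolding is_category_def
proof (intro conjI ballI)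
  fix X :: "'a mop" assume "X \<in> obj MOP"
  then show "ident MOP X \<in> hom MOP X X" by (simp add: MOP_def mop_morphism_id)
next
  fix X Y Z :: "'a mop" and f g
  assume "X \<in> obj MOP" "Y \<in> obj MOP" "Z \<in> obj MOP" "f \<in> hom MOP X Y" "g \<in> hom MOP Y Z"
  then show "cmp MOP X Y Z g f \<in> hom MOP X Z" by (simp add: MOP_def mop_morphism_comp)
next
  fix X Y :: "'a mop" and f assume "X \<in> obj MOP" "Y \<in> obj MOP" "f \<in> hom MOP X Y"
  then have f: "f \<in> cells X \<rightarrow>\<^sub>E cells Y" by (simp add: MOP_def mop_morphism_def)
  show "cmp MOP X Y Y (ident MOP Y) f = f" "cmp MOP X X Y f (ident MOP X) = f"
    using f by (auto simp: MOP_def compose_def fun_eq_iff PiE_iff extensional_def)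
next
  fix X Y Z V :: "'a mop" and f g h
  assume "f \<in> hom MOP X Y"
  then have "f \<in> cells X \<rightarrow> cells Y" by (auto simp: MOP_def mop_morphism_def)
  then show "cmp MOP X Z V h (cmp MOP X Y Z g f) = cmp MOP X Y V (cmp MOP Y Z V h g) f"
    using compose_assoc[of f "cells X" "cells Y" h g] by (simp add: MOP_def)
qed

lemma is_category_DFC_core: "is_category DFC_core"
  by (simp add: DFC_core_def DFC_def is_category_core is_category_full_subcat is_category_MOP)

section \<open>The category of opetopes\<close>

lemma map_prod_restrict_id: "R \<subseteq> A \<times> B \<Longrightarrow> map_prod (restrict id A) (restrict id B) ` R = R"
proof -
  assume "R \<subseteq> A \<times> B"
  then have "map_prod (restrict id A) (restrict id B) ` R = id ` R" by (intro image_cong) auto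
  then show ?thesis by simp
qed

lemma bij_betw_compose: "bij_betw h A B \<Longrightarrow> bij_betw k B D \<Longrightarrow> bij_betw (compose A k h) A D"
  using bij_betw_trans[of h A B k D] bij_betw_cong[of A "compose A k h" "k \<circ> h" D]
  by (simp add: compose_def)

lemma map_prod_compose_image:
  "R \<subseteq> A \<times> B \<Longrightarrow> map_prod (compose A k h) (compose B k' h') ` R = map_prod k k' ` map_prod h h' ` R"
  unfolding image_image by (intro image_cong) (auto simp: compose_def)

lemma subdivided_tree_iso_id:
  assumes "tgt_edge T \<subseteq> nodes T \<times> edges T" "tgt_node T \<subseteq> edges T \<times> nodes T" "root T \<in> edges T"
  shows "subdivided_tree_iso T W T W \<lparr>on_nodes = restrict id (nodes T), on_edges = restrict id (edges T),
    on_white = restrict id (whitedots T W)\<rparr>"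
proof -
  have "map (restrict id (whitedots T W)) (W b) = W b" if "b \<in> edges T" for b
    using that by (intro map_idI) (auto simp: whitedots_def)
  then show ?thesis using assms
    by (simp add: subdivided_tree_iso_def map_prod_restrict_id)
qed

lemma subdivided_tree_iso_comp:
  assumes te: "tgt_edge T \<subseteq> nodes T \<times> edges T" and tn: "tgt_node T \<subseteq> edges T \<times> nodes T" and rt: "root T \<in> edges T"
    and f: "subdivided_tree_iso T W T' W' f" and g: "subdivided_tree_iso T' W' T'' W'' g"
  shows "subdivided_tree_iso T W T'' W'' \<lparr>on_nodes = compose (nodes T) (on_nodes g) (on_nodes f),
    on_edges = compose (edges T) (on_edges g) (on_edges f),
    on_white = compose (whitedots T W) (on_white g) (on_white f)\<rparr>"
proof -
  have edge: "on_edges f b \<in> edges T'" if "b \<in> edges T" for b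
    using f that by (auto simp: subdivided_tree_iso_def bij_betw_def)
  have "W'' (compose (edges T) (on_edges g) (on_edges f) b) =
      map (compose (whitedots T W) (on_white g) (on_white f)) (W b)" if b: "b \<in> edges T" for b
  proof -
    have "W'' (on_edges g (on_edges f b)) = map (on_white g) (map (on_white f) (W b))"
      using f g b edge by (simp add: subdivided_tree_iso_def)
    also have "\<dots> = map (compose (whitedots T W) (on_white g) (on_white f)) (W b)"
      using b by (auto simp: compose_def whitedots_def)
    finally show ?thesis using b by (simp add: compose_def)
  qed
  moreover have "bij_betw (compose (nodes T) (on_nodes g) (on_nodes f)) (nodes T) (nodes T'')"
    "bij_betw (compose (edges T) (on_edges g) (on_edges f)) (edges T) (edges T'')"
    "bij_betw (compose (whitedots T W) (on_white g) (on_white f)) (whitedots T W) (whitedots T'' W'')"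
    using f g by (auto simp: subdivided_tree_iso_def intro!: bij_betw_compose)
  moreover have "tgt_edge T'' = map_prod (compose (nodes T) (on_nodes g) (on_nodes f))
      (compose (edges T) (on_edges g) (on_edges f)) ` tgt_edge T"
    "tgt_node T'' = map_prod (compose (edges T) (on_edges g) (on_edges f))
      (compose (nodes T) (on_nodes g) (on_nodes f)) ` tgt_node T"
    unfolding map_prod_compose_image[OF te] map_prod_compose_image[OF tn] using f g by (simp_all add: subdivided_tree_iso_def)
  moreover have "root T'' = compose (edges T) (on_edges g) (on_edges f) (root T)"
    using f g rt by (simp add: subdivided_tree_iso_def compose_def)
  ultimately show ?thesis by (simp add: subdivided_tree_iso_def compose_extensional)
qed

lemma opetope_tree:
  assumes Y: "n_opetope n Y" and "k \<le> op_dim Y"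
  shows "tgt_edge (trees Y ! k) \<subseteq> nodes (trees Y ! k) \<times> edges (trees Y ! k)"
    "tgt_node (trees Y ! k) \<subseteq> edges (trees Y ! k) \<times> nodes (trees Y ! k)"
    "root (trees Y ! k) \<in> edges (trees Y ! k)"
  using opetope_rooted[OF Y, of k] assms(2) op_dim_eq[OF Y] by (auto simp: rooted_tree_def)

text \<open>\<open>compose\<close> is meaningful only on its domain, so the compatibility conditions
  require dots of one tree to lie in the domains of the next.\<close>

lemma white_nodes:
  assumes Y: "n_opetope n Y" and "k < op_dim Y"
  shows "whitedots (trees Y ! k) (subs Y ! k) \<subseteq> nodes (trees Y ! Suc k)"
    "nodes (trees Y ! k) \<subseteq> edges (trees Y ! Suc k)"
proof -
  interpret exact "trees Y ! k" "subs Y ! k" "trees Y ! Suc k"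
    using assms op_dim_eq[OF Y] by unfold_locales (simp add: n_opetope_def)
  show "whitedots (trees Y ! k) (subs Y ! k) \<subseteq> nodes (trees Y ! Suc k)"
    "nodes (trees Y ! k) \<subseteq> edges (trees Y ! Suc k)"
    by (auto simp: white_eq_null nodes_eq_leaves null_dots_def leaves_def)
qed

lemma opetope_id_nth: "k \<le> op_dim Y \<Longrightarrow> opetope_id Y ! k =
     \<lparr>on_nodes = restrict id (nodes (trees Y ! k)),
      on_edges = restrict id (edges (trees Y ! k)),
      on_white = restrict id (whitedots (trees Y ! k) (sub_at Y k))\<rparr>"
  by (simp add: opetope_id_def nth_append del: upt_Suc)

lemma opetope_comp_nth: "k \<le> op_dim Y \<Longrightarrow> opetope_comp Y g f ! k =
     \<lparr>on_nodes = compose (nodes (trees Y ! k)) (on_nodes (g ! k)) (on_nodes (f ! k)),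
      on_edges = compose (edges (trees Y ! k)) (on_edges (g ! k)) (on_edges (f ! k)),
      on_white = compose (whitedots (trees Y ! k) (sub_at Y k))
                   (on_white (g ! k)) (on_white (f ! k))\<rparr>"
  by (simp add: opetope_comp_def nth_append del: upt_Suc)

lemma opetope_iso_id:
  assumes Y: "n_opetope n Y"
  shows "opetope_iso Y Y (opetope_id Y)"
proof -
  have "length (opetope_id Y) = Suc (op_dim Y)" by (simp add: opetope_id_def)
  then show ?thesis
    using opetope_tree[OF Y] white_nodes[OF Y]
    by (auto simp: opetope_iso_def opetope_id_nth subdivided_tree_iso_id sub_at_def subset_iff)
qed

lemma opetope_iso_maps:
  assumes "opetope_iso Y Y' f" "k \<le> op_dim Y"
  shows "on_nodes (f ! k) \<in> extensional (nodes (trees Y ! k))"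
    "on_nodes (f ! k) ` nodes (trees Y ! k) = nodes (trees Y' ! k)"
    "on_edges (f ! k) \<in> extensional (edges (trees Y ! k))"
    "on_edges (f ! k) ` edges (trees Y ! k) = edges (trees Y' ! k)"
    "on_white (f ! k) \<in> extensional (whitedots (trees Y ! k) (sub_at Y k))"
    "on_white (f ! k) ` whitedots (trees Y ! k) (sub_at Y k) = whitedots (trees Y' ! k) (sub_at Y' k)"
  using assms by (auto simp: opetope_iso_def subdivided_tree_iso_def bij_betw_def)

lemma opetope_iso_comp:
  assumes Y: "n_opetope n Y" and f: "opetope_iso Y Y' f" and g: "opetope_iso Y' Y'' g"
  shows "opetope_iso Y Y'' (opetope_comp Y g f)"
proof -
  have dim: "op_dim Y' = op_dim Y" "op_dim Y'' = op_dim Y"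
    using f g by (simp_all add: opetope_iso_def)
  have "length (opetope_comp Y g f) = Suc (op_dim Y)" by (simp add: opetope_comp_def)
  moreover have "subdivided_tree_iso (trees Y ! k) (sub_at Y k) (trees Y'' ! k) (sub_at Y'' k) (opetope_comp Y g f ! k)"
    if k: "k \<le> op_dim Y" for k
    unfolding opetope_comp_nth[OF k]
  proof (rule subdivided_tree_iso_comp)
    show "subdivided_tree_iso (trees Y ! k) (sub_at Y k) (trees Y' ! k) (sub_at Y' k) (f ! k)"
      using f k by (simp add: opetope_iso_def)
    show "subdivided_tree_iso (trees Y' ! k) (sub_at Y' k) (trees Y'' ! k) (sub_at Y'' k) (g ! k)"
      using g k dim by (simp add: opetope_iso_def)
  qed (use opetope_tree[OF Y k] in auto)
  moreover have "on_edges (opetope_comp Y g f ! Suc k) a = on_nodes (opetope_comp Y g f ! k) a"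
    if k: "k < op_dim Y" and a: "a \<in> nodes (trees Y ! k)" for k a
  proof -
    have "on_nodes (f ! k) a \<in> nodes (trees Y' ! k)"
      using opetope_iso_maps(2)[OF f, of k] k a by auto
    then show ?thesis using f g k a dim white_nodes(2)[OF Y k]
      by (auto simp: opetope_comp_nth compose_def opetope_iso_def)
  qed
  moreover have "on_nodes (opetope_comp Y g f ! Suc k) a = on_white (opetope_comp Y g f ! k) a"
    if k: "k < op_dim Y" and a: "a \<in> whitedots (trees Y ! k) (subs Y ! k)" for k a
  proof -
    have "on_white (f ! k) a \<in> whitedots (trees Y' ! k) (subs Y' ! k)"
      using opetope_iso_maps(6)[OF f, of k] k a dim by (auto simp: sub_at_def)
    then show ?thesis using f g k a dim white_nodes(1)[OF Y k]
      by (auto simp: opetope_comp_nth compose_def opetope_iso_def sub_at_def)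
  qed
  ultimately show ?thesis using dim by (simp add: opetope_iso_def)
qed

lemma compose_id_left: "f \<in> extensional A \<Longrightarrow> f ` A \<subseteq> B \<Longrightarrow> compose A (restrict id B) f = f"
  and compose_id_right: "f \<in> extensional A \<Longrightarrow> compose A f (restrict id A) = f"
  by (auto simp: compose_def extensional_def fun_eq_iff)

lemma is_category_KJBM: "is_category KJBM"
  unfolding is_category_def
proof (intro conjI ballI)
  fix X :: "'a opetope" assume "X \<in> obj KJBM"
  then show "ident KJBM X \<in> hom KJBM X X" by (auto simp: KJBM_def opetope_iso_id)
next
  fix X Y Z :: "'a opetope" and f g
  assume "X \<in> obj KJBM" "Y \<in> obj KJBM" "Z \<in> obj KJBM" "f \<in> hom KJBM X Y" "g \<in> hom KJBM Y Z"
  then show "cmp KJBM X Y Z g f \<in> hom KJBM X Z" by (auto simp: KJBM_def intro: opetope_iso_comp)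
next
  fix X Y :: "'a opetope" and f assume "f \<in> hom KJBM X Y"
  then have f: "opetope_iso X Y f" by (simp add: KJBM_def)
  then have len: "length f = Suc (op_dim X)" and dim: "op_dim Y = op_dim X" by (simp_all add: opetope_iso_def)
  have "opetope_comp X (opetope_id Y) f = f"
  proof (rule nth_equalityI)
    fix k assume "k < length (opetope_comp X (opetope_id Y) f)"
    then have k: "k \<le> op_dim X" by (simp add: opetope_comp_def)
    show "opetope_comp X (opetope_id Y) f ! k = f ! k"
      using opetope_iso_maps[OF f k] k dim
      by (simp add: opetope_comp_nth opetope_id_nth compose_id_left)
  qed (simp add: len opetope_comp_def)
  then show "cmp KJBM X Y Y (ident KJBM Y) f = f" by (simp add: KJBM_def)
  have "opetope_comp X f (opetope_id X) = f"
  proof (rule nth_equalityI)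
    fix k assume "k < length (opetope_comp X f (opetope_id X))"
    then have k: "k \<le> op_dim X" by (simp add: opetope_comp_def)
    show "opetope_comp X f (opetope_id X) ! k = f ! k"
      using opetope_iso_maps[OF f k] k
      by (simp add: opetope_comp_nth opetope_id_nth compose_id_right)
  qed (simp add: len opetope_comp_def)
  then show "cmp KJBM X X Y f (ident KJBM X) = f" by (simp add: KJBM_def)
next
  fix X Y Z V :: "'a opetope" and f g h
  assume "f \<in> hom KJBM X Y" "g \<in> hom KJBM Y Z"
  then have f: "opetope_iso X Y f" and g: "opetope_iso Y Z g" by (simp_all add: KJBM_def)
  have dim: "op_dim Y = op_dim X" using f by (simp add: opetope_iso_def)
  have "opetope_comp X h (opetope_comp X g f) = opetope_comp X (opetope_comp Y h g) f"
  proof (rule nth_equalityI)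
    fix k assume "k < length (opetope_comp X h (opetope_comp X g f))"
    then have k: "k \<le> op_dim X" by (simp add: opetope_comp_def)
    note m = opetope_iso_maps[OF f k]
    show "opetope_comp X h (opetope_comp X g f) ! k = opetope_comp X (opetope_comp Y h g) f ! k"
      using k dim m(2,4,6)[THEN equalityD1]
      by (simp add: opetope_comp_nth compose_assoc image_subset_iff_funcset)
  qed (simp add: opetope_comp_def)
  then show "cmp KJBM X Z V h (cmp KJBM X Y Z g f) = cmp KJBM X Y V (cmp KJBM Y Z V h g) f"
    by (simp add: KJBM_def)
qed

section \<open>Functoriality\<close>

text \<open>Equivalences on pairs of cells are required rather than implications, so that the same
  rule applies to the inverse map.\<close>

lemma mop_morphismI:
  assumes C: "is_mop C" and D: "is_mop D" and h: "bij_betw h (cells C) (cells D)" "h \<in> extensional (cells C)"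
    and dim: "\<And>x. x \<in> cells C \<Longrightarrow> dim D (h x) = dim C x"
    and dlt: "\<And>x y. x \<in> cells C \<Longrightarrow> y \<in> cells C \<Longrightarrow> h y \<in> dlt D (h x) \<longleftrightarrow> y \<in> dlt C x"
    and gam: "\<And>x y. x \<in> cells C \<Longrightarrow> y \<in> cells C \<Longrightarrow> h y \<in> gam D (h x) \<longleftrightarrow> y \<in> gam C x"
    and lord: "\<And>x y y' z. x \<in> cells C \<Longrightarrow> y \<in> cells C \<Longrightarrow> y' \<in> cells C \<Longrightarrow> z \<in> cells C \<Longrightarrow>
      (h y, h y') \<in> lord D (h x) (h z) \<longleftrightarrow> (y, y') \<in> lord C x z"
  shows "mop_morphism C D h"
proof -
  have img: "h ` A = B" if A: "A \<subseteq> cells C" "B \<subseteq> cells D" and iff: "\<And>y. y \<in> cells C \<Longrightarrow> h y \<in> B \<longleftrightarrow> y \<in> A" for A B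
  proof
    show "h ` A \<subseteq> B" using A iff by auto
    show "B \<subseteq> h ` A"
    proof
      fix d assume d: "d \<in> B"
      then have "d \<in> h ` cells C" using A h(1) by (auto simp: bij_betw_def)
      then show "d \<in> h ` A" using d iff by auto
    qed
  qed
  have "h ` dlt C x = dlt D (h x)" "h ` gam C x = gam D (h x)" if "x \<in> cells C" for x
    using that img[OF mop_faces(1)[OF C] mop_faces(1)[OF D]] img[OF mop_faces(2)[OF C] mop_faces(2)[OF D]]
      dlt gam by simp_all
  moreover have "inj_on h (dlt C x)" for x
    using h(1) mop_faces(1)[OF C] by (auto simp: bij_betw_def intro: inj_on_subset)
  moreover have "h \<in> cells C \<rightarrow>\<^sub>E cells D" using h by (auto simp: bij_betw_def PiE_iff)
  ultimately show ?thesis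
    using dim lord mop_lord[OF C] unfolding mop_morphism_def bij_betw_def by auto
qed

lemma mop_iso_core:
  assumes C: "C \<in> obj DFC" and D: "D \<in> obj DFC" and h: "bij_betw h (cells C) (cells D)" "h \<in> extensional (cells C)"
    and dim: "\<And>x. x \<in> cells C \<Longrightarrow> dim D (h x) = dim C x"
    and dlt: "\<And>x y. x \<in> cells C \<Longrightarrow> y \<in> cells C \<Longrightarrow> h y \<in> dlt D (h x) \<longleftrightarrow> y \<in> dlt C x"
    and gam: "\<And>x y. x \<in> cells C \<Longrightarrow> y \<in> cells C \<Longrightarrow> h y \<in> gam D (h x) \<longleftrightarrow> y \<in> gam C x"
    and lord: "\<And>x y y' z. x \<in> cells C \<Longrightarrow> y \<in> cells C \<Longrightarrow> y' \<in> cells C \<Longrightarrow> z \<in> cells C \<Longrightarrow>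
      (h y, h y') \<in> lord D (h x) (h z) \<longleftrightarrow> (y, y') \<in> lord C x z"
  shows "h \<in> hom DFC_core C D"
proof -
  have mop: "is_mop C" "is_mop D" using C D by (simp_all add: DFC_def full_subcat_def MOP_def)
  define g where "g = restrict (inv_into (cells C) h) (cells D)"
  have hg: "h (g d) = d" "g d \<in> cells C" if "d \<in> cells D" for d
    using that h(1) by (auto simp: g_def bij_betw_inv_into_right bij_betw_def inv_into_into)
  have gh: "g (h c) = c" "h c \<in> cells D" if "c \<in> cells C" for c
    using that h(1) by (auto simp: g_def bij_betw_inv_into_left bij_betw_def)
  have g: "bij_betw g (cells D) (cells C)"
    by (rule bij_betwI[of _ _ _ h]) (use hg gh in auto)
  have "mop_morphism C D h" using mop h dim dlt gam lord by (rule mop_morphismI)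
  moreover have "mop_morphism D C g"
  proof (rule mop_morphismI[OF mop(2,1) g])
    show "g \<in> extensional (cells D)" by (simp add: g_def)
    show "dim C (g x) = dim D x" if "x \<in> cells D" for x
      using that hg dim[of "g x"] by simp
    show "g y \<in> dlt C (g x) \<longleftrightarrow> y \<in> dlt D x" if "x \<in> cells D" "y \<in> cells D" for x y
      using that hg dlt[of "g x" "g y"] by simp
    show "g y \<in> gam C (g x) \<longleftrightarrow> y \<in> gam D x" if "x \<in> cells D" "y \<in> cells D" for x y
      using that hg gam[of "g x" "g y"] by simp
    show "(g y, g y') \<in> lord C (g x) (g z) \<longleftrightarrow> (y, y') \<in> lord D x z"
      if "x \<in> cells D" "y \<in> cells D" "y' \<in> cells D" "z \<in> cells D" for x y y' z
      using that hg lord[of "g x" "g y" "g y'" "g z"] by simp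
  qed
  moreover have "compose (cells C) g h = restrict id (cells C)" "compose (cells D) h g = restrict id (cells D)"
    using hg gh by (auto simp: compose_def fun_eq_iff)
  ultimately show ?thesis
    by (auto simp: DFC_core_def core_def DFC_def full_subcat_def MOP_def)
qed

text \<open>Shows that a face-preserving bijection preserves the domain of the local orders, which
  depends on the faces alone.\<close>

lemma bd2_bij:
  assumes C: "is_mop C" and D: "is_mop D" and h: "bij_betw h (cells C) (cells D)"
    and dlt: "\<And>x y. x \<in> cells C \<Longrightarrow> y \<in> cells C \<Longrightarrow> h y \<in> dlt D (h x) \<longleftrightarrow> y \<in> dlt C x"
    and gam: "\<And>x y. x \<in> cells C \<Longrightarrow> y \<in> cells C \<Longrightarrow> h y \<in> gam D (h x) \<longleftrightarrow> y \<in> gam C x"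
    and x: "x \<in> cells C" and z: "z \<in> cells C"
  shows "h z \<in> bd2 D (h x) \<longleftrightarrow> z \<in> bd2 C x" "h x \<in> Lam D \<longleftrightarrow> x \<in> Lam C"
proof -
  have surj: "\<exists>c\<in>cells C. d = h c" if "d \<in> cells D" for d
    using that h by (auto simp: bij_betw_def)
  have into: "h c \<in> cells D" if "c \<in> cells C" for c using that h by (auto simp: bij_betw_def)
  have bd: "h y \<in> bd D (h x) \<longleftrightarrow> y \<in> bd C x" if "x \<in> cells C" "y \<in> cells C" for x y
    using that dlt gam by (simp add: bd_def)
  show "h z \<in> bd2 D (h x) \<longleftrightarrow> z \<in> bd2 C x"
  proof
    assume "h z \<in> bd2 D (h x)"
    then obtain d where d: "d \<in> bd D (h x)" "h z \<in> bd D d" by (auto simp: bd2_def)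
    then obtain c where "c \<in> cells C" "d = h c" using surj mop_faces(3)[OF D] by blast
    then show "z \<in> bd2 C x" using d bd x z by (auto simp: bd2_def)
  next
    assume "z \<in> bd2 C x"
    then obtain c where c: "c \<in> bd C x" "z \<in> bd C c" by (auto simp: bd2_def)
    then have "c \<in> cells C" using mop_faces(3)[OF C] by auto
    then have "h c \<in> bd D (h x)" "h z \<in> bd D (h c)" using c bd x z by simp_all
    then show "h z \<in> bd2 D (h x)" by (auto simp: bd2_def)
  qed
  have plus: "h y \<in> gam_plus D (h x) \<longleftrightarrow> y \<in> gam_plus C x" if "x \<in> cells C" "y \<in> cells C" for x y
    using that dlt gam by (simp add: gam_plus_def)
  have "(\<exists>d\<in>cells D. h x \<in> gam_plus D d) \<longleftrightarrow> (\<exists>c\<in>cells C. x \<in> gam_plus C c)"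
    using surj into plus x by metis
  then show "h x \<in> Lam D \<longleftrightarrow> x \<in> Lam C" using x into by (auto simp: Lam_def)
qed

lemma opetopic_obj_DFC: "n_opetope n Y \<Longrightarrow> P_obj Y \<in> obj DFC"
  using opetopic.is_dfc_P[of Y n] by (simp add: opetopic_def DFC_def full_subcat_def MOP_def is_dfc_def)

text \<open>By exactness one family of maps is enough: \<open>\<phi> k\<close> acts on the edges of
  the tree of index \<open>k\<close>, \<open>\<phi> (Suc k)\<close> on its nodes, and
  \<open>\<phi> (Suc (Suc k))\<close> on its white dots.\<close>

locale opetopic_iso = Y: opetopic Y n + Y': opetopic Y' n for Y Y' :: "'a opetope" and n +
  fixes f :: "'a opetope_map"
  assumes iso: "opetope_iso Y Y' f"
begin

abbreviation "\<phi> k \<equiv> ext_map_edges Y f k"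
abbreviation "Pf \<equiv> P_arr Y Y' f"

lemma tree_level:
  assumes "k \<le> n"
  shows "subdivided_tree_iso (trees Y ! k) (sub_at Y k) (trees Y' ! k) (sub_at Y' k) (f ! k)"
  using iso assms Y.dim_Y by (simp add: opetope_iso_def)

lemma map_edges: "k \<le> n \<Longrightarrow> \<phi> k (Old e) = Old (on_edges (f ! k) e)"
  by (simp add: ext_map_edges_def Y.dim_Y)

lemma map_nodes:
  assumes "k \<le> n" "a \<in> nodes (trees Y ! k)"
  shows "\<phi> (Suc k) (Old a) = Old (on_nodes (f ! k) a)"
  using assms iso Y.dim_Y by (cases "k = n") (auto simp: ext_map_edges_def opetope_iso_def)

lemma map_white:
  assumes "k < n" "w \<in> whitedots (trees Y ! k) (subs Y ! k)"
  shows "\<phi> (Suc (Suc k)) (Old w) = Old (on_white (f ! k) w)"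
proof -
  have "w \<in> nodes (trees Y ! Suc k)" using white_nodes(1)[OF Y.Y, of k] assms Y.dim_Y by auto
  then have "\<phi> (Suc (Suc k)) (Old w) = Old (on_nodes (f ! Suc k) w)" using assms by (intro map_nodes) auto
  then show ?thesis using assms iso Y.dim_Y by (simp add: opetope_iso_def)
qed

lemma map_Top [simp]: "\<phi> k Top = Top" "\<phi> k Top_Root = Top_Root"
  by (simp_all add: ext_map_edges_def)

lemma tree_iso_level:
  assumes "k \<le> Suc (Suc n)"
  shows "tree_iso (Y.S k) (\<phi> (Suc k)) (\<phi> k) (Y'.S k)"
proof -
  consider "k \<le> n" | "k = Suc n" | "k = Suc (Suc n)" using assms by linarith
  then show ?thesis
  proof cases
    case 1
    let ?T = "trees Y ! k" and ?T' = "trees Y' ! k" and ?fn = "on_nodes (f ! k)" and ?fe = "on_edges (f ! k)"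
    note t = tree_level[OF 1, unfolded subdivided_tree_iso_def]
    interpret T: rtree ?T using opetope_rooted[OF Y.Y 1] by unfold_locales
    interpret oT: tree_iso ?T Old Old "old_tree ?T" using T.rooted by (rule old_tree_iso)
    have S: "Y.S k = old_tree ?T" "Y'.S k = old_tree ?T'"
      using 1 Y.dim_Y Y'.dim_Y by (simp_all add: ext_tree_def)
    have te: "a \<in> nodes ?T" "b \<in> edges ?T" if "(a, b) \<in> tgt_edge ?T" for a b using that T.te_sub by auto
    have tn: "a \<in> nodes ?T" "b \<in> edges ?T" if "(b, a) \<in> tgt_node ?T" for a b using that T.tn_sub by auto
    have nodes: "\<phi> (Suc k) (Old a) = Old (?fn a)" if "a \<in> nodes ?T" for a using 1 that by (rule map_nodes)
    note edges = map_edges[OF 1]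
    show ?thesis unfolding S
    proof unfold_locales
      show "rooted_tree (old_tree ?T)" by (rule oT.rooted_image)
      show "inj_on (\<phi> (Suc k)) (nodes (old_tree ?T))"
        using t nodes by (auto simp: old_tree_def inj_on_def bij_betw_def)
      show "inj_on (\<phi> k) (edges (old_tree ?T))"
        using t edges by (auto simp: old_tree_def inj_on_def bij_betw_def)
      have "nodes ?T' = ?fn ` nodes ?T" "edges ?T' = ?fe ` edges ?T" using t by (auto simp: bij_betw_def)
      then show "nodes (old_tree ?T') = \<phi> (Suc k) ` nodes (old_tree ?T)"
        "edges (old_tree ?T') = \<phi> k ` edges (old_tree ?T)"
        using nodes edges by (simp_all add: old_tree_def image_image)
      have "tgt_edge ?T' = map_prod ?fn ?fe ` tgt_edge ?T" "tgt_node ?T' = map_prod ?fe ?fn ` tgt_node ?T"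
        using t by auto
      then show "tgt_edge (old_tree ?T') = map_prod (\<phi> (Suc k)) (\<phi> k) ` tgt_edge (old_tree ?T)"
        "tgt_node (old_tree ?T') = map_prod (\<phi> k) (\<phi> (Suc k)) ` tgt_node (old_tree ?T)"
        using nodes edges te tn by (auto simp: old_tree_def image_image intro!: image_cong)
      show "root (old_tree ?T') = \<phi> k (root (old_tree ?T))"
        using t edges by (simp add: old_tree_def)
    qed
  next
    case 2
    let ?N = "nodes (trees Y ! n)"
    have bij: "bij_betw (on_nodes (f ! n)) ?N (nodes (trees Y' ! n))"
      using tree_level[of n] by (simp add: subdivided_tree_iso_def)
    have nodes: "\<phi> (Suc n) (Old a) = Old (on_nodes (f ! n) a)" if "a \<in> ?N" for a
      using that by (intro map_nodes) auto
    have S: "Y.S k = corolla Top (Old ` ?N) Top_Root" "Y'.S k = corolla Top (Old ` nodes (trees Y' ! n)) Top_Root"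
      using 2 Y.dim_Y Y'.dim_Y by (simp_all add: ext_tree_def)
    have N: "Old ` nodes (trees Y' ! n) = \<phi> (Suc n) ` Old ` ?N"
      using bij nodes by (auto simp: image_image bij_betw_def)
    have inj: "inj_on (\<phi> (Suc n)) (insert Top_Root (Old ` ?N))"
      using bij nodes by (auto simp: inj_on_def bij_betw_def)
    have sources: "Old ` nodes (trees Y' ! n) \<times> {Top} =
        map_prod (\<phi> (Suc n)) (\<phi> (Suc (Suc n))) ` (Old ` ?N \<times> {Top})"
      unfolding N map_prod_def by (simp add: image_paired_Times)
    show ?thesis unfolding S unfolding 2
    proof unfold_locales
      show "rooted_tree (corolla Top (Old ` ?N) Top_Root)"
        using opetope_rooted[OF Y.Y, of n] by (intro rooted_corolla) (auto simp: rooted_tree_def)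
      show "tgt_node (corolla Top (Old ` nodes (trees Y' ! n)) Top_Root) =
          map_prod (\<phi> (Suc n)) (\<phi> (Suc (Suc n))) ` tgt_node (corolla Top (Old ` ?N) Top_Root)"
        by (simp add: corolla_def sources)
    qed (use inj N in \<open>auto simp: corolla_def\<close>)
  next
    case 3
    then have S: "Y.S k = unit_tree Top" "Y'.S k = unit_tree Top"
      using Y.dim_Y Y'.dim_Y by (simp_all add: ext_tree_def)
    show ?thesis unfolding S
      by unfold_locales (auto simp: rooted_unit, auto simp: unit_tree_def)
  qed
qed

lemma white_level:
  assumes "k \<le> Suc n" "b \<in> edges (Y.S k)"
  shows "Y'.W k (\<phi> k b) = map (\<phi> (Suc (Suc k))) (Y.W k b)"
proof -
  consider "k < n" | "k = n" | "k = Suc n" using assms by linarith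
  then show ?thesis
  proof cases
    case 1
    then obtain e where e: "b = Old e" "e \<in> edges (trees Y ! k)"
      using assms(2) Y.dim_Y by (auto simp: ext_tree_def old_tree_def)
    have sub: "sub_at Y' k (on_edges (f ! k) e) = map (on_white (f ! k)) (sub_at Y k e)"
      using tree_level[of k] 1 e by (auto simp: subdivided_tree_iso_def)
    have "Old (on_white (f ! k) w) = \<phi> (Suc (Suc k)) (Old w)" if w: "w \<in> set (sub_at Y k e)" for w
    proof -
      have "w \<in> whitedots (trees Y ! k) (subs Y ! k)"
        using w e 1 Y.dim_Y by (auto simp: sub_at_def whitedots_def)
      then show ?thesis using map_white[OF 1] by simp
    qed
    then show ?thesis using 1 e sub Y.dim_Y Y'.dim_Y
      by (auto simp: ext_white_def ext_sub_def map_edges)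
  next
    case 2
    interpret tree_iso "Y.S n" "\<phi> (Suc n)" "\<phi> n" "Y'.S n" by (rule tree_iso_level) simp
    \<comment> \<open>The auxiliary white dot is present on both sides or on neither, and
      \<open>Top\<close> is fixed.\<close>
    have "nodes (trees Y' ! n) = {} \<longleftrightarrow> nodes (trees Y ! n) = {}"
      using tree_level[of n] by (auto simp: subdivided_tree_iso_def bij_betw_def)
    moreover have "\<phi> n b \<in> edges (Y'.S n)" using assms 2 by (simp add: edges_image)
    ultimately show ?thesis using 2 assms Y.dim_Y Y'.dim_Y
      by (simp add: ext_white_def ext_sub_empty)
  next
    case 3
    then show ?thesis using Y.dim_Y Y'.dim_Y by (simp add: ext_white_def ext_sub_empty)
  qed
qed

lemma exact_iso_level:
  assumes "k \<le> Suc n"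
  shows "exact_iso (Y.S k) (Y.W k) (Y.S (Suc k)) (\<phi> (Suc (Suc k))) (\<phi> (Suc k)) (\<phi> k)
    (Y'.S k) (Y'.S (Suc k)) (Y'.W k)"
  using Y.exact_level[OF assms] tree_iso_level[of k] tree_iso_level[of "Suc k"] white_level[OF assms] assms
  by (simp add: exact_iso_def exact_iso_axioms_def)

lemma edges_bij:
  assumes "k \<le> Suc (Suc n)"
  shows "bij_betw (\<phi> k) (edges (Y.S k)) (edges (Y'.S k))"
proof -
  interpret tree_iso "Y.S k" "\<phi> (Suc k)" "\<phi> k" "Y'.S k" using assms by (rule tree_iso_level)
  show ?thesis by (simp add: bij_betw_def inj_edges edges_image)
qed

lemma edges_into: "k \<le> n \<Longrightarrow> x \<in> edges (Y.S (Suc (Suc k))) \<Longrightarrow> \<phi> (Suc (Suc k)) x \<in> edges (Y'.S (Suc (Suc k)))"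
  using edges_bij[of "Suc (Suc k)"] by (auto simp: bij_betw_def)

lemma root_map: "root (Y'.S 1) = \<phi> 1 (root (Y.S 1))"
proof -
  interpret tree_iso "Y.S 1" "\<phi> (Suc 1)" "\<phi> 1" "Y'.S 1" by (rule tree_iso_level) simp
  show ?thesis by (rule root_image)
qed

lemma P_arr_cell: "k \<le> n \<Longrightarrow> x \<in> edges (Y.S (Suc (Suc k))) \<Longrightarrow> Pf (int k, x) = (int k, \<phi> (Suc (Suc k)) x)"
proof -
  have "nat (int k + 2) = Suc (Suc k)" by simp
  then show "k \<le> n \<Longrightarrow> x \<in> edges (Y.S (Suc (Suc k))) \<Longrightarrow> ?thesis" by (simp add: P_arr_def)
qed

lemma P_arr_bottom: "Pf (-1, root (Y.S 1)) = (-1, root (Y'.S 1))"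
  unfolding root_map by (simp add: P_arr_def)

text \<open>Includes \<open>k = 0\<close>, where the face is the bottom cell and the relevant tree
  is the one of index 1. This lets all dimensions be treated alike.\<close>

lemma P_arr_below:
  assumes "k \<le> n" "(int k - 1, z) \<in> P_cells Y"
  shows "Pf (int k - 1, z) = (int k - 1, \<phi> (Suc k) z)" "z \<in> edges (Y.S (Suc k))"
proof -
  interpret exact "Y.S 1" "Y.W 1" "Y.S (Suc 1)" by (rule Y.exact_level) simp
  show "Pf (int k - 1, z) = (int k - 1, \<phi> (Suc k) z)" "z \<in> edges (Y.S (Suc k))"
    using assms P_arr_bottom root_map P_arr_cell[of "k - 1" z] T.root_edge by (cases k; simp)+
qed

lemma P_arr_fst: "c \<in> P_cells Y \<Longrightarrow> fst (Pf c) = fst c"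
  by (elim Y.cell_cases) (auto simp: P_arr_cell P_arr_bottom simp del: One_nat_def)

lemma P_arr_bij: "bij_betw Pf (P_cells Y) (P_cells Y')"
  unfolding bij_betw_def
proof
  show "inj_on Pf (P_cells Y)"
  proof (rule inj_onI)
    fix c c' assume c: "c \<in> P_cells Y" "c' \<in> P_cells Y" "Pf c = Pf c'"
    have d: "fst c = fst c'" using c P_arr_fst by metis
    from c(1) show "c = c'"
    proof (cases rule: Y.cell_cases)
      case 1
      then show ?thesis using c(2) d by (elim Y.cell_cases) auto
    next
      case (2 k x)
      then obtain x' where x': "c' = (int k, x')" "x' \<in> edges (Y.S (Suc (Suc k)))"
        using c(2) d by (elim Y.cell_cases) auto
      then have "\<phi> (Suc (Suc k)) x = \<phi> (Suc (Suc k)) x'" using c(3) 2 P_arr_cell by simp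
      then have "x = x'" using edges_bij[of "Suc (Suc k)"] 2 x' by (auto simp: bij_betw_def inj_on_def)
      then show ?thesis using 2 x' by simp
    qed
  qed
  show "Pf ` P_cells Y = P_cells Y'"
  proof
    show "Pf ` P_cells Y \<subseteq> P_cells Y'"
    proof (rule image_subsetI)
      fix c assume "c \<in> P_cells Y"
      then show "Pf c \<in> P_cells Y'"
        by (cases rule: Y.cell_cases) (simp_all add: P_arr_bottom P_arr_cell edges_into del: One_nat_def)
    qed
    show "P_cells Y' \<subseteq> Pf ` P_cells Y"
    proof
      fix c assume "c \<in> P_cells Y'"
      then show "c \<in> Pf ` P_cells Y"
      proof (cases rule: Y'.cell_cases)
        case 1
        have "(-1, root (Y.S 1)) \<in> P_cells Y" by simp
        from imageI[OF this, of Pf] show ?thesis unfolding P_arr_bottom 1 .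
      next
        case (2 k x)
        then obtain x0 where x0: "x0 \<in> edges (Y.S (Suc (Suc k)))" "x = \<phi> (Suc (Suc k)) x0"
          using edges_bij[of "Suc (Suc k)"] by (auto simp: bij_betw_def)
        then have "(int k, x0) \<in> P_cells Y" using 2 by simp
        from imageI[OF this, of Pf] show ?thesis using 2 x0 P_arr_cell by simp
      qed
    qed
  qed
qed

lemma P_arr_into: "c \<in> P_cells Y \<Longrightarrow> Pf c \<in> P_cells Y'"
  using P_arr_bij by (auto simp: bij_betw_def)

lemma level_image:
  assumes "k \<le> Suc n" "z \<in> edges (Y.S k)" "x \<in> edges (Y.S (Suc k))"
  shows "fplus (Y'.S k) (Y'.S (Suc k)) (\<phi> k z) (\<phi> (Suc k) x) \<longleftrightarrow> fplus (Y.S k) (Y.S (Suc k)) z x"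
    "fminus (Y'.S k) (Y'.S (Suc k)) (\<phi> k z) (\<phi> (Suc k) x) \<longleftrightarrow> fminus (Y.S k) (Y.S (Suc k)) z x"
    "floop (Y'.S k) (Y'.W k) (Y'.S (Suc k)) (\<phi> k z) (\<phi> (Suc k) x) \<longleftrightarrow> floop (Y.S k) (Y.W k) (Y.S (Suc k)) z x"
proof -
  interpret exact_iso "Y.S k" "Y.W k" "Y.S (Suc k)" "\<phi> (Suc (Suc k))" "\<phi> (Suc k)" "\<phi> k"
    "Y'.S k" "Y'.S (Suc k)" "Y'.W k" using assms(1) by (rule exact_iso_level)
  show "fplus (Y'.S k) (Y'.S (Suc k)) (\<phi> k z) (\<phi> (Suc k) x) \<longleftrightarrow> fplus (Y.S k) (Y.S (Suc k)) z x"
    "fminus (Y'.S k) (Y'.S (Suc k)) (\<phi> k z) (\<phi> (Suc k) x) \<longleftrightarrow> fminus (Y.S k) (Y.S (Suc k)) z x"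
    "floop (Y'.S k) (Y'.W k) (Y'.S (Suc k)) (\<phi> k z) (\<phi> (Suc k) x) \<longleftrightarrow> floop (Y.S k) (Y.W k) (Y.S (Suc k)) z x"
    using assms(2,3) by (simp_all add: fplus_def fminus_def src_in_image tgt_in_image floop_image)
qed

lemma P_arr_dlt: "c \<in> P_cells Y \<Longrightarrow> c' \<in> P_cells Y \<Longrightarrow> Pf c' \<in> dlt Y'.C (Pf c) \<longleftrightarrow> c' \<in> dlt Y.C c"
  and P_arr_gam: "c \<in> P_cells Y \<Longrightarrow> c' \<in> P_cells Y \<Longrightarrow> Pf c' \<in> gam Y'.C (Pf c) \<longleftrightarrow> c' \<in> gam Y.C c"
proof -
  assume c: "c \<in> P_cells Y" and c': "c' \<in> P_cells Y"
  have "(Pf c' \<in> dlt Y'.C (Pf c) \<longleftrightarrow> c' \<in> dlt Y.C c) \<and> (Pf c' \<in> gam Y'.C (Pf c) \<longleftrightarrow> c' \<in> gam Y.C c)"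
    using c
  proof (cases rule: Y.cell_cases)
    case 1
    then show ?thesis using P_arr_bottom Y.bottom_faces Y'.bottom_faces by simp
  next
    case (2 k x)
    note x' = edges_into[OF 2(1,2)]
    obtain d z where z: "c' = (d, z)" by force
    obtain z' where hz: "Pf c' = (d, z')" using P_arr_fst[OF c'] z by (cases "Pf c'") auto
    show ?thesis
    proof (cases "d = int k - 1")
      case True
      then have z': "z' = \<phi> (Suc k) z" "z \<in> edges (Y.S (Suc k))"
        using P_arr_below[OF 2(1), of z] c' hz z by auto
      show ?thesis
        unfolding hz unfolding z 2(3) P_arr_cell[OF 2(1,2)] Y.P_obj_fields Y'.P_obj_fields
          Y.mem_dlt[OF 2(1,2)] Y.mem_gam[OF 2(1,2)] Y'.mem_dlt[OF 2(1) x'] Y'.mem_gam[OF 2(1) x'] z'(1)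
        using level_image[of "Suc k" z x] 2 z' by simp
    next
      case False
      then show ?thesis
        unfolding hz unfolding z 2(3) P_arr_cell[OF 2(1,2)] Y.P_obj_fields Y'.P_obj_fields
          Y.mem_dlt[OF 2(1,2)] Y.mem_gam[OF 2(1,2)] Y'.mem_dlt[OF 2(1) x'] Y'.mem_gam[OF 2(1) x'] by simp
    qed
  qed
  then show "Pf c' \<in> dlt Y'.C (Pf c) \<longleftrightarrow> c' \<in> dlt Y.C c" "Pf c' \<in> gam Y'.C (Pf c) \<longleftrightarrow> c' \<in> gam Y.C c"
    by auto
qed

lemma P_arr_lord:
  assumes c: "c \<in> P_cells Y" and y: "u \<in> P_cells Y" and y': "u' \<in> P_cells Y" and b: "b \<in> P_cells Y"
  shows "(Pf u, Pf u') \<in> lord Y'.C (Pf c) (Pf b) \<longleftrightarrow> (u, u') \<in> lord Y.C c b"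
proof -
  have bd2: "Pf b \<in> bd2 Y'.C (Pf c) \<longleftrightarrow> b \<in> bd2 Y.C c" and Lam: "Pf c \<in> Lam Y'.C \<longleftrightarrow> c \<in> Lam Y.C"
    using bd2_bij[OF Y.is_mop_P Y'.is_mop_P, of Pf c b] P_arr_bij P_arr_dlt P_arr_gam c b by auto
  have low: "(w, w') \<in> lord C x z \<Longrightarrow> z \<in> bd2 C x" if "is_mop C" for C :: "'a cell mop" and w w' x z
    using mop_lord(2)[OF that] .
  from c show ?thesis
  proof (cases rule: Y.cell_cases)
    case 1
    then have "b \<notin> bd2 Y.C c" by (simp add: bd2_def bd_def Y.bottom_faces)
    then show ?thesis using bd2 low[OF Y.is_mop_P] low[OF Y'.is_mop_P] by blast
  next
    case (2 k x)
    note x' = edges_into[OF 2(1,2)]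
    obtain d y1 d' y2 e z where u: "u = (d, y1)" "u' = (d', y2)" "b = (e, z)" by (metis surj_pair)
    obtain y1' y2' z' where hu: "Pf u = (d, y1')" "Pf u' = (d', y2')" "Pf b = (e, z')"
      using P_arr_fst[OF y] P_arr_fst[OF y'] P_arr_fst[OF b] u by (metis fst_conv surj_pair)
    have hc: "Pf c = (int k, \<phi> (Suc (Suc k)) x)" using P_arr_cell[OF 2(1,2)] 2(3) by simp
    show ?thesis
    proof (cases "k > 0 \<and> d = int k - 1 \<and> d' = int k - 1 \<and> e = int k - 2")
      case True
      \<comment> \<open>The dimension of \<open>z\<close> takes the form required by
        \<open>P_arr_below\<close> at index \<open>k - 1\<close>; \<open>k > 0\<close> keeps the
        subtraction honest.\<close>
      then have j: "k = Suc (k - 1)" "k - 1 \<le> n" "e = int (k - 1) - 1" using 2(1) by auto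
      have z: "z' = \<phi> k z" "z \<in> edges (Y.S k)"
        using P_arr_below[OF j(2), of z] b hu u j by auto
      have Y1: "y1' = \<phi> (Suc k) y1" "y1 \<in> edges (Y.S (Suc k))"
        and Y2: "y2' = \<phi> (Suc k) y2" "y2 \<in> edges (Y.S (Suc k))"
        using P_arr_below[OF 2(1)] y y' hu u True by auto
      have neq: "y1' \<noteq> y2' \<longleftrightarrow> y1 \<noteq> y2"
        using Y1 Y2 edges_bij[of "Suc k"] 2(1) by (auto simp: bij_betw_def inj_on_def)
      interpret exact_iso "Y.S k" "Y.W k" "Y.S (Suc k)" "\<phi> (Suc (Suc k))" "\<phi> (Suc k)" "\<phi> k"
        "Y'.S k" "Y'.S (Suc k)" "Y'.W k" using 2(1) by (intro exact_iso_level) simp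
      have before: "before (Y'.W k) (Y'.S (Suc k)) z' y1' y2' \<longleftrightarrow> before (Y.W k) (Y.S (Suc k)) z y1 y2"
        using before_image[OF z(2) Y1(2) Y2(2)] z Y1 Y2 by simp
      show ?thesis
        using bd2 Lam level_image(3)[of k z y1] level_image(3)[of k z y2] neq before
          level_image(2)[of "Suc k" y1 x] level_image(2)[of "Suc k" y2 x] 2 z Y1 Y2
        unfolding hu hc unfolding u 2(3) Y.mem_lord[OF 2(1,2)] Y'.mem_lord[OF 2(1) x'] by simp
    next
      case False
      then show ?thesis
        unfolding hu hc unfolding u 2(3) Y.mem_lord[OF 2(1,2)] Y'.mem_lord[OF 2(1) x'] by auto
    qed
  qed
qed

lemma P_arr_hom: "Pf \<in> hom DFC_core Y.C Y'.C"
proof (rule mop_iso_core)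
  show "Y.C \<in> obj DFC" "Y'.C \<in> obj DFC" using Y.Y Y'.Y by (simp_all add: opetopic_obj_DFC)
  show "bij_betw Pf (cells Y.C) (cells Y'.C)" using P_arr_bij by simp
  show "Pf \<in> extensional (cells Y.C)" by (simp add: P_arr_def)
  show "dim Y'.C (Pf x) = dim Y.C x" if "x \<in> cells Y.C" for x
    using that P_arr_fst P_arr_into by simp
qed (use P_arr_dlt P_arr_gam P_arr_lord in auto)

end

section \<open>Identities, composites and the functor\<close>

lemma opetopic_isoI:
  assumes "n_opetope n Y" "n_opetope m Y'" "opetope_iso Y Y' f"
  shows "opetopic_iso Y Y' n f"
proof -
  have "m = n" using assms op_dim_eq[OF assms(1)] op_dim_eq[OF assms(2)] by (simp add: opetope_iso_def)
  then show ?thesis using assms by (simp add: opetopic_iso_def opetopic_def opetopic_iso_axioms_def)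
qed

lemma ext_map_id:
  assumes Y: "n_opetope n Y" and k: "k \<le> Suc (Suc n)" and x: "x \<in> edges (ext_tree Y k)"
  shows "ext_map_edges Y (opetope_id Y) k x = x"
proof -
  have n: "op_dim Y = n" using Y by (rule op_dim_eq)
  consider "k \<le> n" | "k = Suc n" | "k = Suc (Suc n)" using k by linarith
  then show ?thesis
    by cases (use x n in \<open>auto simp: ext_map_edges_def ext_tree_def old_tree_def corolla_def unit_tree_def
      opetope_id_nth split: ext.split\<close>)
qed

lemma ext_map_comp:
  assumes Y: "n_opetope n Y" and dim: "op_dim Y' = op_dim Y" and k: "k \<le> Suc (Suc n)" and x: "x \<in> edges (ext_tree Y k)"
  shows "ext_map_edges Y (opetope_comp Y g f) k x = ext_map_edges Y' g k (ext_map_edges Y f k x)"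
proof -
  have n: "op_dim Y = n" using Y by (rule op_dim_eq)
  consider "k \<le> n" | "k = Suc n" | "k = Suc (Suc n)" using k by linarith
  then show ?thesis
    by cases (use x n dim in \<open>auto simp: ext_map_edges_def ext_tree_def old_tree_def corolla_def unit_tree_def
      opetope_comp_nth compose_def split: ext.split\<close>)
qed

text \<open>In dimension -1 the index \<open>d + 2\<close> is 1 and the edge is the root, so
  identities and composites need no separate case for the bottom cell.\<close>

lemma (in opetopic) cell_level:
  assumes "(d, x) \<in> P_cells Y"
  shows "nat (d + 2) \<le> Suc (Suc n)" "x \<in> edges (S (nat (d + 2)))"
proof -
  interpret exact "S 1" "W 1" "S (Suc 1)" by (rule exact_level) simp
  have "nat (int k + 2) = Suc (Suc k)" for k by simp
  then show "nat (d + 2) \<le> Suc (Suc n)" "x \<in> edges (S (nat (d + 2)))"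
    using assms T.root_edge by (auto simp: mem_cells)
qed

lemma P_arr_id:
  assumes "n_opetope n Y"
  shows "P_arr Y Y (opetope_id Y) = restrict id (P_cells Y)"
proof -
  interpret opetopic Y n using assms by unfold_locales
  show ?thesis unfolding P_arr_def
    using ext_map_id[OF assms] cell_level by (intro restrict_ext) auto
qed

lemma P_arr_comp:
  assumes Y: "n_opetope n Y" and Y': "n_opetope m Y'" and f: "opetope_iso Y Y' f" and g: "opetope_iso Y' Y'' g"
  shows "P_arr Y Y'' (opetope_comp Y g f) = compose (P_cells Y) (P_arr Y' Y'' g) (P_arr Y Y' f)"
proof -
  interpret opetopic_iso Y Y' n f using Y Y' f by (rule opetopic_isoI)
  have dim: "op_dim Y' = op_dim Y" using f by (simp add: opetope_iso_def)
  show ?thesis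
  proof (rule extensionalityI)
    fix c assume c: "c \<in> P_cells Y"
    obtain d x where dx: "c = (d, x)" by force
    have h: "P_arr Y Y' f c = (d, ext_map_edges Y f (nat (d + 2)) x)" using c dx by (simp add: P_arr_def)
    then have "(d, ext_map_edges Y f (nat (d + 2)) x) \<in> P_cells Y'" using P_arr_into[OF c] by simp
    then have "P_arr Y' Y'' g (d, ext_map_edges Y f (nat (d + 2)) x) =
        (d, ext_map_edges Y' g (nat (d + 2)) (ext_map_edges Y f (nat (d + 2)) x))"
      by (simp add: P_arr_def)
    then show "P_arr Y Y'' (opetope_comp Y g f) c = compose (P_cells Y) (P_arr Y' Y'' g) (P_arr Y Y' f) c"
      using c h ext_map_comp[OF Y dim Y.cell_level] unfolding dx
      by (simp add: compose_def P_arr_def[of Y Y''])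
  qed (auto simp: P_arr_def)
qed

theorem theorem5p21:
  shows "is_functor (KJBM :: ('a opetope, 'a opetope_map) cat)
           (DFC_core :: ('a cell mop, 'a cell \<Rightarrow> 'a cell) cat)
           P_obj P_arr"
  unfolding is_functor_def
proof (intro conjI ballI)
  show "is_category (KJBM :: ('a opetope, 'a opetope_map) cat)" by (rule is_category_KJBM)
  show "is_category (DFC_core :: ('a cell mop, 'a cell \<Rightarrow> 'a cell) cat)" by (rule is_category_DFC_core)
next
  fix X :: "'a opetope" assume "X \<in> obj KJBM"
  then obtain n where X: "n_opetope n X" by (auto simp: KJBM_def)
  show "P_obj X \<in> obj DFC_core" using opetopic_obj_DFC[OF X] by (simp add: DFC_core_def core_def)
  show "P_arr X X (ident KJBM X) = ident DFC_core (P_obj X)"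
    using P_arr_id[OF X] opetopic.P_obj_fields(1)[of X n] X
    by (simp add: KJBM_def DFC_core_def core_def DFC_def full_subcat_def MOP_def opetopic_def)
next
  fix X Y :: "'a opetope" and f assume "X \<in> obj KJBM" "Y \<in> obj KJBM" "f \<in> hom KJBM X Y"
  then obtain n m where "n_opetope n X" "n_opetope m Y" "opetope_iso X Y f" by (auto simp: KJBM_def)
  then show "P_arr X Y f \<in> hom DFC_core (P_obj X) (P_obj Y)"
    using opetopic_iso.P_arr_hom opetopic_isoI by blast
next
  fix X Y Z :: "'a opetope" and f g
  assume "X \<in> obj KJBM" "Y \<in> obj KJBM" "Z \<in> obj KJBM" "f \<in> hom KJBM X Y" "g \<in> hom KJBM Y Z"
  then obtain n m where X: "n_opetope n X" and Y: "n_opetope m Y" and fg: "opetope_iso X Y f" "opetope_iso Y Z g"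
    by (auto simp: KJBM_def)
  show "P_arr X Z (cmp KJBM X Y Z g f) = cmp DFC_core (P_obj X) (P_obj Y) (P_obj Z) (P_arr Y Z g) (P_arr X Y f)"
    using P_arr_comp[OF X Y fg] opetopic.P_obj_fields(1)[of X n] X
    by (simp add: KJBM_def DFC_core_def core_def DFC_def full_subcat_def MOP_def opetopic_def)
qed

end
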